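(* Assume conditions (C1), (C2) and (C4) below hold. Then for every $x$ satisfying (C3), \[ \mathrm{Law}_x(\hat S_n\mid \tau>n)\Rightarrow \mathrm{Law}\big(\rho W_++(1-\rho)W_-\big),\qquad n\to\infty, \] where $\rho$ is a $\{0,1\}$-valued random variable independent of $W_+$ and $W_-$ with \[ \mathbb{P}(\rho=1)=V(x)^{-1}\sum_{k=0}^\infty\mathbb{E}_x\big[u(S_{T_k});\,\tau\ge T_k,\ S_{T_k}\ge0\big]\in[0,1] \] and $V(x)=\sum_{k=0}^\infty\mathbb{E}_x[u(S_{T_k});\tau\ge T_k]$.
   Context: Let $X_1,X_2,\dots$ be i.i.d. real random variables with $\mathbb{E}[X_1]=0$ and $\sigma^2:=\mathrm{Var}(X_1)\in(0,\infty)$. Let $S_n=x+X_1+\dots+X_n$, and write $\mathbb{P}_x$ and $\mathbb{E}_x$ for probability and expectation when $S_0=x$. For an event $A$, $\mathbb{E}[X;A]:=\mathbb{E}[X\mathbf 1_A]$. Zero-crossing times: $T_0:=0$ and \[ T_{k+1}:=\inf\{n>T_k:\ S_n<0 \text{ if } S_{T_k}\ge0,\ \text{or } S_n\ge0 \text{ if } S_{T_k}<0\}. \] Absorption: let $U$ be either a real random variable or a sequence of real random variables. Let $U_0,U_1,\dots$ be independent copies of $U$, also independent of the walk. For each $i\in\mathbb{N}_0$ let $K_i$ be a measurable $\{0,1\}$-valued function of $(U\text{-value},\,\text{position})$. Define \[ \tau:=\inf\{n:\ \exists k\ge0 \text{ with } T_k\le n<T_{k+1} \text{ and } K_{n-T_k}(U_k,S_n)=1\}.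 \] Rescaled process: $\hat S_n$ is the continuous process on $[0,1]$ with $\hat S_n(m/n)=S_m/(\sigma n^{1/2})$ for $m=0,\dots,n$, linearly interpolated in between. For an event $A$, $\mathrm{Law}_y(\hat S_n\mid A)$ is the law on $(C([0,1]),\|\cdot\|_\infty)$ of $\hat S_n$ under $\mathbb{P}_y(\cdot\mid A)$. $\mathrm{Law}(W)$ is the law of a continuous process $W$, and $\Rightarrow$ denotes weak convergence. Conditions: - (C1): there are constants $c>0$ and $\gamma\in(0,1)$ with $\mathbb{P}_x(\tau\ge T_k)\le c\gamma^k$ for all $x\in\mathbb{R}$ and all $k\in\mathbb{N}_0$. - (C2): there is a function $u:\mathbb{R}\to\mathbb{R}$ with $n^{1/2}\,\mathbb{P}_y(\tau>n,T_1>n)\to u(y)$ for every $y\in\mathbb{R}$. - (C3) for a point $x$: there is a constant $c>0$ with $\mathbb{P}_x(\tau>n)\ge c^{-1}n^{-1/2}$ for all $n\in\mathbb{N}$. - (C4): there are continuous processes $W_+$ and $W_-$ on $[0,1]$ such that, for every $y$ with $u(y)>0$, $\mathrm{Law}_y(\hat S_n\mid\tau>n,T_1>n)\Rightarrow\mathrm{Law}(W_+)$ if $y\ge0$, and $\Rightarrow\mathrm{Law}(W_-)$ if $y<0$. *)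

theory Defs
  imports "HOL-Probability.Probability" "HOL-Library.Extended_Nat"
begin

text \<open>Random walk started at x: S_n = x + X_1 + ... + X_n.  The increments X_1, X_2, ...
  are represented by X 0, X 1, ... (index shift).\<close>
definition walk :: "(nat \<Rightarrow> 'a \<Rightarrow> real) \<Rightarrow> real \<Rightarrow> 'a \<Rightarrow> nat \<Rightarrow> real" where
  "walk X x \<omega> n = x + (\<Sum>i<n. X i \<omega>)"

definition crosses :: "(nat \<Rightarrow> real) \<Rightarrow> nat \<Rightarrow> nat \<Rightarrow> bool" where
  "crosses s t n = (if s t \<ge> 0 then s n < 0 else s n \<ge> 0)"

primrec zc_time :: "(nat \<Rightarrow> real) \<Rightarrow> nat \<Rightarrow> enat" where
  "zc_time s 0 = 0"
| "zc_time s (Suc k) =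
     (case zc_time s k of
        enat t \<Rightarrow> (if \<exists>n>t. crosses s t n then enat (LEAST n. t < n \<and> crosses s t n) else \<infinity>)
      | \<infinity> \<Rightarrow> \<infinity>)"

definition absorbed_at ::
  "(nat \<Rightarrow> real) \<Rightarrow> (nat \<Rightarrow> nat \<Rightarrow> real) \<Rightarrow> (nat \<Rightarrow> (nat \<Rightarrow> real) \<Rightarrow> real \<Rightarrow> bool) \<Rightarrow> nat \<Rightarrow> bool" where
  "absorbed_at s us K n =
     (\<exists>k. zc_time s k \<le> enat n \<and> enat n < zc_time s (Suc k) \<and>
          K (n - the_enat (zc_time s k)) (us k) (s n))"

definition absorb_time ::
  "(nat \<Rightarrow> real) \<Rightarrow> (nat \<Rightarrow> nat \<Rightarrow> real) \<Rightarrow> (nat \<Rightarrow> (nat \<Rightarrow> real) \<Rightarrow> real \<Rightarrow> bool) \<Rightarrow> enat" where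
  "absorb_time s us K =
     (if \<exists>n. absorbed_at s us K n then enat (LEAST n. absorbed_at s us K n) else \<infinity>)"

text \<open>Rescaled linearly interpolated process: hat S_n(m/n) = S_m / (sigma sqrt n).
  Only its values on [0,1] matter.\<close>
definition rescaled :: "real \<Rightarrow> (nat \<Rightarrow> real) \<Rightarrow> nat \<Rightarrow> real \<Rightarrow> real" where
  "rescaled \<sigma> s n t =
     (let r = real n * t; m = nat \<lfloor>r\<rfloor>
      in (s m + (r - real m) * (s (Suc m) - s m)) / (\<sigma> * sqrt (real n)))"

definition dist01 :: "(real \<Rightarrow> real) \<Rightarrow> (real \<Rightarrow> real) \<Rightarrow> real" where
  "dist01 f g = (SUP t\<in>{0..1}. \<bar>f t - g t\<bar>)"

definition bcont_C01 :: "((real \<Rightarrow> real) \<Rightarrow> real) \<Rightarrow> bool" where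
  "bcont_C01 F \<longleftrightarrow>
     (\<exists>B. \<forall>f. continuous_on {0..1} f \<longrightarrow> \<bar>F f\<bar> \<le> B) \<and>
     (\<forall>f. continuous_on {0..1} f \<longrightarrow>
        (\<forall>e>0. \<exists>d>0. \<forall>g. continuous_on {0..1} g \<longrightarrow> dist01 f g < d \<longrightarrow> \<bar>F f - F g\<bar> < e))"

definition law_conv_C01 ::
  "(nat \<Rightarrow> 'a measure) \<Rightarrow> (nat \<Rightarrow> 'a \<Rightarrow> real \<Rightarrow> real) \<Rightarrow> 'b measure \<Rightarrow> ('b \<Rightarrow> real \<Rightarrow> real) \<Rightarrow> bool" where
  "law_conv_C01 P Yn Q Y \<longleftrightarrow>
     (\<forall>F. bcont_C01 F \<longrightarrow> (\<lambda>n. \<integral>\<omega>. F (Yn n \<omega>) \<partial>P n) \<longlonglongrightarrow> (\<integral>\<omega>. F (Y \<omega>) \<partial>Q))"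

definition cont_process :: "'b measure \<Rightarrow> ('b \<Rightarrow> real \<Rightarrow> real) \<Rightarrow> bool" where
  "cont_process N W \<longleftrightarrow> prob_space N \<and>
     (\<forall>t\<in>{0..1}. (\<lambda>\<omega>. W \<omega> t) \<in> borel_measurable N) \<and>
     (\<forall>\<omega>\<in>space N. continuous_on {0..1} (W \<omega>))"

end

theory Submission
  imports Defs "HOL-Real_Asymp.Real_Asymp"
begin

text \<open>
  Decompose the path at the crossing times: on \<open>\<tau> > n\<close> there is a unique \<open>k\<close> with \<open>T\<^sub>k \<le> n < T\<^sub>k\<^sub>+\<^sub>1\<close>, and given
  \<open>T\<^sub>k = j \<le> \<tau>\<close> and \<open>S\<^sub>j = y\<close> the rest is a fresh walk started at \<open>y\<close>, which by (C2) and (C4) survives its first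
  excursion with probability \<open>\<sim> u(y) n\<^sup>-\<^sup>1\<^sup>/\<^sup>2\<close> and then looks like \<open>W\<^sub>+\<close> or \<open>W\<^sub>-\<close>. So each pair \<open>(k, j)\<close>
  contributes its share of \<open>V(x)\<close>, and the point is that no mass is lost in the sum over \<open>(k, j)\<close>.

  The excursion bound \<open>\<bbbP>\<^sub>y(T\<^sub>1 > n) \<le> C (1 + |y|) n\<^sup>-\<^sup>1\<^sup>/\<^sup>2\<close> follows from optional stopping, Harris' inequality
  \<open>\<bbbE>\<^sub>y[S\<^sub>n\<^sup>+; T\<^sub>1 > n] \<ge> \<bbbE>\<^sub>y[S\<^sub>n\<^sup>+] \<bbbP>\<^sub>y(T\<^sub>1 > n)\<close> and the central limit theorem, once the overshoot is controlled.
  An explicit Lyapunov function gives \<open>\<bbbE>\<^sub>y|S\<^bsub>T\<^sub>1\<^esub>| \<le> \<epsilon> |y| + C\<close> for every \<open>\<epsilon>\<close>; with (C1) this makes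
  \<open>\<bbbE>\<^sub>x[1 + |S\<^bsub>T\<^sub>k\<^esub>|; \<tau> \<ge> T\<^sub>k]\<close> decay geometrically in \<open>k\<close>.

  The late crossings, \<open>T\<^sub>k\<close> close to \<open>n\<close>, are not dominated termwise. They are dominated after averaging over \<open>n\<close>:
  \<open>N\<^sup>-\<^sup>1\<^sup>/\<^sup>2 \<Sum>\<^sub>n\<^sub><\<^sub>N \<bbbP>\<^sub>x(\<tau> > n) \<rightarrow> 2 V(x)\<close>. Since \<open>\<bbbP>\<^sub>x(\<tau> > n)\<close> is monotone in \<open>n\<close>, this bounds
  \<open>n\<^sup>1\<^sup>/\<^sup>2 \<bbbP>\<^sub>x(\<tau> > n)\<close> from above by \<open>V(x) + o(1)\<close>, and finitely many pairs \<open>(k, j)\<close> already account for almost all of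
  \<open>V(x)\<close>, so the remaining ones are negligible.
\<close>

section \<open>Weak convergence on $C([0,1])$\<close>

text \<open>(C1) bounds the number of crossings before absorption, not the positions where they take
  place. The excursion bound and \<open>u\<close> both grow linearly in the starting point, so first
  moments at the crossings must decay as well. This is why the overshoot is needed with an
  arbitrarily small slope: a slope below 1 makes the recursion from one crossing to the next a
  contraction.

  A restart at a crossing cuts off an initial piece of the path and shifts time by j / n, while (C4)
  speaks of the restarted path only. No tightness argument is made: the truncated modulus of
  continuity is itself a bounded Lipschitz functional, (C4) is applied to it, and its limit is small
  because the limit processes are continuous. For this reason everything is first proved for bounded
  Lipschitz functionals.

  Zero belongs to the upper half-line, so the two sides are not mirror images. Excursion bounds are
  proved for every set between (0, \<infinity>) and [0, \<infinity>), and then used for the walk and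
  for its reflection.

  (C3) supplies V(x) > 0, which turns the conditioning into a quotient of two limits.\<close>

definition interp :: "(nat \<Rightarrow> real) \<Rightarrow> nat \<Rightarrow> real \<Rightarrow> real" where
  "interp s n r = s 0 + (\<Sum>i<n. (s (Suc i) - s i) * max 0 (min 1 (r - real i)))"

text \<open>The sum gives increment \<open>i\<close> the weight \<open>r - i\<close> clipped to
  [0,1]. It is visibly continuous in \<open>r\<close> and in the finitely many values of
  \<open>s\<close> that enter, which the floor formula of \<open>rescaled\<close> is not; this lemma
  joins the two.\<close>

lemma interp_eq:
  assumes "0 \<le> r" "r \<le> real n"
  shows "interp s n r = s (nat \<lfloor>r\<rfloor>) + (r - real (nat \<lfloor>r\<rfloor>)) * (s (Suc (nat \<lfloor>r\<rfloor>)) - s (nat \<lfloor>r\<rfloor>))"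
  using assms
proof (induction n)
  case 0 then show ?case by (simp add: interp_def)
next
  case (Suc n)
  show ?case
  proof (cases "r \<le> real n")
    case True
    then have "interp s (Suc n) r = interp s n r" by (simp add: interp_def)
    then show ?thesis using Suc True by simp
  next
    case False
    have "(\<Sum>i<n. (s (Suc i) - s i) * max 0 (min 1 (r - real i))) = (\<Sum>i<n. s (Suc i) - s i)"
    proof (rule sum.cong)
      fix i assume "i \<in> {..<n}"
      then have "real i + 1 \<le> real n" by simp
      then have "max 0 (min 1 (r - real i)) = 1" using False by simp
      then show "(s (Suc i) - s i) * max 0 (min 1 (r - real i)) = s (Suc i) - s i" by simp
    qed simp
    also have "\<dots> = s n - s 0" by (rule sum_lessThan_telescope)
    finally have *: "interp s (Suc n) r = s n + (s (Suc n) - s n) * (r - real n)"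
      using False Suc.prems by (simp add: interp_def)
    show ?thesis
    proof (cases "r = real (Suc n)")
      \<comment> \<open>The floor has jumped to \<open>Suc n\<close>, but the new increment carries
        the factor zero.\<close>
      case True
      then have "nat \<lfloor>r\<rfloor> = Suc n" by simp
      then show ?thesis using True * by simp
    next
      case False
      then have "\<lfloor>r\<rfloor> = int n" using \<open>\<not> r \<le> real n\<close> Suc.prems by (intro floor_unique) auto
      then show ?thesis using * by simp
    qed
  qed
qed

lemma continuous_on_interp: "continuous_on S (\<lambda>t. interp s n (real n * t))"
  unfolding interp_def by (intro continuous_intros)

lemma rescaled_eq_interp:
  assumes "t \<in> {0..1}"
  shows "rescaled \<sigma> s n t = interp s n (real n * t) / (\<sigma> * sqrt (real n))"
proof -
  have "real n * t \<le> real n * 1" using assms by (intro mult_left_mono) auto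
  then show ?thesis unfolding rescaled_def Let_def using assms by (subst interp_eq) auto
qed

text \<open>The index \<open>n = 0\<close> is no exception: division by zero makes the function
  zero.\<close>

lemma continuous_on_rescaled: "continuous_on {0..1} (rescaled \<sigma> s n)"
proof -
  have "continuous_on {0..1} (\<lambda>t. interp s n (real n * t) * inverse (\<sigma> * sqrt (real n)))"
    by (intro continuous_intros continuous_on_interp)
  moreover have "continuous_on {0..1} (rescaled \<sigma> s n) \<longleftrightarrow>
      continuous_on {0..1} (\<lambda>t. interp s n (real n * t) * inverse (\<sigma> * sqrt (real n)))"
    by (rule continuous_on_cong) (auto simp: rescaled_eq_interp divide_inverse)
  ultimately show ?thesis by blast
qed

section \<open>Uniform distance on [0,1] and measurability of continuous functionals\<close>

lemma bdd_above_abs_diff: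
  fixes f g :: "real \<Rightarrow> real"
  assumes "continuous_on {0..1} f" "continuous_on {0..1} g"
  shows "bdd_above ((\<lambda>t. \<bar>f t - g t\<bar>) ` {0..1})"
  by (intro bounded_imp_bdd_above compact_imp_bounded compact_continuous_image continuous_intros assms) auto

lemma abs_diff_le_dist01:
  assumes "continuous_on {0..1} f" "continuous_on {0..1} g" "t \<in> {0..1}"
  shows "\<bar>f t - g t\<bar> \<le> dist01 f g"
  unfolding dist01_def by (intro cSUP_upper bdd_above_abs_diff assms)

lemma dist01_le:
  assumes "\<And>t. t \<in> {0..1} \<Longrightarrow> \<bar>f t - g t\<bar> \<le> c" shows "dist01 f g \<le> c"
  unfolding dist01_def by (rule cSUP_least) (use assms in auto)

lemma dist01_nonneg:
  assumes "continuous_on {0..1} f" "continuous_on {0..1} g" shows "0 \<le> dist01 f g"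
  using abs_diff_le_dist01[OF assms, of 0] by (smt (verit) atLeastAtMost_iff)

lemma dist01_self: "dist01 f f = 0"
  unfolding dist01_def by simp

lemma dist01_commute: "dist01 f g = dist01 g f"
  unfolding dist01_def by (simp add: abs_minus_commute)

lemma dist01_triangle:
  assumes "continuous_on {0..1} f" "continuous_on {0..1} g" "continuous_on {0..1} h"
  shows "dist01 f h \<le> dist01 f g + dist01 g h"
proof (rule dist01_le)
  fix t :: real assume t: "t \<in> {0..1}"
  show "\<bar>f t - h t\<bar> \<le> dist01 f g + dist01 g h"
    using abs_diff_le_dist01[OF assms(1,2) t] abs_diff_le_dist01[OF assms(2,3) t] by linarith
qed

lemma bcont_C01_tendsto:
  assumes F: "bcont_C01 F" and f: "continuous_on {0..1} f" and g: "\<And>n. continuous_on {0..1} (g n)"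
    and lim: "(\<lambda>n. dist01 f (g n)) \<longlonglongrightarrow> 0"
  shows "(\<lambda>n. F (g n)) \<longlonglongrightarrow> F f"
proof (rule LIMSEQ_I)
  fix e :: real assume "0 < e"
  then obtain d where d: "0 < d" "\<And>g. continuous_on {0..1} g \<Longrightarrow> dist01 f g < d \<Longrightarrow> \<bar>F f - F g\<bar> < e"
    using F f unfolding bcont_C01_def by meson
  have "\<forall>\<^sub>F n in sequentially. dist01 f (g n) < d" using lim d(1) by (rule order_tendstoD)
  then obtain N where "\<And>n. n \<ge> N \<Longrightarrow> dist01 f (g n) < d" by (auto simp: eventually_sequentially)
  then show "\<exists>N. \<forall>n\<ge>N. norm (F (g n) - F f) < e"
    using d(2)[OF g] by (metis abs_minus_commute real_norm_def)
qed

text \<open>\<open>bcont_C01\<close> says nothing about measurability. For polygons with finitely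
  many nodes it follows from continuity in the product topology, whose Borel sets form the product
  sigma-algebra because there are countably many coordinates.\<close>

lemma measurable_polygon:
  assumes F: "bcont_C01 F"
  shows "(\<lambda>v. F (\<lambda>t. interp v n (real n * t))) \<in> borel_measurable (PiM UNIV (\<lambda>_::nat. borel :: real measure))"
proof -
  have "continuous_on UNIV (\<lambda>v. F (\<lambda>t. interp v n (real n * t)))"
  proof (subst continuous_on_sequentially, intro allI ballI impI)
    fix vs and v :: "nat \<Rightarrow> real" assume "v \<in> UNIV" and "(\<forall>k. vs k \<in> UNIV) \<and> vs \<longlonglongrightarrow> v"
    then have lim: "(\<lambda>k. vs k i) \<longlonglongrightarrow> v i" for i
      using continuous_on_tendsto_compose[OF continuous_on_product_coordinates[of i], of vs v] by auto
    have "(\<lambda>k. dist01 (\<lambda>t. interp v n (real n * t)) (\<lambda>t. interp (vs k) n (real n * t))) \<longlonglongrightarrow> 0"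
    proof (rule tendsto_sandwich[OF _ _ tendsto_const])
      show "\<forall>\<^sub>F k in sequentially. 0 \<le> dist01 (\<lambda>t. interp v n (real n * t)) (\<lambda>t. interp (vs k) n (real n * t))"
        by (intro always_eventually allI dist01_nonneg continuous_on_interp)
      \<comment> \<open>All weights lie in [0,1], so the distance of two polygons is at most a
        finite sum of distances of their nodes.\<close>
      let ?c = "\<lambda>k. \<bar>v 0 - vs k 0\<bar> + (\<Sum>i<n. \<bar>v (Suc i) - vs k (Suc i)\<bar> + \<bar>v i - vs k i\<bar>)"
      show "\<forall>\<^sub>F k in sequentially. dist01 (\<lambda>t. interp v n (real n * t)) (\<lambda>t. interp (vs k) n (real n * t)) \<le> ?c k"
      proof (intro always_eventually allI dist01_le)
        fix k and t :: real
        let ?m = "\<lambda>i. max 0 (min 1 (real n * t - real i))"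
        have eq: "interp v n (real n * t) - interp (vs k) n (real n * t)
            = (v 0 - vs k 0) + (\<Sum>i<n. ((v (Suc i) - vs k (Suc i)) - (v i - vs k i)) * ?m i)"
          unfolding interp_def by (simp add: sum_subtractf[symmetric] algebra_simps)
        have "\<bar>interp v n (real n * t) - interp (vs k) n (real n * t)\<bar>
            \<le> \<bar>v 0 - vs k 0\<bar> + (\<Sum>i<n. \<bar>((v (Suc i) - vs k (Suc i)) - (v i - vs k i)) * ?m i\<bar>)"
          unfolding eq by (intro order_trans[OF abs_triangle_ineq] add_left_mono sum_abs)
        also have "\<dots> \<le> ?c k"
        proof (intro add_left_mono sum_mono)
          fix i
          have "\<bar>((v (Suc i) - vs k (Suc i)) - (v i - vs k i)) * ?m i\<bar> \<le> \<bar>(v (Suc i) - vs k (Suc i)) - (v i - vs k i)\<bar> * 1"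
            unfolding abs_mult by (intro mult_left_mono) auto
          also have "\<dots> \<le> \<bar>v (Suc i) - vs k (Suc i)\<bar> + \<bar>v i - vs k i\<bar>"
            unfolding mult_1_right by (rule abs_triangle_ineq4)
          finally show "\<bar>((v (Suc i) - vs k (Suc i)) - (v i - vs k i)) * ?m i\<bar> \<le> \<bar>v (Suc i) - vs k (Suc i)\<bar> + \<bar>v i - vs k i\<bar>" .
        qed
        finally show "\<bar>interp v n (real n * t) - interp (vs k) n (real n * t)\<bar> \<le> ?c k" .
      qed
      have "?c \<longlonglongrightarrow> \<bar>v 0 - v 0\<bar> + (\<Sum>i<n. \<bar>v (Suc i) - v (Suc i)\<bar> + \<bar>v i - v i\<bar>)"
        by (intro tendsto_intros lim)
      then show "?c \<longlonglongrightarrow> 0" by simp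
    qed
    then show "((\<lambda>v. F (\<lambda>t. interp v n (real n * t))) \<circ> vs) \<longlonglongrightarrow> F (\<lambda>t. interp v n (real n * t))"
      unfolding comp_def by (intro bcont_C01_tendsto[OF F] continuous_on_interp)
  qed
  then have "(\<lambda>v. F (\<lambda>t. interp v n (real n * t))) \<in> borel_measurable borel"
    by (rule borel_measurable_continuous_onI)
  then show ?thesis
    using measurable_cong_sets[OF sets_PiM_equal_borel refl] by blast
qed

text \<open>\<open>Y \<omega>\<close> is the uniform limit of its polygons on the grid
  \<open>i / n\<close>, so \<open>F (Y \<omega>)\<close> is a pointwise limit of the functions in
  \<open>measurable_polygon\<close>.\<close>

lemma bcont_C01_measurable:
  assumes F: "bcont_C01 F" and cont: "\<And>\<omega>. \<omega> \<in> space N \<Longrightarrow> continuous_on {0..1} (Y \<omega>)"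
    and Y: "\<And>t. t \<in> {0..1} \<Longrightarrow> (\<lambda>\<omega>. Y \<omega> t) \<in> borel_measurable N"
  shows "(\<lambda>\<omega>. F (Y \<omega>)) \<in> borel_measurable N"
proof -
  \<comment> \<open>Capping at 1 keeps every sample point in the domain, also for the index
    \<open>n + 1\<close>, which the floor formula reads at the right end.\<close>
  define v where "v n \<omega> i = Y \<omega> (min 1 (real i / real n))" for n \<omega> and i :: nat
  have "(\<lambda>\<omega>. v n \<omega>) \<in> measurable N (PiM UNIV (\<lambda>_::nat. borel))" for n
    unfolding v_def by (intro measurable_PiM_single') (auto intro: Y)
  from measurable_compose[OF this measurable_polygon[OF F]]
  have m: "(\<lambda>\<omega>. F (\<lambda>t. interp (v n \<omega>) n (real n * t))) \<in> borel_measurable N" for n .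
  have "(\<lambda>n. F (\<lambda>t. interp (v n \<omega>) n (real n * t))) \<longlonglongrightarrow> F (Y \<omega>)" if \<omega>: "\<omega> \<in> space N" for \<omega>
  proof (rule bcont_C01_tendsto[OF F cont[OF \<omega>] continuous_on_interp], rule LIMSEQ_I)
    fix e :: real assume "0 < e"
    have "uniformly_continuous_on {0..1} (Y \<omega>)"
      by (rule compact_uniformly_continuous[OF cont[OF \<omega>]]) simp
    then obtain d where d: "0 < d" "\<And>s t. s \<in> {0..1} \<Longrightarrow> t \<in> {0..1} \<Longrightarrow> dist s t < d \<Longrightarrow> dist (Y \<omega> s) (Y \<omega> t) < e / 2"
      unfolding uniformly_continuous_on_def using \<open>0 < e\<close> by (meson half_gt_zero)
    obtain N0 :: nat where N0: "1 / d < real N0" using reals_Archimedean2 by blast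
    show "\<exists>N0. \<forall>n\<ge>N0. norm (dist01 (Y \<omega>) (\<lambda>t. interp (v n \<omega>) n (real n * t)) - 0) < e"
    proof (intro exI[of _ N0] allI impI)
      fix n assume n: "N0 \<le> n"
      have N0': "0 < real N0" using N0 d(1) by (smt (verit) divide_pos_pos)
      then have n0: "0 < n" using n by simp
      have "1 < real N0 * d" using N0 d(1) by (simp add: field_simps)
      also have "\<dots> \<le> real n * d" using n d(1) by simp
      finally have nd: "1 / real n < d" using n0 by (simp add: field_simps)
      have "dist01 (Y \<omega>) (\<lambda>t. interp (v n \<omega>) n (real n * t)) \<le> e / 2"
      proof (rule dist01_le)
        fix t :: real assume t: "t \<in> {0..1}"
        define r where "r = real n * t"
        define m where "m = nat \<lfloor>r\<rfloor>"
        have r: "0 \<le> r" "r \<le> real n" unfolding r_def using t n0 by (auto simp: mult_left_le)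
        have mr: "real m \<le> r" "r < real m + 1" unfolding m_def using r by auto
        have mn: "real m / real n \<le> t" "t \<le> (real m + 1) / real n"
          using mr n0 unfolding r_def by (auto simp: field_simps)
        have n1: "(real m + 1) / real n = real m / real n + 1 / real n" by (simp add: add_divide_distrib)
        have close: "\<bar>v n \<omega> i - Y \<omega> t\<bar> \<le> e / 2" if "i = m \<or> i = Suc m" for i
        proof -
          have "dist (min 1 (real i / real n)) t < d"
            using that mn nd n1 t unfolding dist_real_def by (auto simp: min_def field_simps)
          moreover have "min 1 (real i / real n) \<in> {0..1}" by auto
          ultimately have "dist (Y \<omega> (min 1 (real i / real n))) (Y \<omega> t) < e / 2" using t d(2) by blast
          then show ?thesis unfolding v_def dist_real_def by simp
        qed
        \<comment> \<open>A convex combination of two neighbouring sample values, each within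
          \<open>e / 2\<close> of \<open>Y \<omega> t\<close>.\<close>
        have eq: "interp (v n \<omega>) n r - Y \<omega> t = (1 - (r - real m)) * (v n \<omega> m - Y \<omega> t) + (r - real m) * (v n \<omega> (Suc m) - Y \<omega> t)"
          unfolding interp_eq[OF r] m_def[symmetric] by (simp add: algebra_simps)
        have "\<bar>(1 - (r - real m)) * (v n \<omega> m - Y \<omega> t)\<bar> \<le> (1 - (r - real m)) * (e / 2)"
          unfolding abs_mult using mr close[of m] by (intro mult_mono) auto
        moreover have "\<bar>(r - real m) * (v n \<omega> (Suc m) - Y \<omega> t)\<bar> \<le> (r - real m) * (e / 2)"
          unfolding abs_mult using mr close[of "Suc m"] by (intro mult_mono) auto
        ultimately have "\<bar>interp (v n \<omega>) n r - Y \<omega> t\<bar> \<le> (1 - (r - real m)) * (e / 2) + (r - real m) * (e / 2)"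
          unfolding eq by linarith
        also have "\<dots> = e / 2" by (simp only: distrib_right[symmetric]) simp
        finally show "\<bar>Y \<omega> t - interp (v n \<omega>) n (real n * t)\<bar> \<le> e / 2" unfolding r_def by (simp add: abs_minus_commute)
      qed
      moreover have "0 \<le> dist01 (Y \<omega>) (\<lambda>t. interp (v n \<omega>) n (real n * t))"
        by (intro dist01_nonneg cont \<omega> continuous_on_interp)
      ultimately show "norm (dist01 (Y \<omega>) (\<lambda>t. interp (v n \<omega>) n (real n * t)) - 0) < e" using \<open>0 < e\<close> by simp
    qed
  qed
  then show ?thesis using m by (rule borel_measurable_LIMSEQ_real)
qed

section \<open>Reduction of weak convergence to bounded Lipschitz functionals\<close>

definition lip_C01 :: "((real \<Rightarrow> real) \<Rightarrow> real) \<Rightarrow> real \<Rightarrow> real \<Rightarrow> bool" where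
  "lip_C01 F B L \<longleftrightarrow> (\<forall>f. continuous_on {0..1} f \<longrightarrow> \<bar>F f\<bar> \<le> B) \<and>
     (\<forall>f g. continuous_on {0..1} f \<longrightarrow> continuous_on {0..1} g \<longrightarrow> \<bar>F f - F g\<bar> \<le> L * dist01 f g)"

lemma lip_C01_bcont:
  assumes "lip_C01 F B L" shows "bcont_C01 F"
  unfolding bcont_C01_def
proof (intro conjI allI impI)
  show "\<exists>B. \<forall>f. continuous_on {0..1} f \<longrightarrow> \<bar>F f\<bar> \<le> B" using assms unfolding lip_C01_def by blast
  fix f :: "real \<Rightarrow> real" and e :: real assume f: "continuous_on {0..1} f" and e: "0 < e"
  show "\<exists>d>0. \<forall>g. continuous_on {0..1} g \<longrightarrow> dist01 f g < d \<longrightarrow> \<bar>F f - F g\<bar> < e"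
  proof (intro exI[of _ "e / (\<bar>L\<bar> + 1)"] conjI allI impI)
    show "0 < e / (\<bar>L\<bar> + 1)" using e by simp
    fix g assume g: "continuous_on {0..1} g" "dist01 f g < e / (\<bar>L\<bar> + 1)"
    have "\<bar>F f - F g\<bar> \<le> L * dist01 f g" using assms f g(1) unfolding lip_C01_def by blast
    also have "\<dots> \<le> (\<bar>L\<bar> + 1) * dist01 f g" using dist01_nonneg[OF f g(1)] by (intro mult_right_mono) auto
    also have "\<dots> < e" using g(2) by (simp add: field_simps)
    finally show "\<bar>F f - F g\<bar> < e" .
  qed
qed

text \<open>A bounded continuous functional is an increasing limit of bounded Lipschitz ones.\<close>

definition inf_conv :: "((real \<Rightarrow> real) \<Rightarrow> real) \<Rightarrow> nat \<Rightarrow> (real \<Rightarrow> real) \<Rightarrow> real" where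
  "inf_conv F k f = (INF g\<in>{g. continuous_on {0..1} g}. F g + real k * dist01 f g)"

context
  fixes F :: "(real \<Rightarrow> real) \<Rightarrow> real" and B :: real
  assumes F: "bcont_C01 F" and B: "\<And>f. continuous_on {0..1} f \<Longrightarrow> \<bar>F f\<bar> \<le> B"
begin

lemma inf_conv_lower:
  assumes "continuous_on {0..1} f" "\<And>g. continuous_on {0..1} g \<Longrightarrow> c \<le> F g + real k * dist01 f g"
  shows "c \<le> inf_conv F k f"
  unfolding inf_conv_def by (rule cINF_greatest) (use assms in auto)

lemma inf_conv_upper:
  assumes "continuous_on {0..1} f" "continuous_on {0..1} g"
  shows "inf_conv F k f \<le> F g + real k * dist01 f g"
  unfolding inf_conv_def
proof (rule cINF_lower)
  have "- B \<le> F g' + real k * dist01 f g'" if "continuous_on {0..1} g'" for g'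
    using B[OF that] mult_nonneg_nonneg[OF _ dist01_nonneg[OF assms(1) that], of "real k"] by linarith
  then show "bdd_below ((\<lambda>g. F g + real k * dist01 f g) ` {g. continuous_on {0..1} g})"
    by (intro bdd_belowI2[of _ "- B"]) auto
qed (use assms in auto)

lemma inf_conv_le: "continuous_on {0..1} f \<Longrightarrow> inf_conv F k f \<le> F f"
  using inf_conv_upper[of f f k] by (simp add: dist01_self)

text \<open>An infimum of functions of \<open>f\<close> each of which is \<open>k\<close>-Lipschitz
  by the triangle inequality; the bound \<open>- B\<close> from below is inherited from
  \<open>F\<close>, since the penalty is nonnegative.\<close>

lemma lip_inf_conv: "lip_C01 (inf_conv F k) B (real k)"
  unfolding lip_C01_def
proof (intro conjI allI impI)
  fix f :: "real \<Rightarrow> real" assume f: "continuous_on {0..1} f"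
  have "- B \<le> inf_conv F k f"
  proof (rule inf_conv_lower[OF f])
    fix g :: "real \<Rightarrow> real" assume g: "continuous_on {0..1} g"
    show "- B \<le> F g + real k * dist01 f g"
      using B[OF g] mult_nonneg_nonneg[OF _ dist01_nonneg[OF f g], of "real k"] by linarith
  qed
  then show "\<bar>inf_conv F k f\<bar> \<le> B" using inf_conv_le[OF f, of k] B[OF f] by linarith
next
  have *: "inf_conv F k f - inf_conv F k g \<le> real k * dist01 f g"
    if f: "continuous_on {0..1} f" and g: "continuous_on {0..1} g" for f g
  proof -
    have "inf_conv F k f - real k * dist01 f g \<le> inf_conv F k g"
    proof (rule inf_conv_lower[OF g])
      fix h :: "real \<Rightarrow> real" assume h: "continuous_on {0..1} h"
      have "real k * dist01 f h \<le> real k * (dist01 f g + dist01 g h)"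
        by (intro mult_left_mono dist01_triangle f g h) auto
      then show "inf_conv F k f - real k * dist01 f g \<le> F h + real k * dist01 g h"
        using inf_conv_upper[OF f h, of k] by (simp add: algebra_simps)
    qed
    then show ?thesis by simp
  qed
  fix f g :: "real \<Rightarrow> real" assume "continuous_on {0..1} f" "continuous_on {0..1} g"
  then show "\<bar>inf_conv F k f - inf_conv F k g\<bar> \<le> real k * dist01 f g"
    using *[of f g] *[of g f] by (simp add: abs_le_iff dist01_commute)
qed

lemma inf_conv_tendsto:
  assumes f: "continuous_on {0..1} f" shows "(\<lambda>k. inf_conv F k f) \<longlonglongrightarrow> F f"
proof (rule LIMSEQ_I)
  fix e :: real assume e: "0 < e"
  then obtain d where d: "0 < d" "\<And>g. continuous_on {0..1} g \<Longrightarrow> dist01 f g < d \<Longrightarrow> \<bar>F f - F g\<bar> < e / 2"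
    using F f unfolding bcont_C01_def by (meson half_gt_zero)
  \<comment> \<open>With this choice a competitor at distance at least \<open>d\<close> pays more
    than \<open>2 * B\<close>, the most that \<open>F\<close> can gain; closer competitors differ
    from \<open>F f\<close> by less than \<open>e / 2\<close>.\<close>
  obtain K :: nat where K: "2 * B / d < real K" using reals_Archimedean2 by blast
  have "F f - e / 2 \<le> inf_conv F k f" if k: "K \<le> k" for k
  proof (rule inf_conv_lower[OF f])
    fix g :: "real \<Rightarrow> real" assume g: "continuous_on {0..1} g"
    show "F f - e / 2 \<le> F g + real k * dist01 f g"
    proof (cases "dist01 f g < d")
      case True
      then show ?thesis
        using d(2)[OF g True] mult_nonneg_nonneg[OF _ dist01_nonneg[OF f g], of "real k"] by linarith
    next
      case False
      have "2 * B < real K * d" using K d(1) by (simp add: field_simps)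
      also have "\<dots> \<le> real k * dist01 f g" using False d(1) k by (intro mult_mono) auto
      finally show ?thesis using B[OF f] B[OF g] e by linarith
    qed
  qed
  then have "norm (inf_conv F k f - F f) < e" if "K \<le> k" for k
    using inf_conv_le[OF f, of k] e that by (force simp: abs_less_iff)
  then show "\<exists>K. \<forall>k\<ge>K. norm (inf_conv F k f - F f) < e" by blast
qed

end

lemma bcont_C01_uminus: "bcont_C01 F \<Longrightarrow> bcont_C01 (\<lambda>f. - F f)"
  unfolding bcont_C01_def by (auto simp: abs_minus_commute)

lemma integrable_bcont_C01:
  assumes "finite_measure N" "bcont_C01 F" "\<And>\<omega>. \<omega> \<in> space N \<Longrightarrow> continuous_on {0..1} (Y \<omega>)"
    and "\<And>t. t \<in> {0..1} \<Longrightarrow> (\<lambda>\<omega>. Y \<omega> t) \<in> borel_measurable N"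
  shows "integrable N (\<lambda>\<omega>. F (Y \<omega>))"
proof -
  obtain B where "\<And>f. continuous_on {0..1} f \<Longrightarrow> \<bar>F f\<bar> \<le> B" using assms(2) unfolding bcont_C01_def by blast
  then show ?thesis
    using assms(3)
    by (intro finite_measure.integrable_const_bound[OF assms(1), where B = B] AE_I2 bcont_C01_measurable[OF assms(2-4)]) auto
qed

text \<open>The minorants \<open>inf_conv F k\<close> bound the lower limit of the integrals; the
  upper limit follows by applying this to \<open>- F\<close>. The reduction is wanted because a
  restart moves the path by a small distance, and for Lipschitz functionals the effect is uniform
  over all paths.\<close>

lemma law_conv_C01_lipschitzI:
  assumes P: "\<forall>\<^sub>F n in sequentially. finite_measure (P n)"
    and Yn_cont: "\<And>n \<omega>. \<omega> \<in> space (P n) \<Longrightarrow> continuous_on {0..1} (Yn n \<omega>)"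
    and Yn_meas: "\<And>n t. t \<in> {0..1} \<Longrightarrow> (\<lambda>\<omega>. Yn n \<omega> t) \<in> borel_measurable (P n)"
    and Q: "cont_process Q Y"
    and conv: "\<And>F B L. lip_C01 F B L \<Longrightarrow> 0 \<le> L \<Longrightarrow> (\<lambda>n. \<integral>\<omega>. F (Yn n \<omega>) \<partial>P n) \<longlonglongrightarrow> (\<integral>\<omega>. F (Y \<omega>) \<partial>Q)"
  shows "law_conv_C01 P Yn Q Y"
proof -
  interpret Q: prob_space Q using Q by (simp add: cont_process_def)
  have Y: "\<And>\<omega>. \<omega> \<in> space Q \<Longrightarrow> continuous_on {0..1} (Y \<omega>)"
      "\<And>t. t \<in> {0..1} \<Longrightarrow> (\<lambda>\<omega>. Y \<omega> t) \<in> borel_measurable Q"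
    using Q by (auto simp: cont_process_def)
  have lower: "\<forall>\<^sub>F n in sequentially. (\<integral>\<omega>. F (Y \<omega>) \<partial>Q) - e < (\<integral>\<omega>. F (Yn n \<omega>) \<partial>P n)"
    if F: "bcont_C01 F" and e: "0 < e" for F e
  proof -
    obtain B where B: "\<And>f. continuous_on {0..1} f \<Longrightarrow> \<bar>F f\<bar> \<le> B" using F unfolding bcont_C01_def by blast
    note lip = lip_inf_conv[OF F B]
    note bc = lip_C01_bcont[OF lip]
    have "(\<lambda>k. \<integral>\<omega>. inf_conv F k (Y \<omega>) \<partial>Q) \<longlonglongrightarrow> (\<integral>\<omega>. F (Y \<omega>) \<partial>Q)"
    proof (rule integral_dominated_convergence[where w = "\<lambda>_. B"])
      show "AE \<omega> in Q. (\<lambda>k. inf_conv F k (Y \<omega>)) \<longlonglongrightarrow> F (Y \<omega>)"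
        using inf_conv_tendsto[OF F B] Y(1) by auto
      show "AE \<omega> in Q. norm (inf_conv F k (Y \<omega>)) \<le> B" for k
        using lip[of k] Y(1) unfolding lip_C01_def by auto
      show "(\<lambda>\<omega>. F (Y \<omega>)) \<in> borel_measurable Q" by (rule bcont_C01_measurable[OF F Y])
      show "(\<lambda>\<omega>. inf_conv F k (Y \<omega>)) \<in> borel_measurable Q" for k by (rule bcont_C01_measurable[OF bc Y])
    qed simp
    then have "\<forall>\<^sub>F k in sequentially. (\<integral>\<omega>. F (Y \<omega>) \<partial>Q) - e < (\<integral>\<omega>. inf_conv F k (Y \<omega>) \<partial>Q)"
      by (rule order_tendstoD) (use e in simp)
    \<comment> \<open>The order matters: \<open>k\<close> is fixed from the limit law alone, and
      only then \<open>n\<close> tends to infinity.\<close>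
    then obtain k where k: "(\<integral>\<omega>. F (Y \<omega>) \<partial>Q) - e < (\<integral>\<omega>. inf_conv F k (Y \<omega>) \<partial>Q)"
      using eventually_happens'[OF sequentially_bot] by blast
    have "\<forall>\<^sub>F n in sequentially. (\<integral>\<omega>. F (Y \<omega>) \<partial>Q) - e < (\<integral>\<omega>. inf_conv F k (Yn n \<omega>) \<partial>P n)"
      using conv[OF lip] k by (intro order_tendstoD) auto
    then show ?thesis using P
    proof eventually_elim
      case (elim n)
      have "(\<integral>\<omega>. inf_conv F k (Yn n \<omega>) \<partial>P n) \<le> (\<integral>\<omega>. F (Yn n \<omega>) \<partial>P n)"
        by (rule integral_mono[OF integrable_bcont_C01[OF elim(2) bc Yn_cont Yn_meas] integrable_bcont_C01[OF elim(2) F Yn_cont Yn_meas]])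
           (auto intro: inf_conv_le[OF F B] Yn_cont)
      then show ?case using elim(1) by simp
    qed
  qed
  show ?thesis unfolding law_conv_C01_def
  proof (intro allI impI)
    fix F assume F: "bcont_C01 F"
    show "(\<lambda>n. \<integral>\<omega>. F (Yn n \<omega>) \<partial>P n) \<longlonglongrightarrow> (\<integral>\<omega>. F (Y \<omega>) \<partial>Q)"
    proof (rule order_tendstoI)
      fix a assume "a < (\<integral>\<omega>. F (Y \<omega>) \<partial>Q)"
      then show "\<forall>\<^sub>F n in sequentially. a < (\<integral>\<omega>. F (Yn n \<omega>) \<partial>P n)"
        using lower[OF F, of "(\<integral>\<omega>. F (Y \<omega>) \<partial>Q) - a"] by simp
    next
      fix a assume "(\<integral>\<omega>. F (Y \<omega>) \<partial>Q) < a"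
      then show "\<forall>\<^sub>F n in sequentially. (\<integral>\<omega>. F (Yn n \<omega>) \<partial>P n) < a"
        using lower[OF bcont_C01_uminus[OF F], of "a - (\<integral>\<omega>. F (Y \<omega>) \<partial>Q)"] by simp
    qed
  qed
qed

subsection \<open>The modulus of continuity\<close>

definition modulus :: "(real \<Rightarrow> real) \<Rightarrow> real \<Rightarrow> real" where
  "modulus f d = (SUP (s, t)\<in>{(s, t). s \<in> {0..1} \<and> t \<in> {0..1} \<and> \<bar>s - t\<bar> \<le> d}. \<bar>f s - f t\<bar>)"

lemma modulus_upper:
  assumes f: "continuous_on {0..1} f" and "s \<in> {0..1}" "t \<in> {0..1}" "\<bar>s - t\<bar> \<le> d"
  shows "\<bar>f s - f t\<bar> \<le> modulus f d"
proof -
  have "bounded (f ` {0..1})" by (intro compact_imp_bounded compact_continuous_image f) simp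
  then obtain C where C: "\<And>t. t \<in> {0..1} \<Longrightarrow> \<bar>f t\<bar> \<le> C" unfolding bounded_iff by (metis imageI real_norm_def)
  have "bdd_above ((\<lambda>(s, t). \<bar>f s - f t\<bar>) ` {(s, t). s \<in> {0..1} \<and> t \<in> {0..1} \<and> \<bar>s - t\<bar> \<le> d})"
  proof (rule bdd_aboveI2[of _ _ "2 * C"], clarify)
    fix s t :: real assume "s \<in> {0..1}" "t \<in> {0..1}"
    then show "\<bar>f s - f t\<bar> \<le> 2 * C" using C[of s] C[of t] by linarith
  qed
  then have "(\<lambda>(s, t). \<bar>f s - f t\<bar>) (s, t) \<le> modulus f d"
    unfolding modulus_def by (rule cSUP_upper[rotated]) (use assms in auto)
  then show ?thesis by simp
qed

lemma modulus_least:
  assumes "0 \<le> d" "\<And>s t. s \<in> {0..1} \<Longrightarrow> t \<in> {0..1} \<Longrightarrow> \<bar>s - t\<bar> \<le> d \<Longrightarrow> \<bar>f s - f t\<bar> \<le> c"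
  shows "modulus f d \<le> c"
  unfolding modulus_def
proof (rule cSUP_least)
  have "(0, 0) \<in> {(s, t). s \<in> {0..1::real} \<and> t \<in> {0..1} \<and> \<bar>s - t\<bar> \<le> d}" using assms(1) by simp
  then show "{(s, t). s \<in> {0..1::real} \<and> t \<in> {0..1} \<and> \<bar>s - t\<bar> \<le> d} \<noteq> {}" by blast
qed (use assms in auto)

lemma modulus_nonneg: "continuous_on {0..1} f \<Longrightarrow> 0 \<le> d \<Longrightarrow> 0 \<le> modulus f d"
  using modulus_upper[of f 0 0 d] by simp

lemma modulus_diff_le:
  assumes f: "continuous_on {0..1} f" and g: "continuous_on {0..1} g" and d: "0 \<le> d"
  shows "modulus f d \<le> modulus g d + 2 * dist01 f g"
proof (rule modulus_least[OF d])
  fix s t :: real assume st: "s \<in> {0..1}" "t \<in> {0..1}" "\<bar>s - t\<bar> \<le> d"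
  show "\<bar>f s - f t\<bar> \<le> modulus g d + 2 * dist01 f g"
    using modulus_upper[OF g st] abs_diff_le_dist01[OF f g st(1)] abs_diff_le_dist01[OF f g st(2)] by linarith
qed

lemma modulus_tendsto_0:
  assumes f: "continuous_on {0..1} f"
  shows "(\<lambda>m. modulus f (1 / real (Suc m))) \<longlonglongrightarrow> 0"
proof (rule LIMSEQ_I)
  fix e :: real assume e: "0 < e"
  have "uniformly_continuous_on {0..1} f" by (rule compact_uniformly_continuous[OF f]) simp
  then obtain d where d: "0 < d" "\<And>s t. s \<in> {0..1} \<Longrightarrow> t \<in> {0..1} \<Longrightarrow> dist s t < d \<Longrightarrow> dist (f s) (f t) < e / 2"
    unfolding uniformly_continuous_on_def using e by (meson half_gt_zero)
  obtain N :: nat where N: "inverse (real (Suc N)) < d" using reals_Archimedean[OF d(1)] by blast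
  show "\<exists>N. \<forall>n\<ge>N. norm (modulus f (1 / real (Suc n)) - 0) < e"
  proof (intro exI[of _ N] allI impI)
    fix n assume "N \<le> n"
    then have "1 / real (Suc n) \<le> inverse (real (Suc N))" by (simp add: field_simps)
    then have "modulus f (1 / real (Suc n)) \<le> e / 2"
      using N d(2) by (intro modulus_least) (force simp: dist_real_def)+
    then show "norm (modulus f (1 / real (Suc n)) - 0) < e"
      using modulus_nonneg[OF f, of "1 / real (Suc n)"] e by simp
  qed
qed

text \<open>Makes the truncated modulus an admissible test functional, to which convergence of the
  conditional laws applies directly. The factor 2 counts the two endpoints of an increment.\<close>

lemma lip_modulus:
  assumes "0 \<le> B" "0 \<le> L" "0 \<le> d"
  shows "lip_C01 (\<lambda>f. min B (L * modulus f d)) B (2 * L)"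
  unfolding lip_C01_def
proof (intro conjI allI impI)
  fix f :: "real \<Rightarrow> real" assume f: "continuous_on {0..1} f"
  show "\<bar>min B (L * modulus f d)\<bar> \<le> B"
    using assms modulus_nonneg[OF f assms(3)] by (auto simp: min_def)
next
  fix f g :: "real \<Rightarrow> real" assume fg: "continuous_on {0..1} f" "continuous_on {0..1} g"
  have "\<bar>modulus f d - modulus g d\<bar> \<le> 2 * dist01 f g"
    using modulus_diff_le[OF fg assms(3)] modulus_diff_le[OF fg(2,1) assms(3)] by (simp add: abs_le_iff dist01_commute)
  from mult_left_mono[OF this assms(2)]
  have "\<bar>L * modulus f d - L * modulus g d\<bar> \<le> L * (2 * dist01 f g)"
    using assms(2) by (simp add: abs_mult right_diff_distrib[symmetric])
  then show "\<bar>min B (L * modulus f d) - min B (L * modulus g d)\<bar> \<le> 2 * L * dist01 f g"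
    by (auto simp: min_def abs_le_iff)
qed

subsection \<open>Mixtures\<close>

lemma cont_process_mixture:
  assumes "cont_process N1 Wp" "cont_process N2 Wm"
  shows "cont_process (measure_pmf (bernoulli_pmf p) \<Otimes>\<^sub>M (N1 \<Otimes>\<^sub>M N2))
           (\<lambda>(\<rho>, \<omega>1, \<omega>2) t. of_bool \<rho> * Wp \<omega>1 t + (1 - of_bool \<rho>) * Wm \<omega>2 t)"
proof -
  interpret N1: prob_space N1 using assms by (simp add: cont_process_def)
  interpret N2: prob_space N2 using assms by (simp add: cont_process_def)
  interpret N12: pair_prob_space N1 N2 ..
  interpret P: pair_prob_space "measure_pmf (bernoulli_pmf p)" "N1 \<Otimes>\<^sub>M N2" ..
  have [measurable]: "\<And>t. t \<in> {0..1} \<Longrightarrow> (\<lambda>\<omega>. Wp \<omega> t) \<in> borel_measurable N1"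
      "\<And>t. t \<in> {0..1} \<Longrightarrow> (\<lambda>\<omega>. Wm \<omega> t) \<in> borel_measurable N2"
    using assms by (auto simp: cont_process_def)
  show ?thesis
    unfolding cont_process_def
  proof (intro conjI ballI)
    show "prob_space (measure_pmf (bernoulli_pmf p) \<Otimes>\<^sub>M (N1 \<Otimes>\<^sub>M N2))" by (rule P.P.prob_space_axioms)
    fix t :: real assume [measurable]: "t \<in> {0..1}"
    show "(\<lambda>\<omega>. (case \<omega> of (\<rho>, \<omega>1, \<omega>2) \<Rightarrow> \<lambda>t. of_bool \<rho> * Wp \<omega>1 t + (1 - of_bool \<rho>) * Wm \<omega>2 t) t)
       \<in> borel_measurable (measure_pmf (bernoulli_pmf p) \<Otimes>\<^sub>M (N1 \<Otimes>\<^sub>M N2))"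
      unfolding split_beta by measurable
  next
    fix \<omega> assume "\<omega> \<in> space (measure_pmf (bernoulli_pmf p) \<Otimes>\<^sub>M (N1 \<Otimes>\<^sub>M N2))"
    then have "continuous_on {0..1} (Wp (fst (snd \<omega>)))" "continuous_on {0..1} (Wm (snd (snd \<omega>)))"
      using assms by (auto simp: cont_process_def space_pair_measure)
    then show "continuous_on {0..1} (case \<omega> of (\<rho>, \<omega>1, \<omega>2) \<Rightarrow> \<lambda>t. of_bool \<rho> * Wp \<omega>1 t + (1 - of_bool \<rho>) * Wm \<omega>2 t)"
      unfolding split_beta by (intro continuous_intros)
  qed
qed

text \<open>Given the coin, the process is one of the two, and the other factor of the product
  integrates to one.\<close>

lemma integral_mixture:
  assumes W: "cont_process N1 Wp" "cont_process N2 Wm" and p: "p \<in> {0..1}" and F: "bcont_C01 F"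
  shows "(\<integral>\<omega>. F ((\<lambda>(\<rho>, \<omega>1, \<omega>2) t. of_bool \<rho> * Wp \<omega>1 t + (1 - of_bool \<rho>) * Wm \<omega>2 t) \<omega>)
            \<partial>(measure_pmf (bernoulli_pmf p) \<Otimes>\<^sub>M (N1 \<Otimes>\<^sub>M N2)))
         = p * (\<integral>\<omega>. F (Wp \<omega>) \<partial>N1) + (1 - p) * (\<integral>\<omega>. F (Wm \<omega>) \<partial>N2)"
proof -
  interpret N1: prob_space N1 using assms by (simp add: cont_process_def)
  interpret N2: prob_space N2 using assms by (simp add: cont_process_def)
  interpret N12: pair_prob_space N1 N2 ..
  interpret P: pair_prob_space "measure_pmf (bernoulli_pmf p)" "N1 \<Otimes>\<^sub>M N2" ..
  let ?Y = "\<lambda>(\<rho>, \<omega>1, \<omega>2) t. of_bool \<rho> * Wp \<omega>1 t + (1 - of_bool \<rho>) * Wm \<omega>2 t"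
  have I: "integrable (measure_pmf (bernoulli_pmf p) \<Otimes>\<^sub>M (N1 \<Otimes>\<^sub>M N2)) (\<lambda>\<omega>. F (?Y \<omega>))"
    using cont_process_mixture[OF W, of p]
    by (intro integrable_bcont_C01[OF P.P.finite_measure_axioms F]) (auto simp: cont_process_def)
  have I1: "integrable N1 (\<lambda>\<omega>. F (Wp \<omega>))"
    using W by (intro integrable_bcont_C01[OF N1.finite_measure_axioms F]) (auto simp: cont_process_def)
  have I2: "integrable N2 (\<lambda>\<omega>. F (Wm \<omega>))"
    using W by (intro integrable_bcont_C01[OF N2.finite_measure_axioms F]) (auto simp: cont_process_def)
  have m [measurable]: "(\<lambda>\<omega>. F (Wp \<omega>)) \<in> borel_measurable N1" "(\<lambda>\<omega>. F (Wm \<omega>)) \<in> borel_measurable N2"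
    using I1 I2 by auto
  obtain B where B: "\<And>f. continuous_on {0..1} f \<Longrightarrow> \<bar>F f\<bar> \<le> B" using F unfolding bcont_C01_def by blast
  have J1: "integrable (N1 \<Otimes>\<^sub>M N2) (\<lambda>\<omega>. F (Wp (fst \<omega>)))"
    by (intro N12.P.integrable_const_bound[of _ B])
       (use W B in \<open>auto simp: cont_process_def space_pair_measure intro!: AE_I2\<close>)
  have J2: "integrable (N1 \<Otimes>\<^sub>M N2) (\<lambda>\<omega>. F (Wm (snd \<omega>)))"
    by (intro N12.P.integrable_const_bound[of _ B])
       (use W B in \<open>auto simp: cont_process_def space_pair_measure intro!: AE_I2\<close>)
  have K1: "(\<integral>\<omega>. F (Wp (fst \<omega>)) \<partial>(N1 \<Otimes>\<^sub>M N2)) = (\<integral>\<omega>. F (Wp \<omega>) \<partial>N1)"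
    using N12.integral_fst'[OF J1] by (simp add: N2.prob_space)
  have K2: "(\<integral>\<omega>. F (Wm (snd \<omega>)) \<partial>(N1 \<Otimes>\<^sub>M N2)) = (\<integral>\<omega>. F (Wm \<omega>) \<partial>N2)"
    using N12.integral_fst'[OF J2] by (simp add: N1.prob_space)
  have "(\<integral>\<omega>. F (?Y \<omega>) \<partial>(measure_pmf (bernoulli_pmf p) \<Otimes>\<^sub>M (N1 \<Otimes>\<^sub>M N2)))
      = (\<integral>\<rho>. (\<integral>\<omega>. F (?Y (\<rho>, \<omega>)) \<partial>(N1 \<Otimes>\<^sub>M N2)) \<partial>measure_pmf (bernoulli_pmf p))"
    by (rule P.integral_fst'[OF I, symmetric])
  also have "\<dots> = (\<integral>\<rho>. (if \<rho> then (\<integral>\<omega>. F (Wp \<omega>) \<partial>N1) else (\<integral>\<omega>. F (Wm \<omega>) \<partial>N2)) \<partial>measure_pmf (bernoulli_pmf p))"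
  proof (rule Bochner_Integration.integral_cong[OF refl])
    fix \<rho> :: bool
    have "(\<lambda>\<omega>. F (?Y (\<rho>, \<omega>))) = (\<lambda>\<omega>. if \<rho> then F (Wp (fst \<omega>)) else F (Wm (snd \<omega>)))"
      by (auto simp: fun_eq_iff split_beta)
    then show "(\<integral>\<omega>. F (?Y (\<rho>, \<omega>)) \<partial>(N1 \<Otimes>\<^sub>M N2)) = (if \<rho> then (\<integral>\<omega>. F (Wp \<omega>) \<partial>N1) else (\<integral>\<omega>. F (Wm \<omega>) \<partial>N2))"
      by (simp add: K1 K2)
  qed
  also have "\<dots> = p * (\<integral>\<omega>. F (Wp \<omega>) \<partial>N1) + (1 - p) * (\<integral>\<omega>. F (Wm \<omega>) \<partial>N2)"
    using p by (subst integral_bernoulli_pmf) auto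
  finally show ?thesis .
qed

section \<open>Walks stopped on leaving a set\<close>

text \<open>\<open>stopped M X D f n y\<close> is \<open>\<bbbE>\<^sub>y f (S\<^bsub>min n T\<^esub>)\<close> for the walk with step \<open>X\<close>, where \<open>T \<ge> 0\<close> is the
  first exit time from \<open>D\<close>. In particular \<open>f = indicator D\<close> gives \<open>\<bbbP>\<^sub>y (T > n)\<close>, and \<open>D = UNIV\<close> the free walk.\<close>

primrec stopped :: "'a measure \<Rightarrow> ('a \<Rightarrow> real) \<Rightarrow> real set \<Rightarrow> (real \<Rightarrow> real) \<Rightarrow> nat \<Rightarrow> real \<Rightarrow> real" where
  "stopped M X D f 0 y = f y"
| "stopped M X D f (Suc n) y = (if y \<in> D then \<integral>\<omega>. stopped M X D f n (y + X \<omega>) \<partial>M else f y)"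

text \<open>A class of test functions that are integrable along a step with finite mean and that is
  stable under the transition operator (\<open>lin_growth_step\<close>), so every iterated
  expectation in \<open>stopped\<close> exists.\<close>

definition lin_growth :: "(real \<Rightarrow> real) \<Rightarrow> bool" where
  "lin_growth f \<longleftrightarrow> f \<in> borel_measurable borel \<and> (\<exists>a b. 0 \<le> a \<and> 0 \<le> b \<and> (\<forall>z. \<bar>f z\<bar> \<le> a + b * \<bar>z\<bar>))"

lemma lin_growthI:
  assumes "f \<in> borel_measurable borel" "0 \<le> a" "0 \<le> b" "\<And>z. \<bar>f z\<bar> \<le> a + b * \<bar>z\<bar>"
  shows "lin_growth f"
  using assms unfolding lin_growth_def by blast

lemma lin_growth_add:
  assumes "lin_growth f" "lin_growth g" shows "lin_growth (\<lambda>z. f z + g z)"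
proof -
  obtain a b where 1: "0 \<le> a" "0 \<le> b" "\<And>z. \<bar>f z\<bar> \<le> a + b * \<bar>z\<bar>" using assms(1) unfolding lin_growth_def by blast
  obtain c d where 2: "0 \<le> c" "0 \<le> d" "\<And>z. \<bar>g z\<bar> \<le> c + d * \<bar>z\<bar>" using assms(2) unfolding lin_growth_def by blast
  have [measurable]: "f \<in> borel_measurable borel" "g \<in> borel_measurable borel"
    using assms unfolding lin_growth_def by auto
  have "\<bar>f z + g z\<bar> \<le> (a + c) + (b + d) * \<bar>z\<bar>" for z
    using 1(3)[of z] 2(3)[of z] by (simp add: algebra_simps)
  then show ?thesis using 1 2 by (intro lin_growthI[of _ "a + c" "b + d"]) auto
qed

lemma lin_growth_cmult:
  assumes "lin_growth f" shows "lin_growth (\<lambda>z. c * f z)"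
proof -
  obtain a b where 1: "0 \<le> a" "0 \<le> b" "\<And>z. \<bar>f z\<bar> \<le> a + b * \<bar>z\<bar>" using assms(1) unfolding lin_growth_def by blast
  have [measurable]: "f \<in> borel_measurable borel"
    using assms unfolding lin_growth_def by auto
  have "\<bar>c * f z\<bar> \<le> (\<bar>c\<bar> * a) + (\<bar>c\<bar> * b) * \<bar>z\<bar>" for z
    using mult_left_mono[OF 1(3)[of z], of "\<bar>c\<bar>"] by (simp add: algebra_simps abs_mult)
  then show ?thesis using 1 by (intro lin_growthI[of _ "\<bar>c\<bar> * a" "\<bar>c\<bar> * b"]) auto
qed

lemma lin_growth_const: "lin_growth (\<lambda>_. c)"
  by (rule lin_growthI[of _ "\<bar>c\<bar>" 0]) auto

lemma lin_growth_id: "lin_growth (\<lambda>z. z)"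
  by (rule lin_growthI[of _ 0 1]) auto

lemma lin_growth_pos: "lin_growth (\<lambda>z. max 0 z)"
  by (rule lin_growthI[of _ 0 1]) auto

lemma lin_growth_neg: "lin_growth (\<lambda>z. max 0 (- z))"
  by (rule lin_growthI[of _ 0 1]) auto

lemma lin_growth_indicator: "D \<in> sets borel \<Longrightarrow> lin_growth (indicator D)"
  by (rule lin_growthI[of _ 1 0]) (auto simp: indicator_def)

lemma lin_growth_measurable: "lin_growth f \<Longrightarrow> f \<in> borel_measurable borel"
  by (simp add: lin_growth_def)

locale centered_step = prob_space M for M :: "'a measure" +
  fixes X :: "'a \<Rightarrow> real"
  assumes X_integrable: "integrable M X"
    and X_mean_zero: "(\<integral>\<omega>. X \<omega> \<partial>M) = 0"
    and X_square_integrable: "integrable M (\<lambda>\<omega>. (X \<omega>)\<^sup>2)"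
    and X_square_pos: "(\<integral>\<omega>. (X \<omega>)\<^sup>2 \<partial>M) > 0"
begin

lemma X_measurable [measurable]: "X \<in> borel_measurable M"
  using X_integrable by auto

lemma integrable_lin_growth:
  assumes "lin_growth f" shows "integrable M (\<lambda>\<omega>. f (y + X \<omega>))"
proof -
  obtain a b where 1: "0 \<le> a" "0 \<le> b" "\<And>z. \<bar>f z\<bar> \<le> a + b * \<bar>z\<bar>" using assms(1) unfolding lin_growth_def by blast
  note [measurable] = lin_growth_measurable[OF assms]
  have bnd: "\<bar>f (y + X \<omega>)\<bar> \<le> (a + b * \<bar>y\<bar>) + b * \<bar>X \<omega>\<bar>" for \<omega>
  proof -
    have "b * \<bar>y + X \<omega>\<bar> \<le> b * (\<bar>y\<bar> + \<bar>X \<omega>\<bar>)" using 1 by (intro mult_left_mono) auto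
    then show ?thesis using 1(3)[of "y + X \<omega>"] by (simp add: algebra_simps)
  qed
  show ?thesis
    by (rule Bochner_Integration.integrable_bound[of _ "\<lambda>\<omega>. (a + b * \<bar>y\<bar>) + b * \<bar>X \<omega>\<bar>"])
       (use X_integrable bnd 1 in \<open>auto intro!: Bochner_Integration.integrable_add AE_I2 integrable_abs intro: order_trans[OF _ abs_ge_self]\<close>)
qed

lemma lin_growth_step:
  assumes "lin_growth f" shows "lin_growth (\<lambda>y. \<integral>\<omega>. f (y + X \<omega>) \<partial>M)"
proof -
  obtain a b where 1: "0 \<le> a" "0 \<le> b" "\<And>z. \<bar>f z\<bar> \<le> a + b * \<bar>z\<bar>" using assms(1) unfolding lin_growth_def by blast
  note [measurable] = lin_growth_measurable[OF assms]
  define m where "m = (\<integral>\<omega>. \<bar>X \<omega>\<bar> \<partial>M)"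
  have m: "0 \<le> m" unfolding m_def by simp
  have "\<bar>\<integral>\<omega>. f (y + X \<omega>) \<partial>M\<bar> \<le> (a + b * m) + b * \<bar>y\<bar>" for y
  proof -
    have "\<bar>\<integral>\<omega>. f (y + X \<omega>) \<partial>M\<bar> \<le> (\<integral>\<omega>. \<bar>f (y + X \<omega>)\<bar> \<partial>M)" by (rule integral_abs_bound)
    also have "\<dots> \<le> (\<integral>\<omega>. (a + b * \<bar>y\<bar>) + b * \<bar>X \<omega>\<bar> \<partial>M)"
    proof (rule integral_mono)
      show "integrable M (\<lambda>\<omega>. \<bar>f (y + X \<omega>)\<bar>)" using integrable_lin_growth[OF assms] by (rule integrable_abs)
      show "integrable M (\<lambda>\<omega>. (a + b * \<bar>y\<bar>) + b * \<bar>X \<omega>\<bar>)" using X_integrable by auto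
      fix \<omega>
      have "b * \<bar>y + X \<omega>\<bar> \<le> b * (\<bar>y\<bar> + \<bar>X \<omega>\<bar>)" using 1 by (intro mult_left_mono) auto
      then show "\<bar>f (y + X \<omega>)\<bar> \<le> (a + b * \<bar>y\<bar>) + b * \<bar>X \<omega>\<bar>" using 1(3)[of "y + X \<omega>"] by (simp add: algebra_simps)
    qed
    also have "\<dots> = (a + b * m) + b * \<bar>y\<bar>"
      unfolding m_def using X_integrable by (simp add: prob_space)
    finally show ?thesis .
  qed
  then show ?thesis using 1 m by (intro lin_growthI[of _ "a + b * m" b]) auto
qed

lemma lin_growth_stopped:
  assumes "lin_growth f" "D \<in> sets borel" shows "lin_growth (stopped M X D f n)"
proof (induction n)
  case 0 then show ?case using assms by (simp add: lin_growth_def cong: measurable_cong)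
next
  case (Suc n)
  note lin_growth_step[OF Suc]
  then obtain a b where 1: "0 \<le> a" "0 \<le> b" "\<And>z. \<bar>\<integral>\<omega>. stopped M X D f n (z + X \<omega>) \<partial>M\<bar> \<le> a + b * \<bar>z\<bar>"
      and [measurable]: "(\<lambda>z. \<integral>\<omega>. stopped M X D f n (z + X \<omega>) \<partial>M) \<in> borel_measurable borel"
    unfolding lin_growth_def by blast
  obtain c d where 2: "0 \<le> c" "0 \<le> d" "\<And>z. \<bar>f z\<bar> \<le> c + d * \<bar>z\<bar>"
      and [measurable]: "f \<in> borel_measurable borel" using assms(1) unfolding lin_growth_def by blast
  note [measurable] = assms(2)
  have "\<bar>stopped M X D f (Suc n) z\<bar> \<le> (a + c) + (b + d) * \<bar>z\<bar>" for z
    using 1(3)[of z] 2(3)[of z] 1(1,2) 2(1,2) by (auto simp: algebra_simps intro: add_increasing add_increasing2)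
  moreover have "stopped M X D f (Suc n) \<in> borel_measurable borel"
  proof -
    have "stopped M X D f (Suc n) = (\<lambda>y. if y \<in> D then \<integral>\<omega>. stopped M X D f n (y + X \<omega>) \<partial>M else f y)"
      by auto
    then show ?thesis by simp
  qed
  ultimately show ?case using 1 2 by (intro lin_growthI[of _ "a + c" "b + d"]) auto
qed

lemma integrable_stopped:
  assumes "lin_growth f" "D \<in> sets borel" shows "integrable M (\<lambda>\<omega>. stopped M X D f n (y + X \<omega>))"
  by (intro integrable_lin_growth lin_growth_stopped assms)

lemma stopped_mono:
  assumes "lin_growth f" "lin_growth g" "D \<in> sets borel" "\<And>z. f z \<le> g z"
  shows "stopped M X D f n y \<le> stopped M X D g n y"
proof (induction n arbitrary: y)
  case (Suc n)
  then show ?case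
    using assms by (auto intro!: integral_mono integrable_stopped)
qed (use assms in auto)

lemma stopped_add:
  assumes "lin_growth f" "lin_growth g" "D \<in> sets borel"
  shows "stopped M X D (\<lambda>z. f z + g z) n y = stopped M X D f n y + stopped M X D g n y"
proof (induction n arbitrary: y)
  case (Suc n)
  then show ?case
    using assms by (auto simp: integrable_stopped)
qed auto

lemma stopped_cmult:
  shows "stopped M X D (\<lambda>z. c * f z) n y = c * stopped M X D f n y"
  by (induction n arbitrary: y) auto

lemma stopped_const: "stopped M X D (\<lambda>z. c) n y = c"
  by (induction n arbitrary: y) (auto simp: prob_space)

text \<open>Optional stopping for the martingale of the walk at the bounded time min n T.\<close>

lemma stopped_id: "stopped M X D (\<lambda>z. z) n y = y"
  by (induction n arbitrary: y) (use X_integrable X_mean_zero in \<open>auto simp: prob_space\<close>)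

text \<open>Optional stopping for supermartingales, by conditioning on the first step. Outside
  \<open>D\<close> the walk is frozen, so the drift condition concerns points of
  \<open>D\<close>.\<close>

lemma stopped_le_superharmonic:
  assumes "lin_growth f" "D \<in> sets borel" "\<And>z. z \<in> D \<Longrightarrow> (\<integral>\<omega>. f (z + X \<omega>) \<partial>M) \<le> f z"
  shows "stopped M X D f n y \<le> f y"
proof (induction n arbitrary: y)
  case (Suc n)
  show ?case
  proof (cases "y \<in> D")
    case True
    have "(\<integral>\<omega>. stopped M X D f n (y + X \<omega>) \<partial>M) \<le> (\<integral>\<omega>. f (y + X \<omega>) \<partial>M)"
      using Suc assms by (intro integral_mono integrable_stopped integrable_lin_growth) auto
    then show ?thesis using True assms(3)[of y] by simp
  qed simp
qed simp

subsection \<open>Harris' inequality for the stopped walk\<close>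

text \<open>Chebyshev's association inequality. With \<open>a\<close> the mean of \<open>g\<close>
  and \<open>t\<close> a level of \<open>f\<close> at the place where \<open>g\<close> passes
  \<open>a\<close>, monotonicity gives \<open>f - t\<close> and \<open>g - a\<close> the same sign
  everywhere, and the mean of their product is the covariance.\<close>

lemma integral_mult_ge_of_mono:
  fixes f g :: "real \<Rightarrow> real"
  assumes "mono f" "mono g" "\<And>z. 0 \<le> f z" "\<And>z. f z \<le> 1" "lin_growth f" "lin_growth g"
  shows "integrable M (\<lambda>\<omega>. f (y + X \<omega>) * g (y + X \<omega>))"
    and "(\<integral>\<omega>. f (y + X \<omega>) \<partial>M) * (\<integral>\<omega>. g (y + X \<omega>) \<partial>M) \<le> (\<integral>\<omega>. f (y + X \<omega>) * g (y + X \<omega>) \<partial>M)"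
proof -
  note [measurable] = lin_growth_measurable[OF assms(5)] lin_growth_measurable[OF assms(6)]
  have If: "integrable M (\<lambda>\<omega>. f (y + X \<omega>))" and Ig: "integrable M (\<lambda>\<omega>. g (y + X \<omega>))"
    using assms by (auto intro: integrable_lin_growth)
  have Ifg: "integrable M (\<lambda>\<omega>. f (y + X \<omega>) * g (y + X \<omega>))"
  proof (rule Bochner_Integration.integrable_bound[OF Ig])
    have "\<bar>f z * g z\<bar> \<le> \<bar>g z\<bar>" for z
      using mult_right_mono[of "\<bar>f z\<bar>" 1 "\<bar>g z\<bar>"] assms(3,4)[of z] by (simp add: abs_mult)
    then show "AE \<omega> in M. norm (f (y + X \<omega>) * g (y + X \<omega>)) \<le> norm (g (y + X \<omega>))" by auto
  qed simp
  then show "integrable M (\<lambda>\<omega>. f (y + X \<omega>) * g (y + X \<omega>))" .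
  define a where "a = (\<integral>\<omega>. g (y + X \<omega>) \<partial>M)"
  define S where "S = {z. g z < a}"
  \<comment> \<open>The default 0 serves when \<open>g\<close> never falls below its mean; it lies
    below \<open>f\<close>, which is nonnegative.\<close>
  define t where "t = (if S = {} then 0 else (SUP z\<in>S. f z))"
  have bdd: "bdd_above (f ` S)" using assms(4) by (auto intro!: bdd_aboveI[of _ 1])
  have "0 \<le> (f z - t) * (g z - a)" for z
  proof (cases "z \<in> S")
    case True
    then have "f z \<le> t" unfolding t_def using bdd by (auto intro: cSUP_upper)
    then show ?thesis using True unfolding S_def by (intro mult_nonpos_nonpos) auto
  next
    case False
    have "t \<le> f z"
    proof (cases "S = {}")
      case False
      have "f x \<le> f z" if "x \<in> S" for x
      proof -
        have "x \<le> z"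
        proof (rule ccontr)
          assume "\<not> x \<le> z"
          then have "g z \<le> g x" using monoD[OF assms(2), of z x] by simp
          then show False using that \<open>z \<notin> S\<close> unfolding S_def by simp
        qed
        then show ?thesis using assms(1) by (rule monoD[rotated])
      qed
      then show ?thesis using False unfolding t_def by (auto intro: cSUP_least)
    qed (simp add: t_def assms)
    then show ?thesis using False unfolding S_def by auto
  qed
  then have "0 \<le> (\<integral>\<omega>. (f (y + X \<omega>) - t) * (g (y + X \<omega>) - a) \<partial>M)" by simp
  also have "\<dots> = (\<integral>\<omega>. f (y + X \<omega>) * g (y + X \<omega>) - a * f (y + X \<omega>) - t * g (y + X \<omega>) + t * a \<partial>M)"
    by (simp add: algebra_simps)
  \<comment> \<open>Since \<open>a\<close> is the mean of \<open>g\<close>, the two terms with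
    \<open>t\<close> cancel.\<close>
  also have "\<dots> = (\<integral>\<omega>. f (y + X \<omega>) * g (y + X \<omega>) \<partial>M) - a * (\<integral>\<omega>. f (y + X \<omega>) \<partial>M)"
    using If Ig Ifg by (simp add: prob_space a_def)
  finally show "(\<integral>\<omega>. f (y + X \<omega>) \<partial>M) * (\<integral>\<omega>. g (y + X \<omega>) \<partial>M) \<le> (\<integral>\<omega>. f (y + X \<omega>) * g (y + X \<omega>) \<partial>M)"
    by (simp add: a_def algebra_simps)
qed

lemma stopped_indicator_bounds:
  assumes "D \<in> sets borel"
  shows "0 \<le> stopped M X D (indicator D) n y" "stopped M X D (indicator D) n y \<le> 1"
proof -
  have "stopped M X D (\<lambda>_. 0) n y \<le> stopped M X D (indicator D) n y"
    by (intro stopped_mono lin_growth_const lin_growth_indicator assms) auto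
  then show "0 \<le> stopped M X D (indicator D) n y" by (simp add: stopped_const)
  have "stopped M X D (indicator D) n y \<le> stopped M X D (\<lambda>_. 1) n y"
    by (intro stopped_mono lin_growth_const lin_growth_indicator assms) auto
  then show "stopped M X D (indicator D) n y \<le> 1" by (simp add: stopped_const)
qed

text \<open>Two walks driven by the same steps keep their order, and an up-closed \<open>D\<close>
  holds the higher one for as long as it holds the lower one.\<close>

lemma mono_stopped_indicator:
  assumes "D \<in> sets borel" "\<And>z z'. z \<in> D \<Longrightarrow> z \<le> z' \<Longrightarrow> z' \<in> D"
  shows "mono (stopped M X D (indicator D) n)"
proof (induction n)
  case 0 show ?case using assms(2) by (auto simp: mono_def indicator_def)
next
  case (Suc n)
  show ?case
  proof (rule monoI)
    fix y y' :: real assume "y \<le> y'"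
    show "stopped M X D (indicator D) (Suc n) y \<le> stopped M X D (indicator D) (Suc n) y'"
    proof (cases "y \<in> D")
      case True
      then have "y' \<in> D" using assms \<open>y \<le> y'\<close> by blast
      have "(\<integral>\<omega>. stopped M X D (indicator D) n (y + X \<omega>) \<partial>M) \<le> (\<integral>\<omega>. stopped M X D (indicator D) n (y' + X \<omega>) \<partial>M)"
        using \<open>y \<le> y'\<close> assms by (intro integral_mono integrable_stopped lin_growth_indicator monoD[OF Suc]) auto
      then show ?thesis using True \<open>y' \<in> D\<close> by simp
    next
      case False
      then show ?thesis using stopped_indicator_bounds[OF assms(1), of "Suc n" y'] by simp
    qed
  qed
qed

lemma mono_stopped_UNIV:
  assumes "mono f" "lin_growth f" shows "mono (stopped M X UNIV f n)"
proof (induction n)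
  case 0 show ?case using assms(1) by (auto simp: mono_def)
next
  case (Suc n)
  show ?case
    using assms by (intro monoI) (auto intro!: integral_mono integrable_stopped monoD[OF Suc])
qed

text \<open>Induction on \<open>n\<close>: association for a single step splits the integral of the
  product of two increasing functions, and the induction hypothesis is applied under the integral.
  Outside \<open>D\<close> the left side is zero.\<close>

lemma stopped_harris:
  assumes D: "D \<in> sets borel" "\<And>z z'. z \<in> D \<Longrightarrow> z \<le> z' \<Longrightarrow> z' \<in> D"
    and f: "mono f" "lin_growth f" "\<And>z. 0 \<le> f z"
  shows "stopped M X D (indicator D) n y * stopped M X UNIV f n y \<le> stopped M X D f n y"
proof (induction n arbitrary: y)
  case 0 then show ?case using f(3)[of y] by (auto simp: indicator_def)
next
  case (Suc n)
  show ?case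
  proof (cases "y \<in> D")
    case True
    let ?p = "stopped M X D (indicator D) n" and ?e = "stopped M X UNIV f n"
    note pe = integral_mult_ge_of_mono[OF mono_stopped_indicator[OF D] mono_stopped_UNIV[OF f(1,2)]
        stopped_indicator_bounds[OF D(1)] lin_growth_stopped[OF lin_growth_indicator[OF D(1)] D(1)]
        lin_growth_stopped[OF f(2)], simplified]
    have "(\<integral>\<omega>. ?p (y + X \<omega>) \<partial>M) * (\<integral>\<omega>. ?e (y + X \<omega>) \<partial>M) \<le> (\<integral>\<omega>. ?p (y + X \<omega>) * ?e (y + X \<omega>) \<partial>M)"
      by (rule pe)
    also have "\<dots> \<le> (\<integral>\<omega>. stopped M X D f n (y + X \<omega>) \<partial>M)"
      by (rule integral_mono[OF pe(1) integrable_stopped[OF f(2) D(1)] Suc])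
    finally show ?thesis using True by simp
  qed (use f(3) in auto)
qed

subsection \<open>The overshoot\<close>

text \<open>For \<open>z \<ge> 0\<close> this is the drift of the negative part at \<open>z\<close>,
  the quantity that the Lyapunov function of \<open>overshoot_bound\<close> has to
  compensate.\<close>

definition neg_part :: "real \<Rightarrow> real" where
  "neg_part z = (\<integral>\<omega>. max 0 (- (z + X \<omega>)) \<partial>M)"

lemma neg_part_nonneg: "0 \<le> neg_part z"
  by (simp add: neg_part_def)

lemma neg_part_antimono: "z \<le> z' \<Longrightarrow> neg_part z' \<le> neg_part z"
  unfolding neg_part_def
  by (intro integral_mono integrable_lin_growth[OF lin_growth_neg]) auto

text \<open>Multiplied by \<open>d\<close>, the left side is a lower Riemann sum of the integral of
  the positive part of x - t over [0, n d], and the right side is that integral. Keeping the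
  remainder square makes the bound inductive.\<close>

lemma sum_truncated_le:
  fixes x d :: real assumes "0 < d" "0 \<le> x"
  shows "(\<Sum>i<n. max 0 (x - (real i + 1) * d)) \<le> (x\<^sup>2 - (max 0 (x - real n * d))\<^sup>2) / (2 * d)"
proof (induction n)
  case 0 then show ?case using assms by simp
next
  case (Suc n)
  define t where "t = x - (real n + 1) * d"
  have *: "max 0 t * (2 * d) + (max 0 t)\<^sup>2 \<le> (max 0 (t + d))\<^sup>2"
  proof (cases "t > 0")
    case True
    then show ?thesis using assms by (simp add: power2_eq_square algebra_simps)
  next
    case False
    then show ?thesis by (simp add: max_def)
  qed
  have "max 0 t \<le> ((max 0 (t + d))\<^sup>2 - (max 0 t)\<^sup>2) / (2 * d)"
    using * assms by (subst pos_le_divide_eq) (simp, linarith)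
  moreover have td: "t + d = x - real n * d" "x - real (Suc n) * d = t"
    by (simp_all add: t_def algebra_simps)
  ultimately have "max 0 t \<le> (max 0 (x - real n * d))\<^sup>2 / (2 * d) - (max 0 t)\<^sup>2 / (2 * d)"
    by (simp only: diff_divide_distrib)
  then show ?case
    using Suc unfolding sum.lessThan_Suc t_def[symmetric] td(2) diff_divide_distrib by linarith
qed

text \<open>Here the finite second moment enters the overshoot bound: summing the truncated parts of
  \<open>- X\<close> over the grid gives at most \<open>X\<^sup>2 / (2 * d)\<close>.\<close>

lemma summable_neg_part:
  assumes "0 < d" shows "summable (\<lambda>i. neg_part (real i * d))"
proof -
  have "summable (\<lambda>i. neg_part (real (Suc i) * d))"
  proof (rule summableI_nonneg_bounded)
    fix n
    have "(\<Sum>i<n. neg_part (real (Suc i) * d)) = (\<integral>\<omega>. (\<Sum>i<n. max 0 (- (real (Suc i) * d + X \<omega>))) \<partial>M)"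
      unfolding neg_part_def by (rule Bochner_Integration.integral_sum[symmetric]) (rule integrable_lin_growth[OF lin_growth_neg])
    also have "\<dots> \<le> (\<integral>\<omega>. (X \<omega>)\<^sup>2 / (2 * d) \<partial>M)"
    proof (intro integral_mono Bochner_Integration.integrable_sum integrable_lin_growth[OF lin_growth_neg])
      show "integrable M (\<lambda>\<omega>. (X \<omega>)\<^sup>2 / (2 * d))" using X_square_integrable by auto
      fix \<omega>
      have "(\<Sum>i<n. max 0 (- (real (Suc i) * d + X \<omega>))) \<le> (\<Sum>i<n. max 0 (max 0 (- X \<omega>) - (real i + 1) * d))"
        by (intro sum_mono) (auto simp: algebra_simps)
      also have "\<dots> \<le> ((max 0 (- X \<omega>))\<^sup>2 - (max 0 (max 0 (- X \<omega>) - real n * d))\<^sup>2) / (2 * d)"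
        by (rule sum_truncated_le) (use assms in auto)
      also have "\<dots> \<le> (X \<omega>)\<^sup>2 / (2 * d)"
      proof (intro divide_right_mono)
        have "(max 0 (- X \<omega>))\<^sup>2 \<le> (X \<omega>)\<^sup>2" by (auto simp: max_def)
        then show "(max 0 (- X \<omega>))\<^sup>2 - (max 0 (max 0 (- X \<omega>) - real n * d))\<^sup>2 \<le> (X \<omega>)\<^sup>2"
          using zero_le_power2[of "max 0 (max 0 (- X \<omega>) - real n * d)"] by linarith
      qed (use assms in auto)
      finally show "(\<Sum>i<n. max 0 (- (real (Suc i) * d + X \<omega>))) \<le> (X \<omega>)\<^sup>2 / (2 * d)" .
    qed
    finally show "(\<Sum>i<n. neg_part (real (Suc i) * d)) \<le> (\<integral>\<omega>. (X \<omega>)\<^sup>2 / (2 * d) \<partial>M)" .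
  qed (rule neg_part_nonneg)
  then show ?thesis by (subst (asm) summable_Suc_iff)
qed

text \<open>Otherwise \<open>X\<close> would be nonnegative almost surely, hence zero because of its
  mean, against the positive variance. With the factor 2, such a step from a window of width
  \<open>d\<close> ends at least \<open>d\<close> below the left end of the window.\<close>

lemma prob_negative_step: "\<exists>d>0. 0 < prob {\<omega>\<in>space M. X \<omega> \<le> - (2 * d)}"
proof (rule ccontr)
  assume *: "\<not> ?thesis"
  have z: "prob {\<omega>\<in>space M. X \<omega> \<le> - (2 * d)} = 0" if "d > 0" for d
    using * that measure_nonneg[of M] by (metis less_eq_real_def)
  have "AE \<omega> in M. \<forall>n::nat. \<not> X \<omega> \<le> - (2 * (1 / (real n + 1)))"
    unfolding AE_all_countable
  proof
    fix n :: nat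
    have "prob {\<omega>\<in>space M. X \<omega> \<le> - (2 * (1 / (real n + 1)))} = 0" by (rule z) simp
    then have "emeasure M {\<omega>\<in>space M. X \<omega> \<le> - (2 * (1 / (real n + 1)))} = 0"
      by (simp add: emeasure_eq_measure)
    then show "AE \<omega> in M. \<not> X \<omega> \<le> - (2 * (1 / (real n + 1)))"
      by (subst AE_iff_measurable[OF _ refl]) auto
  qed
  then have nn: "AE \<omega> in M. 0 \<le> X \<omega>"
  proof eventually_elim
    case (elim \<omega>)
    show ?case
    proof (rule ccontr)
      assume "\<not> 0 \<le> X \<omega>"
      then obtain n :: nat where "inverse (real (Suc n)) < - X \<omega> / 2" using reals_Archimedean[of "- X \<omega> / 2"] by auto
      then have "X \<omega> \<le> - (2 * (1 / (real n + 1)))" by (simp add: field_simps inverse_eq_divide)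
      with elim show False by blast
    qed
  qed
  have "AE \<omega> in M. X \<omega> = 0"
    using integral_nonneg_eq_0_iff_AE[OF X_integrable nn] X_mean_zero by auto
  then have "(\<integral>\<omega>. (X \<omega>)\<^sup>2 \<partial>M) = (\<integral>\<omega>. 0 \<partial>M)" by (intro integral_cong_AE) auto
  then show False using X_square_pos by simp
qed

text \<open>The Lyapunov function is \<open>z\<^sup>-\<close> plus a bounded term whose drift compensates that of \<open>z\<^sup>-\<close> near \<open>0\<close>, plus a
  combination of the functions \<open>min z (i * d)\<close>, each of which has drift at most \<open>- p * d\<close> on \<open>[i * d, (i + 1) * d)\<close>.
  Since \<open>neg_part\<close> is summable along \<open>i * d\<close>, the total slope of the last term can be made small.\<close>

lemma overshoot_bound:
  assumes "0 < e"
  shows "\<exists>C\<ge>0. \<forall>D n y. D \<in> sets borel \<longrightarrow> D \<subseteq> {0..} \<longrightarrow> 0 \<le> y \<longrightarrow>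
           stopped M X D (\<lambda>z. max 0 (- z)) n y \<le> e * y + C"
proof -
  obtain d where d: "0 < d" and p0: "0 < prob {\<omega>\<in>space M. X \<omega> \<le> - (2 * d)}" using prob_negative_step by blast
  define p where "p = prob {\<omega>\<in>space M. X \<omega> \<le> - (2 * d)}"
  let ?J = "{\<omega>\<in>space M. X \<omega> \<le> - (2 * d)}"
  have p: "0 < p" using p0 by (simp add: p_def)
  have Jint: "(\<integral>\<omega>. indicator ?J \<omega> \<partial>M) = p" "integrable M (indicator ?J :: _ \<Rightarrow> real)"
    unfolding p_def by (simp, intro integrable_real_indicator) (auto simp: less_top[symmetric])
  \<comment> \<open>The cap 1/2 lets \<open>h\<close> consume at most half of the negative part,
    which costs a factor 2 in \<open>f_ge\<close>; \<open>e / 2\<close> makes up for that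
    factor.\<close>
  define \<epsilon> where "\<epsilon> = min (1/2) (e / 2)"
  have \<epsilon>: "0 < \<epsilon>" "\<epsilon> \<le> 1/2" "2 * \<epsilon> \<le> e" using assms by (auto simp: \<epsilon>_def)
  have "summable (\<lambda>i. neg_part (real i * d) / (p * d))"
    using summable_neg_part[OF d] by (rule summable_divide)
  \<comment> \<open>Starting the grid at \<open>i0\<close> makes the total weight of
    \<open>w\<close> smaller than \<epsilon>; the stretch below \<open>i0 * d\<close> is left to the
    bounded term \<open>v\<close>.\<close>
  from suminf_exist_split[OF \<epsilon>(1) this] obtain i0 where i0: "norm (\<Sum>i. neg_part (real (i + i0) * d) / (p * d)) < \<epsilon>"
    by auto
  define a where "a i = real (i + i0) * d" for i
  define w where "w i = neg_part (a i) / (p * d)" for i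
  have w: "0 \<le> w i" for i unfolding w_def using p d by (simp add: neg_part_nonneg)
  have a: "0 \<le> a i" for i unfolding a_def using d by simp
  have sw: "summable w" unfolding w_def[abs_def] a_def
    using summable_neg_part[OF d] by (intro summable_divide) (simp only: summable_iff_shift[of "\<lambda>i. neg_part (real i * d)"])
  have we: "suminf w < \<epsilon>" using i0 unfolding w_def[abs_def] a_def by simp
  have w0: "0 \<le> suminf w" using sw w by (intro suminf_nonneg) auto
  define h where "h z = (\<Sum>i. w i * min z (a i))" for z
  have min_abs: "\<bar>min z (a i)\<bar> \<le> \<bar>z\<bar>" for z i using a[of i] by (auto simp: min_def)
  have swz: "summable (\<lambda>i. norm (w i * min z (a i)))" for z
  proof (rule summable_comparison_test'[OF summable_mult2[OF sw, of "\<bar>z\<bar>"]])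
    fix n show "norm (norm (w n * min z (a n))) \<le> w n * \<bar>z\<bar>"
      using mult_left_mono[OF min_abs[of z n] w[of n]] w[of n] by (simp add: abs_mult)
  qed
  have swz': "summable (\<lambda>i. w i * min z (a i))" for z using swz by (rule summable_norm_cancel)
  have h_abs: "\<bar>h z\<bar> \<le> suminf w * \<bar>z\<bar>" for z
  proof -
    have "\<bar>h z\<bar> \<le> (\<Sum>i. norm (w i * min z (a i)))"
      unfolding h_def using summable_norm[OF swz] by simp
    also have "\<dots> \<le> (\<Sum>i. w i * \<bar>z\<bar>)"
      using mult_left_mono[OF min_abs w] w
      by (intro suminf_le swz summable_mult2 sw) (auto simp: abs_mult)
    finally show ?thesis using sw by (simp add: suminf_mult2)
  qed
  have h_nonneg: "0 \<le> h z" if "0 \<le> z" for z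
    unfolding h_def using that a w by (intro suminf_nonneg swz') (auto intro!: mult_nonneg_nonneg simp: a)
  have h_meas [measurable]: "h \<in> borel_measurable borel" unfolding h_def by measurable
  have h_lin: "lin_growth h"
    by (rule lin_growthI[of _ 0 "suminf w"]) (use h_abs w0 in auto)
  have lin_min: "lin_growth (\<lambda>z. min z (a i))" for i
    by (rule lin_growthI[of _ 0 1]) (use min_abs in auto)
  \<comment> \<open>Concavity gives a nonpositive drift everywhere. On the window there is a gain:
    with probability \<open>p\<close> the step is at most \<open>- 2 * d\<close> and ends at least
    \<open>d\<close> below \<open>a i\<close>.\<close>
  have min_drift: "(\<integral>\<omega>. min (z + X \<omega>) (a i) \<partial>M) \<le> min z (a i) - (if a i \<le> z \<and> z < a i + d then p * d else 0)" for z i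
  proof (cases "a i \<le> z \<and> z < a i + d")
    case True
    have "(\<integral>\<omega>. min (z + X \<omega>) (a i) \<partial>M) \<le> (\<integral>\<omega>. a i - d * indicator ?J \<omega> \<partial>M)"
    proof (intro integral_mono_AE integrable_lin_growth[OF lin_min] AE_I2)
      show "integrable M (\<lambda>\<omega>. a i - d * indicator ?J \<omega>)" using Jint(2) by simp
      fix \<omega> assume "\<omega> \<in> space M"
      then show "min (z + X \<omega>) (a i) \<le> a i - d * indicator ?J \<omega>" using True by (auto simp: indicator_def min_def)
    qed
    also have "\<dots> = a i - p * d" using Jint by (simp add: prob_space)
    finally show ?thesis using True by (simp add: min_def)
  next
    case False
    have "(\<integral>\<omega>. min (z + X \<omega>) (a i) \<partial>M) \<le> (\<integral>\<omega>. z + X \<omega> \<partial>M)"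
      by (intro integral_mono integrable_lin_growth[OF lin_min]) (use X_integrable in auto)
    moreover have "(\<integral>\<omega>. min (z + X \<omega>) (a i) \<partial>M) \<le> (\<integral>\<omega>. a i \<partial>M)"
      by (intro integral_mono integrable_lin_growth[OF lin_min]) auto
    ultimately show ?thesis using False X_mean_zero X_integrable by (auto simp: prob_space)
  qed
  have hz: "(\<integral>\<omega>. h (z + X \<omega>) \<partial>M) = (\<Sum>i. w i * (\<integral>\<omega>. min (z + X \<omega>) (a i) \<partial>M))"
     and sI: "summable (\<lambda>i. w i * (\<integral>\<omega>. min (z + X \<omega>) (a i) \<partial>M))" for z
  proof -
    have I1: "integrable M (\<lambda>\<omega>. w i * min (z + X \<omega>) (a i))" for i
      by (intro integrable_mult_right integrable_lin_growth[OF lin_min])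
    have I2: "integrable M (\<lambda>\<omega>. \<bar>z + X \<omega>\<bar>)" using X_integrable by auto
    have S1: "summable (\<lambda>i. \<integral>\<omega>. norm (w i * min (z + X \<omega>) (a i)) \<partial>M)"
    proof (rule summable_comparison_test'[OF summable_mult2[OF sw, of "\<integral>\<omega>. \<bar>z + X \<omega>\<bar> \<partial>M"]])
      fix n
      have "(\<integral>\<omega>. norm (w n * min (z + X \<omega>) (a n)) \<partial>M) \<le> (\<integral>\<omega>. w n * \<bar>z + X \<omega>\<bar> \<partial>M)"
        using mult_left_mono[OF min_abs w] w I1 I2
        by (intro integral_mono integrable_norm) (auto simp: abs_mult)
      then show "norm (\<integral>\<omega>. norm (w n * min (z + X \<omega>) (a n)) \<partial>M) \<le> w n * (\<integral>\<omega>. \<bar>z + X \<omega>\<bar> \<partial>M)"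
        by simp
    qed
    show "(\<integral>\<omega>. h (z + X \<omega>) \<partial>M) = (\<Sum>i. w i * (\<integral>\<omega>. min (z + X \<omega>) (a i) \<partial>M))"
      unfolding h_def by (subst integral_suminf) (use I1 S1 swz in auto)
    show "summable (\<lambda>i. w i * (\<integral>\<omega>. min (z + X \<omega>) (a i) \<partial>M))"
    proof (rule summable_comparison_test'[OF S1])
      fix n show "norm (w n * (\<integral>\<omega>. min (z + X \<omega>) (a n) \<partial>M)) \<le> (\<integral>\<omega>. norm (w n * min (z + X \<omega>) (a n)) \<partial>M)"
        using integral_norm_bound[of M "\<lambda>\<omega>. w n * min (z + X \<omega>) (a n)"] by simp
    qed
  qed
  have h_drift: "(\<integral>\<omega>. h (z + X \<omega>) \<partial>M) \<le> h z" for z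
    unfolding hz unfolding h_def
  proof (intro suminf_le sI swz' mult_left_mono w)
    fix i
    have "0 \<le> (if a i \<le> z \<and> z < a i + d then p * d else 0)" using p d by simp
    then show "(\<integral>\<omega>. min (z + X \<omega>) (a i) \<partial>M) \<le> min z (a i)" using min_drift[of z i] by linarith
  qed
  \<comment> \<open>All terms of the drift series have the same sign, so the window of
    \<open>z\<close> alone supplies \<open>w k * (p * d)\<close>, which is
    \<open>neg_part (a k)\<close> by the choice of \<open>w\<close>.\<close>
  have h_drift': "(\<integral>\<omega>. h (z + X \<omega>) \<partial>M) \<le> h z - neg_part (a k)" if "a k \<le> z" "z < a k + d" for z k
  proof -
    let ?t = "\<lambda>i. w i * min z (a i) - w i * (\<integral>\<omega>. min (z + X \<omega>) (a i) \<partial>M)"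
    have nn: "0 \<le> ?t i" for i
    proof -
      have "0 \<le> (if a i \<le> z \<and> z < a i + d then p * d else 0)" using p d by simp
      then have "(\<integral>\<omega>. min (z + X \<omega>) (a i) \<partial>M) \<le> min z (a i)" using min_drift[of z i] by linarith
      from mult_left_mono[OF this w[of i]] show ?thesis by simp
    qed
    have "neg_part (a k) = w k * (p * d)" unfolding w_def using p d by simp
    also have "\<dots> \<le> ?t k"
      using mult_left_mono[OF min_drift[of z k] w[of k]] that by (simp add: algebra_simps)
    also have "\<dots> \<le> suminf ?t"
      using sum_le_suminf[of ?t "{k}"] nn summable_diff[OF swz' sI] by simp
    also have "\<dots> = h z - (\<integral>\<omega>. h (z + X \<omega>) \<partial>M)"
      unfolding hz unfolding h_def by (rule suminf_diff[OF swz' sI, symmetric])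
    finally show ?thesis by simp
  qed
  define A where "A = real i0 * d"
  \<comment> \<open>A descent by \<open>2 * d\<close> multiplies the exponential in \<open>v\<close>
    by \<open>(1 + p) / p\<close>. Such steps have probability \<open>p\<close> and so contribute
    the factor \<open>1 + p\<close>: the mean of \<open>v\<close> falls by at least
    \<open>p\<close>.\<close>
  define \<theta> where "\<theta> = ln ((1 + p) / p) / (2 * d)"
  have \<theta>: "0 \<le> \<theta>" "exp (\<theta> * (2 * d)) = (1 + p) / p"
    unfolding \<theta>_def using p d by (auto intro!: divide_nonneg_nonneg ln_ge_zero simp: field_simps)
  \<comment> \<open>Clamping makes \<open>v\<close> bounded. The lower clamp
    \<open>- (2 * d)\<close> still lets a descent by \<open>2 * d\<close> from any
    \<open>z \<ge> 0\<close> count in full, and from \<open>A\<close> on \<open>v\<close> has its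
    maximal value -1.\<close>
  define v where "v z = - exp (\<theta> * (A - max (- (2 * d)) (min A z)))" for z
  define B where "B = exp (\<theta> * (A + 2 * d))"
  have A: "0 \<le> A" unfolding A_def using d by simp
  have v_le: "v z \<le> - 1" for z
    unfolding v_def using \<theta>(1) A d by (auto simp: min_def max_def)
  have v_ge: "- B \<le> v z" for z
    unfolding v_def B_def using \<theta>(1) A d by (auto intro!: mult_left_mono)
  have v_meas [measurable]: "v \<in> borel_measurable borel" unfolding v_def by measurable
  have v_lin: "lin_growth v"
  proof (rule lin_growthI[of _ B 0])
    show "0 \<le> B" by (simp add: B_def)
    show "\<bar>v z\<bar> \<le> B + 0 * \<bar>z\<bar>" for z using v_ge[of z] v_le[of z] by simp
  qed auto
  have v_drift: "(\<integral>\<omega>. v (z + X \<omega>) \<partial>M) \<le> v z - p" if "0 \<le> z" "z < A" for z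
  proof -
    have "(\<integral>\<omega>. v (z + X \<omega>) \<partial>M) \<le> (\<integral>\<omega>. - (exp (\<theta> * (A - z)) * ((1 + p) / p)) * indicator ?J \<omega> \<partial>M)"
    proof (intro integral_mono_AE integrable_lin_growth[OF v_lin] AE_I2)
      show "integrable M (\<lambda>\<omega>. - (exp (\<theta> * (A - z)) * ((1 + p) / p)) * indicator ?J \<omega>)" using Jint by simp
      fix \<omega> assume sp: "\<omega> \<in> space M"
      show "v (z + X \<omega>) \<le> - (exp (\<theta> * (A - z)) * ((1 + p) / p)) * indicator ?J \<omega>"
      proof (cases "\<omega> \<in> ?J")
        case True
        have "\<theta> * (A - z) + \<theta> * (2 * d) \<le> \<theta> * (A - max (- (2 * d)) (min A (z + X \<omega>)))"
          unfolding distrib_left[symmetric] using \<theta>(1) True that d by (intro mult_left_mono) auto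
        then have "exp (\<theta> * (A - z)) * ((1 + p) / p) \<le> exp (\<theta> * (A - max (- (2 * d)) (min A (z + X \<omega>))))"
          unfolding \<theta>(2)[symmetric] exp_add[symmetric] by simp
        then show ?thesis using True unfolding v_def by simp
      next
        case False then show ?thesis using v_le[of "z + X \<omega>"] by simp
      qed
    qed
    also have "\<dots> = - (exp (\<theta> * (A - z)) * ((1 + p) / p)) * p"
      by (subst Bochner_Integration.integral_mult_right_zero) (simp only: Jint)
    also have "\<dots> = - exp (\<theta> * (A - z)) - p * exp (\<theta> * (A - z))" using p by (simp add: field_simps)
    also have "\<dots> \<le> v z - p"
      unfolding v_def using that \<theta>(1) d p by (simp add: max_def min_def)
    finally show ?thesis .
  qed
  have v_drift': "(\<integral>\<omega>. v (z + X \<omega>) \<partial>M) \<le> v z" if "A \<le> z" for z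
  proof -
    have "(\<integral>\<omega>. v (z + X \<omega>) \<partial>M) \<le> (\<integral>\<omega>. - 1 \<partial>M)"
      by (intro integral_mono integrable_lin_growth[OF v_lin] v_le) auto
    also have "\<dots> = v z" unfolding v_def using that A d by (simp add: prob_space max_def min_def)
    finally show ?thesis .
  qed
  \<comment> \<open>\<open>c * p\<close> equals \<open>neg_part 0\<close>, which dominates
    \<open>neg_part z\<close> for all \<open>z \<ge> 0\<close>.\<close>
  define c where "c = neg_part 0 / p"
  have c: "0 \<le> c" unfolding c_def using p neg_part_nonneg by simp
  define f where "f z = max 0 (- z) + (c * v z + h z)" for z
  have f_lin: "lin_growth f"
    unfolding f_def[abs_def] by (intro lin_growth_add lin_growth_neg lin_growth_cmult v_lin h_lin)
  have f_int: "(\<integral>\<omega>. f (z + X \<omega>) \<partial>M) = neg_part z + (c * (\<integral>\<omega>. v (z + X \<omega>) \<partial>M) + (\<integral>\<omega>. h (z + X \<omega>) \<partial>M))" for z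
    unfolding f_def neg_part_def
    using integrable_lin_growth[OF lin_growth_neg, of z] integrable_lin_growth[OF v_lin, of z] integrable_lin_growth[OF h_lin, of z]
    by simp
  have f_super: "(\<integral>\<omega>. f (z + X \<omega>) \<partial>M) \<le> f z" if "0 \<le> z" for z
  proof (cases "z < A")
    case True
    have "c * (\<integral>\<omega>. v (z + X \<omega>) \<partial>M) \<le> c * (v z - p)"
      using v_drift[OF that True] c by (rule mult_left_mono)
    also have "\<dots> = c * v z - neg_part 0" unfolding c_def using p by (simp add: field_simps)
    finally show ?thesis
      using neg_part_antimono[OF that] h_drift[of z] that unfolding f_int unfolding f_def by simp
  next
    case False
    \<comment> \<open>The index of the window that contains \<open>z\<close>; the truncated
      subtraction is exact because \<open>z \<ge> A\<close> puts the floor at \<open>i0\<close> or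
      above.\<close>
    define k where "k = nat \<lfloor>z / d\<rfloor> - i0"
    have kz: "real (nat \<lfloor>z / d\<rfloor>) = of_int \<lfloor>z / d\<rfloor>" using that d by simp
    have "real i0 \<le> z / d" using False d unfolding A_def by (simp add: field_simps)
    then have "int i0 \<le> \<lfloor>z / d\<rfloor>" by (simp add: le_floor_iff)
    then have ak: "a k = of_int \<lfloor>z / d\<rfloor> * d" unfolding a_def k_def using kz by (simp add: nat_le_iff of_nat_diff)
    have "of_int \<lfloor>z / d\<rfloor> \<le> z / d" "z / d < of_int \<lfloor>z / d\<rfloor> + 1" by linarith+
    then have "a k \<le> z" "z < a k + d" unfolding ak using d
      by (simp_all only: pos_le_divide_eq pos_divide_less_eq distrib_right mult_1_left)
    moreover have "neg_part z \<le> neg_part (a k)" using \<open>a k \<le> z\<close> by (rule neg_part_antimono)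
    moreover have "c * (\<integral>\<omega>. v (z + X \<omega>) \<partial>M) \<le> c * v z" using v_drift' False c by (intro mult_left_mono) auto
    ultimately show ?thesis using h_drift'[of k z] that unfolding f_int unfolding f_def by simp
  qed
  have f_ge: "max 0 (- z) \<le> 2 * (f z + c * B)" for z
  proof -
    have 1: "- (c * B) \<le> c * v z" using mult_left_mono[OF v_ge[of z] c] by simp
    have "- (1/2) * max 0 (- z) \<le> h z"
    proof (cases "0 \<le> z")
      case True then show ?thesis using h_nonneg[of z] by simp
    next
      case False
      have "suminf w * \<bar>z\<bar> \<le> 1/2 * \<bar>z\<bar>" using we \<epsilon> by (intro mult_right_mono) auto
      then have "\<bar>h z\<bar> \<le> 1/2 * \<bar>z\<bar>" using h_abs[of z] by linarith
      then show ?thesis using False by (simp add: max_def)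
    qed
    then show ?thesis using 1 unfolding f_def by (cases "0 \<le> z") (simp_all add: max_def)
  qed
  have f_le: "f y \<le> \<epsilon> * y" if "0 \<le> y" for y
  proof -
    have "c * v y \<le> 0" using c v_le[of y] by (intro mult_nonneg_nonpos) auto
    moreover have "h y \<le> \<epsilon> * y"
      using h_abs[of y] that we mult_right_mono[of "suminf w" \<epsilon> y] by auto
    ultimately show ?thesis unfolding f_def using that by simp
  qed
  show ?thesis
  proof (intro exI[of _ "2 * (c * B)"] conjI allI impI)
    show "0 \<le> 2 * (c * B)" using c unfolding B_def by simp
    fix D :: "real set" and n :: nat and y :: real
    assume D: "D \<in> sets borel" "D \<subseteq> {0..}" and y: "0 \<le> y"
    have "stopped M X D (\<lambda>z. max 0 (- z)) n y \<le> stopped M X D (\<lambda>z. 2 * (f z + c * B)) n y"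
      using f_ge by (intro stopped_mono lin_growth_neg lin_growth_cmult lin_growth_add f_lin lin_growth_const D) auto
    also have "\<dots> = 2 * (stopped M X D f n y + c * B)"
      unfolding stopped_cmult stopped_add[OF f_lin lin_growth_const D(1)] stopped_const ..
    also have "\<dots> \<le> 2 * (f y + c * B)"
      using stopped_le_superharmonic[OF f_lin D(1)] f_super D(2) by auto
    also have "\<dots> \<le> e * y + 2 * (c * B)"
      using f_le[OF y] mult_right_mono[OF \<epsilon>(3) y] by simp
    finally show "stopped M X D (\<lambda>z. max 0 (- z)) n y \<le> e * y + 2 * (c * B)" .
  qed
qed

text \<open>The mean of the positive part of the stopped walk equals \<open>y\<close> plus that of
  its negative part, hence is at most \<open>2 * y + C\<close> by \<open>overshoot_bound\<close>
  with slope 1. By Harris' inequality it is at least the staying probability times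
  \<open>c * sqrt n\<close>.\<close>

lemma stay_bound:
  assumes c: "0 < c" "\<And>n. N \<le> n \<Longrightarrow> c * sqrt (real n) \<le> stopped M X UNIV (\<lambda>z. max 0 z) n 0"
  shows "\<exists>C\<ge>0. \<forall>D n y. D \<in> sets borel \<longrightarrow> {0<..} \<subseteq> D \<longrightarrow> D \<subseteq> {0..} \<longrightarrow> 0 \<le> y \<longrightarrow>
           sqrt (real n) * stopped M X D (indicator D) n y \<le> C * (1 + y)"
proof -
  obtain C where C: "0 \<le> C" "\<And>D n y. D \<in> sets borel \<Longrightarrow> D \<subseteq> {0..} \<Longrightarrow> 0 \<le> y \<Longrightarrow>
           stopped M X D (\<lambda>z. max 0 (- z)) n y \<le> 1 * y + C"
    using overshoot_bound[of 1] by auto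
  \<comment> \<open>\<open>2 * y + C \<le> (2 + C) * (1 + y)\<close>, divided by \<open>c\<close>,
    gives the first summand; \<open>sqrt N\<close> covers \<open>n < N\<close>, where the
    probability is bounded by 1.\<close>
  show ?thesis
  proof (intro exI[of _ "(2 + C) / c + sqrt (real N)"] conjI allI impI)
    show "0 \<le> (2 + C) / c + sqrt (real N)" using c C by simp
    fix D :: "real set" and n :: nat and y :: real
    assume D: "D \<in> sets borel" "{0<..} \<subseteq> D" "D \<subseteq> {0..}" and y: "0 \<le> y"
    have up: "z' \<in> D" if z: "z \<in> D" "z \<le> z'" for z z'
    proof (cases "0 < z'")
      case True then show ?thesis using D(2) by auto
    next
      case False
      then have "z = z'" using D(3) z by force
      then show ?thesis using z by simp
    qed
    let ?p = "stopped M X D (indicator D) n y"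
    have p: "0 \<le> ?p" "?p \<le> 1" using stopped_indicator_bounds[OF D(1)] by auto
    show "sqrt (real n) * ?p \<le> ((2 + C) / c + sqrt (real N)) * (1 + y)"
    proof (cases "N \<le> n")
      case True
      have "?p * (c * sqrt (real n)) \<le> ?p * stopped M X UNIV (\<lambda>z. max 0 z) n y"
      proof (intro mult_left_mono p)
        have "stopped M X UNIV (\<lambda>z. max 0 z) n 0 \<le> stopped M X UNIV (\<lambda>z. max 0 z) n y"
          using y by (intro monoD[OF mono_stopped_UNIV[OF _ lin_growth_pos]] monoI) auto
        then show "c * sqrt (real n) \<le> stopped M X UNIV (\<lambda>z. max 0 z) n y" using c(2)[OF True] by simp
      qed
      also have "\<dots> \<le> stopped M X D (\<lambda>z. max 0 z) n y"
        by (rule stopped_harris[OF D(1) up _ lin_growth_pos]) (auto simp: mono_def)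
      also have "\<dots> = stopped M X D (\<lambda>z. z + max 0 (- z)) n y"
        by (intro arg_cong[where f = "\<lambda>f. stopped M X D f n y"]) auto
      also have "\<dots> = y + stopped M X D (\<lambda>z. max 0 (- z)) n y"
        by (simp add: stopped_add[OF lin_growth_id lin_growth_neg D(1)] stopped_id)
      also have "\<dots> \<le> 2 * y + C" using C(2)[OF D(1,3) y, of n] by simp
      also have "\<dots> \<le> (2 + C) * (1 + y)" using C(1) y by (simp add: algebra_simps)
      finally have "sqrt (real n) * ?p \<le> (2 + C) / c * (1 + y)" using c(1) by (simp add: field_simps)
      also have "\<dots> \<le> ((2 + C) / c + sqrt (real N)) * (1 + y)" using y by (intro mult_right_mono) auto
      finally show ?thesis .
    next
      case False
      have "sqrt (real n) * ?p \<le> sqrt (real N) * 1" using False p by (intro mult_mono) auto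
      also have "\<dots> \<le> ((2 + C) / c + sqrt (real N)) * (1 + y)" using y c C by (intro mult_mono) auto
      finally show ?thesis .
    qed
  qed
qed

end

section \<open>Decomposition of paths at the crossing times\<close>

text \<open>Survival of one excursion, from its start \<open>j\<close> through time
  \<open>n\<close>. It involves a single mark and the path from \<open>j\<close> on, which is what a
  restart at time \<open>j\<close> requires.\<close>

definition alive :: "(nat \<Rightarrow> (nat \<Rightarrow> real) \<Rightarrow> real \<Rightarrow> bool) \<Rightarrow> (nat \<Rightarrow> real) \<Rightarrow> nat \<Rightarrow> (nat \<Rightarrow> real) \<Rightarrow> nat \<Rightarrow> bool" where
  "alive K s j v n \<longleftrightarrow> (\<forall>m\<in>{j..n}. (0 \<le> s m \<longleftrightarrow> 0 \<le> s j) \<and> \<not> K (m - j) v (s m))"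

text \<open>\<open>reach K s us k j\<close> says $T_k = j \le \tau$ (see \<open>reach_iff\<close>), in a form that depends only on
  the path up to time \<open>j\<close> and on the first \<open>k\<close> marks.\<close>

primrec reach :: "(nat \<Rightarrow> (nat \<Rightarrow> real) \<Rightarrow> real \<Rightarrow> bool) \<Rightarrow> (nat \<Rightarrow> real) \<Rightarrow> (nat \<Rightarrow> nat \<Rightarrow> real) \<Rightarrow> nat \<Rightarrow> nat \<Rightarrow> bool" where
  "reach K s us 0 j \<longleftrightarrow> j = 0"
| "reach K s us (Suc k) j \<longleftrightarrow> (\<exists>i<j. reach K s us k i \<and> alive K s i (us k) (j - 1) \<and> \<not> (0 \<le> s j \<longleftrightarrow> 0 \<le> s i))"

lemma crosses_iff: "crosses s t n \<longleftrightarrow> \<not> (0 \<le> s n \<longleftrightarrow> 0 \<le> s t)"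
  by (auto simp: crosses_def)

lemma zc_time_Suc_eq_iff:
  assumes "zc_time s k = enat i"
  shows "zc_time s (Suc k) = enat j \<longleftrightarrow> i < j \<and> (\<forall>m\<in>{i<..<j}. \<not> crosses s i m) \<and> crosses s i j"
proof
  assume *: "zc_time s (Suc k) = enat j"
  then have ex: "\<exists>n>i. crosses s i n" using assms by (auto split: if_splits)
  then have j: "j = (LEAST n. i < n \<and> crosses s i n)" using * assms by simp
  have "i < j \<and> crosses s i j" unfolding j by (rule LeastI_ex) (use ex in blast)
  then show "i < j \<and> (\<forall>m\<in>{i<..<j}. \<not> crosses s i m) \<and> crosses s i j"
    using not_less_Least[of _ "\<lambda>n. i < n \<and> crosses s i n"] unfolding j[symmetric] by auto
next
  assume *: "i < j \<and> (\<forall>m\<in>{i<..<j}. \<not> crosses s i m) \<and> crosses s i j"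
  then have "(LEAST n. i < n \<and> crosses s i n) = j"
    by (intro Least_equality) (auto simp: not_less[symmetric])
  then show "zc_time s (Suc k) = enat j" using * assms by auto
qed

lemma less_zc_time_Suc_iff:
  assumes "zc_time s k = enat i"
  shows "enat n < zc_time s (Suc k) \<longleftrightarrow> (\<forall>m\<in>{i<..n}. \<not> crosses s i m)"
proof (cases "zc_time s (Suc k)")
  case (enat j)
  with zc_time_Suc_eq_iff[OF assms, of j]
  have "i < j" "\<forall>m\<in>{i<..<j}. \<not> crosses s i m" "crosses s i j" by auto
  then show ?thesis using enat by (auto simp: not_less)
next
  case infinity
  then show ?thesis using assms by (auto split: if_splits)
qed

declare zc_time.simps(2) [simp del]

lemma zc_time_Suc_infinity: "zc_time s k = \<infinity> \<Longrightarrow> zc_time s (Suc k) = \<infinity>"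
  by (simp add: zc_time.simps(2))

lemma zc_time_mono: "k \<le> l \<Longrightarrow> zc_time s k \<le> zc_time s l"
proof (rule lift_Suc_mono_le[of "zc_time s"])
  fix k
  show "zc_time s k \<le> zc_time s (Suc k)"
  proof (cases "zc_time s k")
    case (enat i)
    show ?thesis
    proof (cases "zc_time s (Suc k)")
      case (enat j)
      then show ?thesis using zc_time_Suc_eq_iff[OF \<open>zc_time s k = enat i\<close>, of j] \<open>zc_time s k = enat i\<close> by simp
    qed simp
  qed (simp add: zc_time_Suc_infinity)
qed

text \<open>Crossing times increase strictly, so by time \<open>n\<close> at most \<open>n\<close>
  crossings have occurred and the decomposition at the crossings is a finite sum.\<close>

lemma zc_time_ge: "enat k \<le> zc_time s k"
proof (induction k)
  case (Suc k)
  show ?case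
  proof (cases "zc_time s (Suc k)")
    case (enat j)
    then obtain i where i: "zc_time s k = enat i" by (cases "zc_time s k") (auto simp: zc_time_Suc_infinity)
    have "i < j" using zc_time_Suc_eq_iff[OF i, of j] enat by simp
    moreover have "k \<le> i" using Suc i by simp
    ultimately show ?thesis using enat by simp
  qed auto
qed (simp add: zero_enat_def)

lemma zc_time_interval_unique:
  assumes "zc_time s k \<le> enat n" "enat n < zc_time s (Suc k)"
    and "zc_time s l \<le> enat n" "enat n < zc_time s (Suc l)"
  shows "k = l"
proof (rule ccontr)
  assume "k \<noteq> l"
  then consider "Suc k \<le> l" | "Suc l \<le> k" by linarith
  then show False
  proof cases
    case 1 from zc_time_mono[OF this, of s] show ?thesis using assms by (meson leD order_less_le_trans)
  next
    case 2 from zc_time_mono[OF this, of s] show ?thesis using assms by (meson leD order_less_le_trans)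
  qed
qed

lemma absorbed_at_iff:
  assumes "zc_time s k = enat i" "i \<le> n" "enat n < zc_time s (Suc k)"
  shows "absorbed_at s us K n \<longleftrightarrow> K (n - i) (us k) (s n)"
proof
  assume "absorbed_at s us K n"
  then obtain l where l: "zc_time s l \<le> enat n" "enat n < zc_time s (Suc l)" "K (n - the_enat (zc_time s l)) (us l) (s n)"
    unfolding absorbed_at_def by blast
  have "l = k" by (rule zc_time_interval_unique[OF l(1,2)]) (use assms in auto)
  then show "K (n - i) (us k) (s n)" using l(3) assms(1) by simp
next
  assume "K (n - i) (us k) (s n)"
  then show "absorbed_at s us K n" unfolding absorbed_at_def using assms by (intro exI[of _ k]) auto
qed

lemma less_absorb_time_iff: "enat n < absorb_time s us K \<longleftrightarrow> (\<forall>m\<le>n. \<not> absorbed_at s us K m)"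
proof (cases "\<exists>m. absorbed_at s us K m")
  case True
  then have eq: "absorb_time s us K = enat (LEAST m. absorbed_at s us K m)" by (simp add: absorb_time_def)
  have L: "absorbed_at s us K (LEAST m. absorbed_at s us K m)" using True by (rule LeastI_ex)
  have "n < (LEAST m. absorbed_at s us K m) \<longleftrightarrow> (\<forall>m\<le>n. \<not> absorbed_at s us K m)"
    using L not_less_Least by (meson leI order.strict_trans1)
  then show ?thesis unfolding eq by simp
qed (auto simp: absorb_time_def)

lemma le_absorb_time_iff: "enat n \<le> absorb_time s us K \<longleftrightarrow> (\<forall>m<n. \<not> absorbed_at s us K m)"
proof (cases n)
  case 0 then show ?thesis by (simp add: zero_enat_def[symmetric])
next
  case (Suc m)
  have "enat n \<le> absorb_time s us K \<longleftrightarrow> enat m < absorb_time s us K"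
    unfolding Suc by (cases "absorb_time s us K") auto
  then show ?thesis unfolding less_absorb_time_iff Suc by auto
qed

lemma alive_iff:
  assumes "zc_time s k = enat i" "i \<le> n"
  shows "alive K s i (us k) n \<longleftrightarrow> enat n < zc_time s (Suc k) \<and> (\<forall>m\<in>{i..n}. \<not> absorbed_at s us K m)"
proof -
  have 1: "(\<forall>m\<in>{i..n}. 0 \<le> s m \<longleftrightarrow> 0 \<le> s i) \<longleftrightarrow> enat n < zc_time s (Suc k)"
    unfolding less_zc_time_Suc_iff[OF assms(1)] crosses_iff by (force simp: le_less)
  have 2: "absorbed_at s us K m \<longleftrightarrow> K (m - i) (us k) (s m)" if "m \<in> {i..n}" "enat n < zc_time s (Suc k)" for m
    using that by (intro absorbed_at_iff assms(1)) (auto intro: order_le_less_trans[of "enat m" "enat n"])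
  show ?thesis unfolding alive_def using 1 2 by blast
qed

text \<open>The excursion before \<open>j\<close> has to survive up to \<open>j - 1\<close> only:
  absorption at time \<open>j\<close> itself is decided by the next mark. Hence the weak inequality
  between \<open>j\<close> and the absorption time.\<close>

lemma reach_iff: "reach K s us k j \<longleftrightarrow> zc_time s k = enat j \<and> enat j \<le> absorb_time s us K"
proof (induction k arbitrary: j)
  case 0 show ?case by (auto simp: enat_0_iff zero_enat_def[symmetric])
next
  case (Suc k)
  show ?case
  proof
    assume "reach K s us (Suc k) j"
    then obtain i where i: "i < j" "reach K s us k i" "alive K s i (us k) (j - 1)" "\<not> (0 \<le> s j \<longleftrightarrow> 0 \<le> s i)" by auto
    have Tk: "zc_time s k = enat i" and ab: "\<forall>m<i. \<not> absorbed_at s us K m"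
      using i(2) Suc by (auto simp: le_absorb_time_iff)
    from alive_iff[OF Tk, of "j - 1" K us] i have a: "enat (j - 1) < zc_time s (Suc k)"
        "\<forall>m\<in>{i..j - 1}. \<not> absorbed_at s us K m" by auto
    from a(1) have "\<forall>m\<in>{i<..<j}. \<not> crosses s i m" unfolding less_zc_time_Suc_iff[OF Tk] by auto
    then have "zc_time s (Suc k) = enat j" unfolding zc_time_Suc_eq_iff[OF Tk] using i by (auto simp: crosses_iff)
    moreover have "\<not> absorbed_at s us K m" if "m < j" for m
      using ab a(2) that by (cases "m < i") auto
    ultimately show "zc_time s (Suc k) = enat j \<and> enat j \<le> absorb_time s us K"
      unfolding le_absorb_time_iff by blast
  next
    assume *: "zc_time s (Suc k) = enat j \<and> enat j \<le> absorb_time s us K"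
    then obtain i where Tk: "zc_time s k = enat i" by (cases "zc_time s k") (auto simp: zc_time_Suc_infinity)
    with * have i: "i < j" "crosses s i j" using zc_time_Suc_eq_iff[OF Tk, of j] by auto
    have "enat (j - 1) < zc_time s (Suc k)" using * i by auto
    then have "alive K s i (us k) (j - 1)"
      using * i by (subst alive_iff[OF Tk]) (auto simp: le_absorb_time_iff)
    moreover have "reach K s us k i" using Suc[of i] Tk * i by (auto simp: le_absorb_time_iff)
    ultimately show "reach K s us (Suc k) j" using i by (auto simp: crosses_iff)
  qed
qed

lemma reach_alive_unique:
  assumes "reach K s us k j" "alive K s j (us k) n" "j \<le> n" "reach K s us l i" "alive K s i (us l) n" "i \<le> n"
  shows "k = l" "j = i"
proof -
  have T: "zc_time s k = enat j" "zc_time s l = enat i" using assms by (auto simp: reach_iff)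
  show "k = l"
    using assms T alive_iff[OF T(1), of n K us] alive_iff[OF T(2), of n K us]
    by (intro zc_time_interval_unique[of s k n l]) auto
  then show "j = i" using T by simp
qed

lemma less_absorb_time_decomp:
  "enat n < absorb_time s us K \<longleftrightarrow> (\<exists>k\<le>n. \<exists>j\<le>n. reach K s us k j \<and> alive K s j (us k) n)"
proof
  assume *: "enat n < absorb_time s us K"
  \<comment> \<open>The first crossing index beyond time \<open>n\<close>. It is at most
    \<open>Suc n\<close> by \<open>zc_time_ge\<close> and not 0 because the time of index 0 is 0;
    its predecessor is the wanted \<open>k\<close>.\<close>
  define l where "l = (LEAST l. enat n < zc_time s l)"
  have "enat n < zc_time s (Suc n)" using zc_time_ge[of "Suc n" s] by (auto intro: order_less_le_trans[of _ "enat (Suc n)"])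
  then have l: "enat n < zc_time s l" "l \<le> Suc n" unfolding l_def by (auto intro: LeastI Least_le)
  then have "l \<noteq> 0" by (intro notI) (simp add: enat_0_iff)
  then obtain k where k: "l = Suc k" by (cases l) auto
  have "\<not> enat n < zc_time s k" using not_less_Least[of k "\<lambda>l. enat n < zc_time s l"] k unfolding l_def by auto
  then obtain j where j: "zc_time s k = enat j" "j \<le> n" by (cases "zc_time s k") (auto simp: not_less)
  have "reach K s us k j" using * j by (auto simp: reach_iff le_absorb_time_iff less_absorb_time_iff)
  moreover have "alive K s j (us k) n" using * l k j by (subst alive_iff) (auto simp: less_absorb_time_iff)
  ultimately show "\<exists>k\<le>n. \<exists>j\<le>n. reach K s us k j \<and> alive K s j (us k) n" using j l k by auto
next
  assume "\<exists>k\<le>n. \<exists>j\<le>n. reach K s us k j \<and> alive K s j (us k) n"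
  then obtain k j where kj: "j \<le> n" "reach K s us k j" "alive K s j (us k) n" by blast
  have Tk: "zc_time s k = enat j" and ab: "\<forall>m<j. \<not> absorbed_at s us K m"
    using kj(2) by (auto simp: reach_iff le_absorb_time_iff)
  from alive_iff[OF Tk kj(1), of K us] kj(3) have "\<forall>m\<in>{j..n}. \<not> absorbed_at s us K m" by auto
  with ab show "enat n < absorb_time s us K" unfolding less_absorb_time_iff by (metis atLeastAtMost_iff not_less)
qed

text \<open>Identifies the conditioning event of (C2) and (C4).\<close>

lemma first_excursion_iff:
  "enat n < absorb_time s us K \<and> enat n < zc_time s 1 \<longleftrightarrow> alive K s 0 (us 0) n"
  using alive_iff[of s 0 0 n K us] by (auto simp: zero_enat_def less_absorb_time_iff)

text \<open>The stopping-time property: continuing the path after \<open>j\<close> or the marks from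
  \<open>k\<close> on differently has no influence.\<close>

lemma reach_cong:
  assumes "\<And>i. i \<le> j \<Longrightarrow> s i = s' i" "\<And>i. i < k \<Longrightarrow> us i = us' i"
  shows "reach K s us k j \<longleftrightarrow> reach K s' us' k j"
  using assms
proof (induction k arbitrary: j)
  case (Suc k)
  have "(reach K s us k i \<and> alive K s i (us k) (j - 1) \<and> \<not> (0 \<le> s j \<longleftrightarrow> 0 \<le> s i))
      \<longleftrightarrow> (reach K s' us' k i \<and> alive K s' i (us' k) (j - 1) \<and> \<not> (0 \<le> s' j \<longleftrightarrow> 0 \<le> s' i))" if "i < j" for i
  proof -
    have "reach K s us k i \<longleftrightarrow> reach K s' us' k i" by (rule Suc.IH) (use Suc.prems that in auto)
    moreover have "alive K s i (us k) (j - 1) \<longleftrightarrow> alive K s' i (us' k) (j - 1)"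
      unfolding alive_def using Suc.prems that by (intro ball_cong) auto
    ultimately show ?thesis using Suc.prems that by auto
  qed
  then show ?case by auto
qed simp

lemma alive_shift:
  assumes "j \<le> n"
  shows "alive K s j v n \<longleftrightarrow> alive K (\<lambda>m. s (j + m)) 0 v (n - j)"
proof
  assume *: "alive K s j v n"
  show "alive K (\<lambda>m. s (j + m)) 0 v (n - j)"
    unfolding alive_def
  proof
    fix m assume "m \<in> {0..n - j}"
    then have "j + m \<in> {j..n}" using assms by simp
    with * show "(0 \<le> s (j + m) \<longleftrightarrow> 0 \<le> s (j + 0)) \<and> \<not> K (m - 0) v (s (j + m))"
      unfolding alive_def by fastforce
  qed
next
  assume *: "alive K (\<lambda>m. s (j + m)) 0 v (n - j)"
  show "alive K s j v n"
    unfolding alive_def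
  proof
    fix m assume "m \<in> {j..n}"
    then have "m - j \<in> {0..n - j}" "j + (m - j) = m" by auto
    with * show "(0 \<le> s m \<longleftrightarrow> 0 \<le> s j) \<and> \<not> K (m - j) v (s m)"
      unfolding alive_def by fastforce
  qed
qed

lemma alive_antimono: "alive K s j v n \<Longrightarrow> m \<le> n \<Longrightarrow> alive K s j v m"
  unfolding alive_def by (meson atLeastAtMost_iff order_trans)

lemma reach_unique: "reach K s us k j \<Longrightarrow> reach K s us k i \<Longrightarrow> i = j"
  by (auto simp: reach_iff)

section \<open>The Markov property\<close>

abbreviation marks :: "(nat \<Rightarrow> real) measure" where
  "marks \<equiv> PiM UNIV (\<lambda>_::nat. borel)"

abbreviation paths :: "((nat \<Rightarrow> real) \<times> (nat \<Rightarrow> nat \<Rightarrow> real)) measure" where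
  "paths \<equiv> PiM UNIV (\<lambda>_::nat. borel) \<Otimes>\<^sub>M PiM UNIV (\<lambda>_::nat. marks)"

text \<open>The walk as a function of the increment sequence instead of the sample point, so that
  sequences can be cut and concatenated by \<open>comb_seq\<close>.\<close>

definition wpath :: "real \<Rightarrow> (nat \<Rightarrow> real) \<Rightarrow> nat \<Rightarrow> real" where
  "wpath y \<xi> n = y + (\<Sum>i<n. \<xi> i)"

lemma walk_eq_wpath: "walk X y \<omega> = wpath y (\<lambda>n. X n \<omega>)"
  by (auto simp: walk_def wpath_def)

lemma wpath_0 [simp]: "wpath y \<xi> 0 = y"
  by (simp add: wpath_def)

lemma wpath_comb_le: "n \<le> j \<Longrightarrow> wpath y (comb_seq j \<xi> \<xi>') n = wpath y \<xi> n"
  unfolding wpath_def by (intro arg_cong2[where f = "(+)"] sum.cong) (auto simp: comb_seq_def)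

lemma wpath_add: "wpath y \<xi> (j + m) = wpath (wpath y \<xi> j) (\<lambda>i. \<xi> (j + i)) m"
  by (induction m) (auto simp: wpath_def)

lemma wpath_Suc_shift: "wpath (y + \<xi> 0) (\<lambda>i. \<xi> (Suc i)) n = wpath y \<xi> (Suc n)"
  by (simp add: wpath_def sum.lessThan_Suc_shift del: sum.lessThan_Suc)

lemma wpath_comb_add: "wpath y (comb_seq j \<xi> \<xi>') (j + m) = wpath (wpath y \<xi> j) \<xi>' m"
  unfolding wpath_add wpath_comb_le[OF order_refl] by (simp add: comb_seq_def)

lemma measurable_wpath [measurable]:
  assumes "f \<in> borel_measurable N" "g \<in> measurable N marks"
  shows "(\<lambda>x. wpath (f x) (g x) n) \<in> borel_measurable N"
  unfolding wpath_def using assms by measurable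

text \<open>The pathwise version of \<open>stopped\<close>, with the same recursion on the first
  step; \<open>stopped_path_integral\<close> joins them with one use of \<open>markov\<close> per
  step.\<close>

primrec stopped_path :: "real set \<Rightarrow> (real \<Rightarrow> real) \<Rightarrow> nat \<Rightarrow> real \<Rightarrow> (nat \<Rightarrow> real) \<Rightarrow> real" where
  "stopped_path D f 0 y \<xi> = f y"
| "stopped_path D f (Suc n) y \<xi> = (if y \<in> D then stopped_path D f n (y + \<xi> 0) (\<lambda>i. \<xi> (Suc i)) else f y)"

lemma measurable_stopped_path:
  assumes [measurable]: "f \<in> borel_measurable borel" "D \<in> sets borel"
  shows "(\<lambda>(y, \<xi>). stopped_path D f n y \<xi>) \<in> borel_measurable (borel \<Otimes>\<^sub>M marks)"
proof (induction n)
  case 0 show ?case by simp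
next
  case (Suc n)
  have "(\<lambda>p. (fst p + snd p 0, \<lambda>i. snd p (Suc i))) \<in> measurable (borel \<Otimes>\<^sub>M marks) (borel \<Otimes>\<^sub>M marks)"
    by (intro measurable_Pair measurable_PiM_single') (auto simp: space_pair_measure space_PiM)
  from measurable_compose[OF this Suc]
  have [measurable]: "(\<lambda>p. stopped_path D f n (fst p + snd p 0) (\<lambda>i. snd p (Suc i))) \<in> borel_measurable (borel \<Otimes>\<^sub>M marks)"
    by simp
  show ?case unfolding stopped_path.simps split_beta by measurable
qed

lemma stopped_path_indicator:
  "stopped_path D (indicator D) n y \<xi> = of_bool (\<forall>m\<le>n. wpath y \<xi> m \<in> D)"
proof (induction n arbitrary: y \<xi>)
  case (Suc n)
  have "(\<forall>m\<le>Suc n. wpath y \<xi> m \<in> D) \<longleftrightarrow> y \<in> D \<and> (\<forall>m\<le>n. wpath y \<xi> (Suc m) \<in> D)"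
    unfolding less_Suc_eq_le[symmetric] All_less_Suc2 by simp
  then show ?case using Suc by (simp add: wpath_Suc_shift)
qed (simp add: indicator_def)

lemma stopped_path_UNIV: "stopped_path UNIV f n y \<xi> = f (wpath y \<xi> n)"
proof (induction n arbitrary: y \<xi>)
  case (Suc n) then show ?case by (simp add: wpath_Suc_shift)
qed simp

lemma stopped_path_exit:
  assumes "d \<le> n" "wpath y \<xi> d \<notin> D" "\<And>e. e < d \<Longrightarrow> wpath y \<xi> e \<in> D"
  shows "stopped_path D f n y \<xi> = f (wpath y \<xi> d)"
  using assms
proof (induction n arbitrary: y \<xi> d)
  case (Suc n)
  show ?case
  proof (cases d)
    case 0 then show ?thesis using Suc.prems by simp
  next
    case (Suc d')
    have "y \<in> D" using Suc.prems(3)[of 0] Suc by simp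
    moreover have "stopped_path D f n (y + \<xi> 0) (\<lambda>i. \<xi> (Suc i)) = f (wpath (y + \<xi> 0) (\<lambda>i. \<xi> (Suc i)) d')"
      using Suc.prems Suc by (intro Suc.IH) (auto simp: wpath_Suc_shift)
    ultimately show ?thesis using Suc by (simp add: wpath_Suc_shift)
  qed
qed auto

text \<open>Carries bounds for upper half-lines and the step \<open>- X\<close> over to lower
  half-lines and the step \<open>X\<close>.\<close>

lemma stopped_reflect:
  "stopped M (\<lambda>\<omega>. - X \<omega>) D f n y = stopped M X (uminus ` D) (\<lambda>z. f (- z)) n (- y)"
proof (induction n arbitrary: y)
  case (Suc n)
  have "- y \<in> uminus ` D \<longleftrightarrow> y \<in> D" by force
  then show ?case using Suc by simp
qed simp

locale killed_walk = prob_space M for M :: "'a measure" +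
  fixes X :: "nat \<Rightarrow> 'a \<Rightarrow> real"
    and U :: "nat \<Rightarrow> 'a \<Rightarrow> nat \<Rightarrow> real"
    and K :: "nat \<Rightarrow> (nat \<Rightarrow> real) \<Rightarrow> real \<Rightarrow> bool"
    and \<sigma> :: real
  assumes indep: "indep_vars (\<lambda>_. marks)
            (\<lambda>i \<omega>. case i of Inl n \<Rightarrow> (\<lambda>_::nat. X n \<omega>) | Inr k \<Rightarrow> U k \<omega>) (UNIV :: (nat + nat) set)"
    and X_ident: "\<And>n. distr M borel (X n) = distr M borel (X 0)"
    and U_ident: "\<And>k. distr M marks (U k) = distr M marks (U 0)"
    and X_int: "integrable M (X 0)"
    and X_mean: "(\<integral>\<omega>. X 0 \<omega> \<partial>M) = 0"
    and X_sq_int: "integrable M (\<lambda>\<omega>. (X 0 \<omega>)\<^sup>2)"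
    and \<sigma>_pos: "\<sigma> > 0"
    and X_var: "(\<integral>\<omega>. (X 0 \<omega>)\<^sup>2 \<partial>M) = \<sigma>\<^sup>2"
    and K_meas: "\<And>i. (\<lambda>(v, y). K i v y) \<in> measurable (marks \<Otimes>\<^sub>M borel) (count_space UNIV)"
begin

abbreviation Xs :: "'a \<Rightarrow> nat \<Rightarrow> real" where "Xs \<omega> \<equiv> (\<lambda>n. X n \<omega>)"
abbreviation Us :: "'a \<Rightarrow> nat \<Rightarrow> nat \<Rightarrow> real" where "Us \<omega> \<equiv> (\<lambda>k. U k \<omega>)"

text \<open>An increment is stored as a constant sequence, so that increments and marks form one
  independent family with values in a single space.\<close>

definition V :: "nat + nat \<Rightarrow> 'a \<Rightarrow> nat \<Rightarrow> real" where
  "V i \<omega> = (case i of Inl n \<Rightarrow> (\<lambda>_. X n \<omega>) | Inr k \<Rightarrow> U k \<omega>)"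

lemma V_simps [simp]: "V (Inl n) \<omega> = (\<lambda>_. X n \<omega>)" "V (Inr k) \<omega> = U k \<omega>"
  by (auto simp: V_def)

lemma indep_V: "indep_vars (\<lambda>_. marks) V UNIV"
  using indep unfolding V_def[abs_def] .

lemma V_measurable [measurable]: "V i \<in> measurable M marks"
  using indep_V unfolding indep_vars_def2 by auto

lemma X_measurable [measurable]: "X n \<in> borel_measurable M"
proof -
  have "(\<lambda>\<omega>. V (Inl n) \<omega> 0) \<in> borel_measurable M" by measurable
  then show ?thesis by simp
qed

lemma U_measurable [measurable]: "U k \<in> measurable M marks"
proof -
  have "V (Inr k) \<in> measurable M marks" by measurable
  then show ?thesis by (simp add: V_def[abs_def])
qed

lemma Xs_measurable [measurable]: "Xs \<in> measurable M marks"
  by (rule measurable_PiM_single') auto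

lemma Us_measurable [measurable]: "Us \<in> measurable M (PiM UNIV (\<lambda>_::nat. marks))"
  by (rule measurable_PiM_single') (auto simp: space_PiM)

lemma distr_V:
  "distr M (PiM UNIV (\<lambda>_. marks)) (\<lambda>\<omega> i. V i \<omega>) = PiM UNIV (\<lambda>i. distr M marks (V i))"
  using indep_vars_iff_distr_eq_PiM[where I = UNIV and M' = "\<lambda>_. marks" and X = V] indep_V by (simp add: restrict_UNIV)

lemma distr_V_Inl: "distr M marks (V (Inl n)) = distr M marks (V (Inl 0))"
proof -
  have c: "(\<lambda>x _. x) \<in> measurable borel (PiM UNIV (\<lambda>_::nat. borel :: real measure))"
    by (rule measurable_PiM_single') auto
  have "distr M marks (V (Inl n)) = distr (distr M borel (X n)) marks (\<lambda>x _. x)" for n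
    by (subst distr_distr[OF c]) (auto simp: comp_def V_def[abs_def])
  then show ?thesis using X_ident[of n] by simp
qed

lemma distr_V_Inr: "distr M marks (V (Inr n)) = distr M marks (V (Inr 0))"
  using U_ident[of n] by (simp add: V_def[abs_def])

text \<open>The Markov property in the form of an equality of laws: an initial segment of one
  sample, continued by an independent second sample, is distributed like one sample.\<close>

lemma distr_comb:
  "distr (M \<Otimes>\<^sub>M M) paths (\<lambda>(\<omega>, \<omega>'). (comb_seq j (Xs \<omega>) (Xs \<omega>'), comb_seq k (Us \<omega>) (Us \<omega>')))
     = distr M paths (\<lambda>\<omega>. (Xs \<omega>, Us \<omega>))"
proof -
  define A where "A = Inl ` {..<j} \<union> Inr ` {..<k}"
  \<comment> \<open>The shift takes its values outside \<open>A\<close>, so the shifted family is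
    independent of the first \<open>j\<close> increments and \<open>k\<close> marks. Being injective
    and respecting the two kinds of index, it does not change the joint law.\<close>
  define f :: "nat + nat \<Rightarrow> nat + nat" where "f i = (case i of Inl n \<Rightarrow> Inl (n + j) | Inr n \<Rightarrow> Inr (n + k))" for i
  have fA: "f i \<in> - A" for i by (auto simp: f_def A_def split: sum.splits)
  have inj: "inj f" by (auto simp: f_def inj_def split: sum.splits)
  let ?B = "\<lambda>_. marks"
  let ?VA = "\<lambda>\<omega>. restrict (\<lambda>i. V i \<omega>) A" and ?S = "\<lambda>\<omega> i. V (f i) \<omega>" and ?V = "\<lambda>\<omega> i. V i \<omega>"
  have Vm [measurable]: "?V \<in> measurable M (PiM UNIV ?B)" by (rule measurable_PiM_single') (auto simp: space_PiM)
  have VAm [measurable]: "?VA \<in> measurable M (PiM A ?B)" by (rule measurable_restrict) simp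
  have fm: "(\<lambda>w i. w (f i)) \<in> measurable (PiM UNIV ?B) (PiM UNIV ?B)"
    by (rule measurable_PiM_single') (auto simp: space_PiM)
  have Dprob: "prob_space (distr M marks (V i))" for i by (rule prob_space_distr) simp
  have "distr M (PiM UNIV ?B) ?S = distr (distr M (PiM UNIV ?B) ?V) (PiM UNIV ?B) (\<lambda>w i. w (f i))"
    by (subst distr_distr[OF fm Vm]) (simp add: comp_def)
  also have "\<dots> = distr (PiM UNIV (\<lambda>i. distr M marks (V i))) (PiM UNIV (\<lambda>i. distr M marks (V (f i)))) (\<lambda>w. \<lambda>n\<in>UNIV. w (f n))"
    unfolding distr_V by (intro distr_cong sets_PiM_cong) auto
  also have "\<dots> = PiM UNIV (\<lambda>i. distr M marks (V (f i)))"
    by (rule distr_PiM_reindex) (use Dprob inj in auto)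
  also have "(\<lambda>i. distr M marks (V (f i))) = (\<lambda>i. distr M marks (V i))"
  proof
    fix i :: "nat + nat"
    show "distr M marks (V (f i)) = distr M marks (V i)"
    proof (cases i)
      case (Inl a)
      then show ?thesis using distr_V_Inl[of "a + j"] distr_V_Inl[of a] by (simp add: f_def)
    next
      case (Inr a)
      then show ?thesis using distr_V_Inr[of "a + k"] distr_V_Inr[of a] by (simp add: f_def)
    qed
  qed
  finally have distrS: "distr M (PiM UNIV ?B) ?S = distr M (PiM UNIV ?B) ?V" unfolding distr_V .
  have "indep_var (PiM A ?B) ?VA (PiM (- A) ?B) (\<lambda>\<omega>. restrict (\<lambda>i. V i \<omega>) (- A))"
    by (rule indep_var_restrict[OF indep_V]) auto
  moreover have "(\<lambda>w i. w (f i)) \<in> measurable (PiM (- A) ?B) (PiM UNIV ?B)"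
  proof (rule measurable_PiM_single')
    show "(\<lambda>w. w (f i)) \<in> measurable (PiM (- A) ?B) marks" for i by (rule measurable_component_singleton[OF fA])
  qed (auto simp: space_PiM)
  ultimately have "indep_var (PiM A ?B) ((\<lambda>w. w) \<circ> ?VA) (PiM UNIV ?B) ((\<lambda>w i. w (f i)) \<circ> (\<lambda>\<omega>. restrict (\<lambda>i. V i \<omega>) (- A)))"
    by (intro indep_var_compose) auto
  moreover have "(\<lambda>w i. w (f i)) \<circ> (\<lambda>\<omega>. restrict (\<lambda>i. V i \<omega>) (- A)) = ?S"
    using fA by (auto simp: fun_eq_iff)
  ultimately have "indep_var (PiM A ?B) ?VA (PiM UNIV ?B) ?S" by (simp add: comp_def)
  then have J: "distr M (PiM A ?B \<Otimes>\<^sub>M PiM UNIV ?B) (\<lambda>\<omega>. (?VA \<omega>, ?S \<omega>)) = distr M (PiM A ?B) ?VA \<Otimes>\<^sub>M distr M (PiM UNIV ?B) ?V"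
    and [measurable]: "?S \<in> measurable M (PiM UNIV ?B)"
    unfolding indep_var_distribution_eq distrS by auto
  have sf: "sigma_finite_measure (distr M (PiM UNIV ?B) ?V)"
    using prob_space_distr[OF Vm] by (simp add: prob_space_imp_sigma_finite)
  \<comment> \<open>\<open>R\<close> glues the initial segments in \<open>v\<close> to the sequences
    in \<open>w\<close>. Fed with a sample and its own shift it returns the sample; fed with two
    independent samples it returns the concatenation.\<close>
  define R where "R = (\<lambda>(v :: nat + nat \<Rightarrow> nat \<Rightarrow> real, w).
      (\<lambda>n. if n < j then v (Inl n) (0::nat) else w (Inl (n - j)) 0, \<lambda>n. if n < k then v (Inr n) else w (Inr (n - k))))"
  have z: "(\<lambda>v. v 0) \<in> borel_measurable marks" by measurable
  have Rm: "R \<in> measurable (PiM A ?B \<Otimes>\<^sub>M PiM UNIV ?B) paths"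
    unfolding R_def split_beta
  proof (rule measurable_Pair)
    show "(\<lambda>x n. if n < j then fst x (Inl n) (0::nat) else snd x (Inl (n - j)) 0) \<in> measurable (PiM A ?B \<Otimes>\<^sub>M PiM UNIV ?B) marks"
    proof (rule measurable_PiM_single')
      fix n
      show "(\<lambda>x. if n < j then fst x (Inl n) (0::nat) else snd x (Inl (n - j)) 0) \<in> borel_measurable (PiM A ?B \<Otimes>\<^sub>M PiM UNIV ?B)"
      proof (cases "n < j")
        case True
        then have "Inl n \<in> A" by (auto simp: A_def)
        then have c: "(\<lambda>v. v (Inl n)) \<in> measurable (PiM A ?B) marks" by (rule measurable_component_singleton)
        have "(\<lambda>x. fst x (Inl n) 0) \<in> borel_measurable (PiM A ?B \<Otimes>\<^sub>M PiM UNIV ?B)"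
          by (rule measurable_compose[OF measurable_fst measurable_compose[OF c z]])
        then show ?thesis using True by simp
      next
        case False
        have c: "(\<lambda>w. w (Inl (n - j))) \<in> measurable (PiM UNIV ?B) marks" by (rule measurable_component_singleton) simp
        have "(\<lambda>x. snd x (Inl (n - j)) 0) \<in> borel_measurable (PiM A ?B \<Otimes>\<^sub>M PiM UNIV ?B)"
          by (rule measurable_compose[OF measurable_snd measurable_compose[OF c z]])
        then show ?thesis using False by simp
      qed
    qed auto
    show "(\<lambda>x n. if n < k then fst x (Inr n) else snd x (Inr (n - k))) \<in> measurable (PiM A ?B \<Otimes>\<^sub>M PiM UNIV ?B) (PiM UNIV (\<lambda>_. marks))"
    proof (rule measurable_PiM_single')
      fix n
      show "(\<lambda>x. if n < k then fst x (Inr n) else snd x (Inr (n - k))) \<in> measurable (PiM A ?B \<Otimes>\<^sub>M PiM UNIV ?B) marks"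
      proof (cases "n < k")
        case True
        then have "Inr n \<in> A" by (auto simp: A_def)
        then have c: "(\<lambda>v. v (Inr n)) \<in> measurable (PiM A ?B) marks" by (rule measurable_component_singleton)
        have "(\<lambda>x. fst x (Inr n)) \<in> measurable (PiM A ?B \<Otimes>\<^sub>M PiM UNIV ?B) marks"
          by (rule measurable_compose[OF measurable_fst c])
        then show ?thesis using True by simp
      next
        case False
        have c: "(\<lambda>w. w (Inr (n - k))) \<in> measurable (PiM UNIV ?B) marks" by (rule measurable_component_singleton) simp
        have "(\<lambda>x. snd x (Inr (n - k))) \<in> measurable (PiM A ?B \<Otimes>\<^sub>M PiM UNIV ?B) marks"
          by (rule measurable_compose[OF measurable_snd c])
        then show ?thesis using False by simp
      qed
    qed (auto simp: space_PiM)
  qed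
  have "distr M paths (\<lambda>\<omega>. (Xs \<omega>, Us \<omega>)) = distr M paths (\<lambda>\<omega>. R (?VA \<omega>, ?S \<omega>))"
    by (intro distr_cong refl) (auto simp: R_def f_def A_def fun_eq_iff)
  also have "\<dots> = distr (distr M (PiM A ?B \<Otimes>\<^sub>M PiM UNIV ?B) (\<lambda>\<omega>. (?VA \<omega>, ?S \<omega>))) paths R"
    by (subst distr_distr[OF Rm]) (auto simp: comp_def)
  also have "\<dots> = distr (distr (M \<Otimes>\<^sub>M M) (PiM A ?B \<Otimes>\<^sub>M PiM UNIV ?B) (\<lambda>(\<omega>, \<omega>'). (?VA \<omega>, ?V \<omega>'))) paths R"
    unfolding J by (subst pair_measure_distr[OF VAm Vm sf]) simp
  also have "\<dots> = distr (M \<Otimes>\<^sub>M M) paths (\<lambda>(\<omega>, \<omega>'). R (?VA \<omega>, ?V \<omega>'))"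
    by (subst distr_distr[OF Rm]) (auto simp: comp_def case_prod_beta')
  also have "\<dots> = distr (M \<Otimes>\<^sub>M M) paths (\<lambda>(\<omega>, \<omega>'). (comb_seq j (Xs \<omega>) (Xs \<omega>'), comb_seq k (Us \<omega>) (Us \<omega>')))"
    by (intro distr_cong refl) (auto simp: R_def A_def fun_eq_iff comb_seq_def split_beta)
  finally show ?thesis by simp
qed

sublocale MM: pair_prob_space M M ..

text \<open>Fubini for \<open>distr_comb\<close>. Here \<open>j\<close> and \<open>k\<close> are
  deterministic; random crossing times come in through the indicator of \<open>reach\<close>, see
  \<open>markov_reach\<close>.\<close>

lemma markov:
  fixes G :: "(nat \<Rightarrow> real) \<times> (nat \<Rightarrow> nat \<Rightarrow> real) \<Rightarrow> real"
  assumes G [measurable]: "G \<in> borel_measurable paths" and int: "integrable M (\<lambda>\<omega>. G (Xs \<omega>, Us \<omega>))"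
  shows "(\<integral>\<omega>. G (Xs \<omega>, Us \<omega>) \<partial>M)
      = (\<integral>\<omega>. (\<integral>\<omega>'. G (comb_seq j (Xs \<omega>) (Xs \<omega>'), comb_seq k (Us \<omega>) (Us \<omega>')) \<partial>M) \<partial>M)"
    and "integrable M (\<lambda>\<omega>. \<integral>\<omega>'. G (comb_seq j (Xs \<omega>) (Xs \<omega>'), comb_seq k (Us \<omega>) (Us \<omega>')) \<partial>M)"
proof -
  let ?c = "\<lambda>(\<omega>, \<omega>'). (comb_seq j (Xs \<omega>) (Xs \<omega>'), comb_seq k (Us \<omega>) (Us \<omega>'))"
  have c: "?c \<in> measurable (M \<Otimes>\<^sub>M M) paths" unfolding split_beta by measurable
  have "integrable (distr M paths (\<lambda>\<omega>. (Xs \<omega>, Us \<omega>))) G" using int by (subst integrable_distr_eq) auto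
  then have "integrable (distr (M \<Otimes>\<^sub>M M) paths ?c) G" unfolding distr_comb .
  then have I: "integrable (M \<Otimes>\<^sub>M M) (\<lambda>p. G (?c p))" using c G by (subst (asm) integrable_distr_eq) auto
  have "(\<integral>\<omega>. G (Xs \<omega>, Us \<omega>) \<partial>M) = integral\<^sup>L (distr M paths (\<lambda>\<omega>. (Xs \<omega>, Us \<omega>))) G"
    by (subst integral_distr) auto
  also have "\<dots> = (\<integral>p. G (?c p) \<partial>(M \<Otimes>\<^sub>M M))"
    unfolding distr_comb[of j k, symmetric] by (rule integral_distr[OF c G])
  also have "\<dots> = (\<integral>\<omega>. (\<integral>\<omega>'. G (?c (\<omega>, \<omega>')) \<partial>M) \<partial>M)" by (rule MM.integral_fst'[OF I, symmetric])
  finally show "(\<integral>\<omega>. G (Xs \<omega>, Us \<omega>) \<partial>M)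
      = (\<integral>\<omega>. (\<integral>\<omega>'. G (comb_seq j (Xs \<omega>) (Xs \<omega>'), comb_seq k (Us \<omega>) (Us \<omega>')) \<partial>M) \<partial>M)" by simp
  show "integrable M (\<lambda>\<omega>. \<integral>\<omega>'. G (comb_seq j (Xs \<omega>) (Xs \<omega>'), comb_seq k (Us \<omega>) (Us \<omega>')) \<partial>M)"
    using MM.integrable_fst'[OF I] by simp
qed

subsection \<open>Estimates for one excursion\<close>

sublocale step: centered_step M "X 0"
  by unfold_locales (use X_int X_mean X_sq_int X_var \<sigma>_pos in auto)

text \<open>Excursions below zero are treated as excursions of the reflected walk.\<close>

sublocale step_neg: centered_step M "\<lambda>\<omega>. - X 0 \<omega>"
  by unfold_locales (use X_int X_mean X_sq_int X_var \<sigma>_pos in auto)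

lemma integrable_X: "integrable M (X n)"
proof -
  have "integrable (distr M borel (X n)) (\<lambda>x. x)"
    unfolding X_ident[of n] using X_int by (subst integrable_distr_eq) auto
  then show ?thesis by (subst (asm) integrable_distr_eq) auto
qed

lemma integrable_path_abs: "integrable M (\<lambda>\<omega>. \<bar>wpath y (Xs \<omega>) n\<bar>)"
  unfolding wpath_def by (intro integrable_abs Bochner_Integration.integrable_add Bochner_Integration.integrable_sum integrable_X) auto

lemma stopped_path_bound:
  assumes "\<And>z. \<bar>f z\<bar> \<le> a + b * \<bar>z\<bar>" "0 \<le> b"
  shows "\<bar>stopped_path D f n y \<xi>\<bar> \<le> a + b * (\<bar>y\<bar> + (\<Sum>i<n. \<bar>\<xi> i\<bar>))"
proof (induction n arbitrary: y \<xi>)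
  case 0 then show ?case using assms by simp
next
  case (Suc n)
  have sm: "(\<Sum>i<Suc n. \<bar>\<xi> i\<bar>) = \<bar>\<xi> 0\<bar> + (\<Sum>i<n. \<bar>\<xi> (Suc i)\<bar>)" by (rule sum.lessThan_Suc_shift)
  show ?case
  proof (cases "y \<in> D")
    case True
    have "\<bar>stopped_path D f n (y + \<xi> 0) (\<lambda>i. \<xi> (Suc i))\<bar> \<le> a + b * (\<bar>y + \<xi> 0\<bar> + (\<Sum>i<n. \<bar>\<xi> (Suc i)\<bar>))"
      by (rule Suc)
    also have "\<dots> \<le> a + b * (\<bar>y\<bar> + (\<Sum>i<Suc n. \<bar>\<xi> i\<bar>))"
      unfolding sm using assms(2) by (intro add_left_mono mult_left_mono) auto
    finally show ?thesis using True by simp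
  next
    case False
    have "b * \<bar>y\<bar> \<le> b * (\<bar>y\<bar> + (\<Sum>i<Suc n. \<bar>\<xi> i\<bar>))" using assms(2) by (intro mult_left_mono) (auto intro: sum_nonneg)
    then show ?thesis using False assms(1)[of y] by simp
  qed
qed

lemma stopped_path_integral:
  assumes f: "lin_growth f" and D [measurable]: "D \<in> sets borel"
  shows "integrable M (\<lambda>\<omega>. stopped_path D f n y (Xs \<omega>))"
    and "(\<integral>\<omega>. stopped_path D f n y (Xs \<omega>) \<partial>M) = stopped M (X 0) D f n y"
proof -
  note [measurable] = lin_growth_measurable[OF f]
  obtain a b where ab: "0 \<le> a" "0 \<le> b" "\<And>z. \<bar>f z\<bar> \<le> a + b * \<bar>z\<bar>" using f unfolding lin_growth_def by blast
  have m: "(\<lambda>\<xi>. stopped_path D f n y \<xi>) \<in> borel_measurable marks" for n y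
    using measurable_compose[OF _ measurable_stopped_path[OF lin_growth_measurable[OF f] D], of "\<lambda>\<xi>. (y, \<xi>)" marks n]
    by simp
  have I: "integrable M (\<lambda>\<omega>. stopped_path D f n y (Xs \<omega>))" for n y
  proof (rule Bochner_Integration.integrable_bound[of _ "\<lambda>\<omega>. a + b * (\<bar>y\<bar> + (\<Sum>i<n. \<bar>X i \<omega>\<bar>))"])
    show "integrable M (\<lambda>\<omega>. a + b * (\<bar>y\<bar> + (\<Sum>i<n. \<bar>X i \<omega>\<bar>)))"
      using integrable_X by auto
    show "(\<lambda>\<omega>. stopped_path D f n y (Xs \<omega>)) \<in> borel_measurable M"
      by (rule measurable_compose[OF Xs_measurable m])
    show "AE \<omega> in M. norm (stopped_path D f n y (Xs \<omega>)) \<le> norm (a + b * (\<bar>y\<bar> + (\<Sum>i<n. \<bar>X i \<omega>\<bar>)))"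
      using stopped_path_bound[OF ab(3,2), of D n y] by (auto intro!: AE_I2 intro: order_trans[OF _ abs_ge_self])
  qed
  show "integrable M (\<lambda>\<omega>. stopped_path D f n y (Xs \<omega>))" by (rule I)
  show "(\<integral>\<omega>. stopped_path D f n y (Xs \<omega>) \<partial>M) = stopped M (X 0) D f n y"
  proof (induction n arbitrary: y)
    case 0 show ?case by (simp add: prob_space)
  next
    case (Suc n)
    have "(\<integral>\<omega>. stopped_path D f (Suc n) y (Xs \<omega>) \<partial>M)
        = (\<integral>\<omega>. (\<integral>\<omega>'. stopped_path D f (Suc n) y (comb_seq (Suc 0) (Xs \<omega>) (Xs \<omega>')) \<partial>M) \<partial>M)"
      using markov(1)[OF measurable_compose[OF measurable_fst m[of "Suc n" y]], where j = "Suc 0" and k = 0] I[of "Suc n" y]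
      by (simp del: stopped_path.simps comb_seq_Suc_0)
    also have "\<dots> = (\<integral>\<omega>. (if y \<in> D then stopped M (X 0) D f n (y + X 0 \<omega>) else f y) \<partial>M)"
      by (intro Bochner_Integration.integral_cong refl) (auto simp: Suc prob_space)
    also have "\<dots> = stopped M (X 0) D f (Suc n) y" by (auto simp: prob_space)
    finally show ?case .
  qed
qed

end

subsection \<open>Measurability\<close>

context
  fixes K :: "nat \<Rightarrow> (nat \<Rightarrow> real) \<Rightarrow> real \<Rightarrow> bool"
  assumes K: "\<And>i. (\<lambda>(v, y). K i v y) \<in> measurable (marks \<Otimes>\<^sub>M borel) (count_space UNIV)"
begin

lemma pred_alive:
  assumes [measurable]: "\<And>m. (\<lambda>x. s x m) \<in> borel_measurable N" and v: "v \<in> measurable N marks"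
  shows "Measurable.pred N (\<lambda>x. alive K (s x) j (v x) n)"
proof -
  have [measurable]: "Measurable.pred N (\<lambda>x. K i (v x) (s x m))" for i m
    using measurable_compose[OF measurable_Pair[OF v assms(1)] K[of i]] by simp
  have "Measurable.pred N (\<lambda>x. (0 \<le> s x m \<longleftrightarrow> 0 \<le> s x j) \<and> \<not> K (m - j) (v x) (s x m))" for m
    by measurable
  then show ?thesis unfolding alive_def by (intro pred_intros_finite) auto
qed

lemma pred_alive_wpath:
  "Measurable.pred paths (\<lambda>p. alive K (wpath x (fst p)) j (snd p k) n)"
proof (rule pred_alive)
  show "(\<lambda>p. wpath x (fst p) m) \<in> borel_measurable paths" for m by measurable
  show "(\<lambda>p. snd p k) \<in> measurable paths marks"
    by (rule measurable_compose[OF measurable_snd measurable_component_singleton]) simp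
qed

lemma pred_reach: "Measurable.pred paths (\<lambda>p. reach K (wpath x (fst p)) (snd p) k j)"
proof (induction k arbitrary: j)
  case (Suc k)
  note [measurable] = Suc pred_alive_wpath
  have "Measurable.pred paths (\<lambda>p. reach K (wpath x (fst p)) (snd p) k i \<and>
      alive K (wpath x (fst p)) i (snd p k) (j - 1) \<and> \<not> (0 \<le> wpath x (fst p) j \<longleftrightarrow> 0 \<le> wpath x (fst p) i))" for i
    by (intro pred_intros_logic Suc pred_alive_wpath) measurable
  then have "Measurable.pred paths (\<lambda>p. \<exists>i\<in>{..<j}. reach K (wpath x (fst p)) (snd p) k i \<and>
      alive K (wpath x (fst p)) i (snd p k) (j - 1) \<and> \<not> (0 \<le> wpath x (fst p) j \<longleftrightarrow> 0 \<le> wpath x (fst p) i))"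
    by (intro pred_intros_finite) auto
  then show ?case by (simp add: Bex_def)
qed simp

lemma pred_less_absorb_time:
  "Measurable.pred paths (\<lambda>p. enat n < absorb_time (wpath x (fst p)) (snd p) K)"
proof -
  have "Measurable.pred paths (\<lambda>p. \<exists>k\<in>{..n}. \<exists>j\<in>{..n}. reach K (wpath x (fst p)) (snd p) k j \<and> alive K (wpath x (fst p)) j (snd p k) n)"
  proof (intro pred_intros_finite)
    fix k j
    note [measurable] = pred_reach pred_alive_wpath
    show "Measurable.pred paths (\<lambda>p. reach K (wpath x (fst p)) (snd p) k j \<and> alive K (wpath x (fst p)) j (snd p k) n)"
      by measurable
  qed auto
  moreover have "(\<lambda>p. enat n < absorb_time (wpath x (fst p)) (snd p) K) =
      (\<lambda>p. \<exists>k\<in>{..n}. \<exists>j\<in>{..n}. reach K (wpath x (fst p)) (snd p) k j \<and> alive K (wpath x (fst p)) j (snd p k) n)"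
    by (simp only: less_absorb_time_decomp Bex_def atMost_iff)
  ultimately show ?thesis by simp
qed

end

text \<open>If absorption never happens, \<open>reach\<close> describes the crossing time alone, so
  \<open>pred_reach\<close> applies.\<close>

lemma pred_zc_time_eq: "Measurable.pred paths (\<lambda>p. zc_time (wpath x (fst p)) k = enat j)"
proof -
  have "absorb_time s us (\<lambda>_ _ _. False) = \<infinity>" for s us by (simp add: absorb_time_def absorbed_at_def)
  then have eq: "zc_time s k = enat j \<longleftrightarrow> reach (\<lambda>_ _ _. False) s us k j" for s us by (simp add: reach_iff)
  have "(\<lambda>p :: (nat \<Rightarrow> real) \<times> (nat \<Rightarrow> nat \<Rightarrow> real). zc_time (wpath x (fst p)) k = enat j)
      = (\<lambda>p. reach (\<lambda>_ _ _. False) (wpath x (fst p)) (snd p) k j)"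
    by (rule ext, rule eq)
  then show ?thesis using pred_reach[of "\<lambda>_ _ _. False" x k j] by simp
qed

lemma pred_zc_time_le_absorb_time:
  assumes K: "\<And>i. (\<lambda>(v, y). K i v y) \<in> measurable (marks \<Otimes>\<^sub>M borel) (count_space UNIV)"
  shows "Measurable.pred paths (\<lambda>p. zc_time (wpath x (fst p)) k \<le> absorb_time (wpath x (fst p)) (snd p) K)"
proof -
  \<comment> \<open>The event of (C1) also contains paths with infinite crossing time, provided that
    they are never absorbed; \<open>reach\<close> does not see these.\<close>
  have eq: "zc_time s k \<le> absorb_time s us K \<longleftrightarrow>
      (\<exists>j. reach K s us k j) \<or> (\<forall>j. zc_time s k \<noteq> enat j) \<and> (\<forall>n. enat n < absorb_time s us K)" for s us
  proof (cases "zc_time s k")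
    case (enat j) then show ?thesis by (auto simp: reach_iff)
  next
    case infinity
    then have "\<not> reach K s us k j" for j by (simp add: reach_iff)
    then show ?thesis using infinity by (cases "absorb_time s us K") auto
  qed
  show ?thesis unfolding eq
    
  proof -
    note [measurable] = pred_reach[OF K] pred_zc_time_eq pred_less_absorb_time[OF K]
    show "Measurable.pred paths (\<lambda>p. (\<exists>j. reach K (wpath x (fst p)) (snd p) k j) \<or>
        (\<forall>j. zc_time (wpath x (fst p)) k \<noteq> enat j) \<and> (\<forall>n. enat n < absorb_time (wpath x (fst p)) (snd p) K))"
      by measurable
  qed
qed

lemma sum_reach:
  assumes "j \<le> n" "reach K s us k j"
  shows "(\<Sum>i\<le>n. of_bool (reach K s us k i) * f i) = (f j :: real)"
proof -
  have "reach K s us k i \<longleftrightarrow> i = j" for i using assms(2) reach_unique by blast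
  then show ?thesis using assms(1) by (simp add: sum.delta')
qed

section \<open>Central limit theorem and excursion bounds on both half-lines\<close>

context killed_walk
begin

lemma indep_X: "indep_vars (\<lambda>_. borel) X UNIV"
proof -
  have fm: "(\<lambda>w n. w (Inl n)) \<in> measurable (PiM UNIV (\<lambda>_::nat + nat. marks)) (PiM UNIV (\<lambda>_::nat. marks))"
    by (rule measurable_PiM_single') (auto simp: space_PiM)
  have Vm: "(\<lambda>\<omega> i. V i \<omega>) \<in> measurable M (PiM UNIV (\<lambda>_. marks))"
    by (rule measurable_PiM_single') (auto simp: space_PiM)
  have "distr M (PiM UNIV (\<lambda>_. marks)) (\<lambda>\<omega> n. V (Inl n) \<omega>)
      = distr (distr M (PiM UNIV (\<lambda>_. marks)) (\<lambda>\<omega> i. V i \<omega>)) (PiM UNIV (\<lambda>_. marks)) (\<lambda>w n. w (Inl n))"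
    by (subst distr_distr[OF fm Vm]) (simp add: comp_def)
  also have "\<dots> = distr (PiM UNIV (\<lambda>i. distr M marks (V i))) (PiM UNIV (\<lambda>n. distr M marks (V (Inl n)))) (\<lambda>w. \<lambda>n\<in>UNIV. w (Inl n))"
    unfolding distr_V by (intro distr_cong sets_PiM_cong) auto
  also have "\<dots> = PiM UNIV (\<lambda>n. distr M marks (V (Inl n)))"
    by (rule distr_PiM_reindex) (auto intro: prob_space_distr)
  finally have "indep_vars (\<lambda>_. marks) (\<lambda>n. V (Inl n)) (UNIV :: nat set)"
    by (subst indep_vars_iff_distr_eq_PiM) (auto simp: restrict_UNIV)
  then have "indep_vars (\<lambda>_. borel) (\<lambda>n \<omega>. (\<lambda>v. v 0) (V (Inl n) \<omega>)) (UNIV :: nat set)"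
    by (rule indep_vars_compose2) measurable
  then show ?thesis by simp
qed

text \<open>The density is positive on [-2, -1], a set of positive Lebesgue measure.\<close>

lemma std_normal_cdf_pos: "0 < cdf std_normal_distribution (-1)"
proof -
  interpret N: real_distribution std_normal_distribution by (rule real_dist_normal_dist)
  have "emeasure std_normal_distribution {..-1} \<noteq> 0"
  proof
    assume "emeasure std_normal_distribution {..-1} = 0"
    then have "(\<integral>\<^sup>+x. ennreal (std_normal_density x) * indicator {..-1} x \<partial>lborel) = 0"
      by (subst (asm) emeasure_density) auto
    then have "AE x in lborel. ennreal (std_normal_density x) * indicator {..-1::real} x = 0"
      by (subst (asm) nn_integral_0_iff_AE) auto
    then have "AE x in lborel. x \<notin> {-2..-1::real}"
    proof eventually_elim
      case (elim x)
      have "0 < std_normal_density x" by (rule normal_density_pos) simp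
      then show ?case using elim by (auto simp: indicator_def ennreal_eq_0_iff split: if_splits)
    qed
    then have "emeasure lborel {x\<in>space lborel. \<not> x \<notin> {-2..-1::real}} = 0"
      by (subst (asm) AE_iff_measurable[OF _ refl]) auto
    moreover have "{x\<in>space lborel. \<not> x \<notin> {-2..-1::real}} = {-2..-1}" by auto
    ultimately show False by simp
  qed
  then show ?thesis unfolding cdf_def using N.emeasure_eq_measure by (simp add: zero_less_measure_iff)
qed

text \<open>By the central limit theorem the sum is below \<open>- \<sigma> * sqrt n\<close> with
  probability tending to \<Phi>(-1) > 0, and on this event its negative part is at least
  \<open>\<sigma> * sqrt n\<close>.\<close>

lemma free_neg_lower:
  "\<exists>c>0. \<exists>N. \<forall>n\<ge>N. c * sqrt (real n) \<le> stopped M (X 0) UNIV (\<lambda>z. max 0 (- z)) n 0"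
proof -
  interpret N: real_distribution std_normal_distribution by (rule real_dist_normal_dist)
  let ?Z = "\<lambda>n \<omega>. (\<Sum>i<n. X i \<omega>) / sqrt (real n * \<sigma>\<^sup>2)"
  have Ef: "(\<integral>\<omega>. f (X n \<omega>) \<partial>M) = (\<integral>\<omega>. f (X 0 \<omega>) \<partial>M)"
    and If: "integrable M (\<lambda>\<omega>. f (X 0 \<omega>)) \<Longrightarrow> integrable M (\<lambda>\<omega>. f (X n \<omega>))"
    if [measurable]: "f \<in> borel_measurable borel" for f :: "real \<Rightarrow> real" and n
  proof -
    show "(\<integral>\<omega>. f (X n \<omega>) \<partial>M) = (\<integral>\<omega>. f (X 0 \<omega>) \<partial>M)"
      using integral_distr[of "X n" M borel f] integral_distr[of "X 0" M borel f] X_ident[of n] by simp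
    show "integrable M (\<lambda>\<omega>. f (X 0 \<omega>)) \<Longrightarrow> integrable M (\<lambda>\<omega>. f (X n \<omega>))"
      using integrable_distr_eq[of "X n" M borel f] integrable_distr_eq[of "X 0" M borel f] X_ident[of n] by simp
  qed
  have mean: "expectation (X n) = 0" for n using Ef[of "\<lambda>x. x" n] X_mean by simp
  have var: "variance (X n) = \<sigma>\<^sup>2" for n using Ef[of "\<lambda>x. x\<^sup>2" n] X_var mean by simp
  have "weak_conv_m (\<lambda>n. distr M borel (?Z n)) std_normal_distribution"
    by (rule central_limit_theorem_zero_mean[OF indep_X mean \<sigma>_pos _ var X_ident])
       (use If[of "\<lambda>x. x\<^sup>2"] X_sq_int in auto)
  moreover have "isCont (cdf std_normal_distribution) (-1)"
  proof -
    have "emeasure std_normal_distribution {-1} = 0"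
      by (subst emeasure_density) (auto intro!: nn_integral_zero' AE_I[of _ _ "{-1}"] simp: indicator_def)
    then show ?thesis by (simp add: N.isCont_cdf measure_def)
  qed
  ultimately have lim: "(\<lambda>n. cdf (distr M borel (?Z n)) (-1)) \<longlonglongrightarrow> cdf std_normal_distribution (-1)"
    unfolding weak_conv_m_def weak_conv_def by blast
  define c where "c = cdf std_normal_distribution (-1) / 2"
  have c: "0 < c" using std_normal_cdf_pos by (simp add: c_def)
  have "\<forall>\<^sub>F n in sequentially. c < cdf (distr M borel (?Z n)) (-1)"
    using lim c by (intro order_tendstoD) (auto simp: c_def)
  then obtain N0 where N0: "\<And>n. N0 \<le> n \<Longrightarrow> c < cdf (distr M borel (?Z n)) (-1)" by (auto simp: eventually_sequentially)
  show ?thesis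
  proof (intro exI[of _ "c * \<sigma>"] conjI exI[of _ "max 1 N0"] allI impI)
    show "0 < c * \<sigma>" using c \<sigma>_pos by simp
    fix n assume n: "max 1 N0 \<le> n"
    define r where "r = sqrt (real n * \<sigma>\<^sup>2)"
    have r: "0 < r" unfolding r_def using n \<sigma>_pos by simp
    have r': "r = sqrt (real n) * \<sigma>" unfolding r_def using \<sigma>_pos by (simp add: real_sqrt_mult)
    have "c * \<sigma> * sqrt (real n) = r * c" using r' by simp
    also have "\<dots> \<le> r * cdf (distr M borel (?Z n)) (-1)" using N0[of n] n r by (intro mult_left_mono) auto
    also have "cdf (distr M borel (?Z n)) (-1) = prob {\<omega>\<in>space M. ?Z n \<omega> \<le> -1}"
      unfolding cdf_def by (subst measure_distr) (auto simp: vimage_def Int_def conj_commute)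
    also have "r * \<dots> = (\<integral>\<omega>. r * indicator {\<omega>\<in>space M. ?Z n \<omega> \<le> -1} \<omega> \<partial>M)" by simp
    also have "\<dots> \<le> (\<integral>\<omega>. stopped_path UNIV (\<lambda>z. max 0 (- z)) n 0 (Xs \<omega>) \<partial>M)"
    proof (rule integral_mono_AE)
      show "integrable M (\<lambda>\<omega>. r * indicator {\<omega>\<in>space M. ?Z n \<omega> \<le> -1} \<omega>)"
        by (intro integrable_mult_right integrable_real_indicator) (auto simp: less_top[symmetric])
      show "integrable M (\<lambda>\<omega>. stopped_path UNIV (\<lambda>z. max 0 (- z)) n 0 (Xs \<omega>))"
        by (rule stopped_path_integral(1)[OF lin_growth_neg]) simp
      show "AE \<omega> in M. r * indicator {\<omega>\<in>space M. ?Z n \<omega> \<le> -1} \<omega> \<le> stopped_path UNIV (\<lambda>z. max 0 (- z)) n 0 (Xs \<omega>)"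
      proof (rule AE_I2)
        fix \<omega>
        show "r * indicator {\<omega>\<in>space M. ?Z n \<omega> \<le> -1} \<omega> \<le> stopped_path UNIV (\<lambda>z. max 0 (- z)) n 0 (Xs \<omega>)"
          unfolding stopped_path_UNIV wpath_def r_def[symmetric] using r
          by (auto simp: indicator_def pos_divide_le_eq)
      qed
    qed
    also have "\<dots> = stopped M (X 0) UNIV (\<lambda>z. max 0 (- z)) n 0"
      by (rule stopped_path_integral(2)[OF lin_growth_neg]) simp
    finally show "c * \<sigma> * sqrt (real n) \<le> stopped M (X 0) UNIV (\<lambda>z. max 0 (- z)) n 0" .
  qed
qed

definition side :: "real \<Rightarrow> real set" where
  "side y = (if 0 \<le> y then {0..} else {..<0})"

text \<open>Zero inside the half-line, so that \<open>stopped\<close> counts |S_T| only on paths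
  that have left by time \<open>n\<close>.\<close>

definition exit_abs :: "real \<Rightarrow> real \<Rightarrow> real" where
  "exit_abs y z = (if z \<in> side y then 0 else \<bar>z\<bar>)"

lemma side_measurable [measurable]: "side y \<in> sets borel"
  by (simp add: side_def)

lemma uminus_image_halfline: "uminus ` {0<..} = {..<(0::real)}"
  by (auto simp: image_iff intro!: bexI[of _ "- x" for x])

lemma lin_growth_exit_abs: "lin_growth (exit_abs y)"
  by (rule lin_growthI[of _ 0 1]) (auto simp: exit_abs_def[abs_def])

text \<open>For \<open>y \<ge> 0\<close> the exit value is the negative part; for
  \<open>y < 0\<close> the walk is reflected and the half-line becomes (0, \<infinity>).\<close>

lemma exit_abs_stopped_bound:
  assumes "0 < e"
  shows "\<exists>C\<ge>0. \<forall>n y. stopped M (X 0) (side y) (exit_abs y) n y \<le> e * \<bar>y\<bar> + C"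
proof -
  obtain C1 where C1: "0 \<le> C1" "\<And>D n y. D \<in> sets borel \<Longrightarrow> D \<subseteq> {0..} \<Longrightarrow> 0 \<le> y \<Longrightarrow>
           stopped M (X 0) D (\<lambda>z. max 0 (- z)) n y \<le> e * y + C1"
    using step.overshoot_bound[OF assms] by auto
  obtain C2 where C2: "0 \<le> C2" "\<And>D n y. D \<in> sets borel \<Longrightarrow> D \<subseteq> {0..} \<Longrightarrow> 0 \<le> y \<Longrightarrow>
           stopped M (\<lambda>\<omega>. - X 0 \<omega>) D (\<lambda>z. max 0 (- z)) n y \<le> e * y + C2"
    using step_neg.overshoot_bound[OF assms] by auto
  have "stopped M (X 0) (side y) (exit_abs y) n y \<le> e * \<bar>y\<bar> + (C1 + C2)" for n y
  proof (cases "0 \<le> y")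
    case True
    have "exit_abs y = (\<lambda>z. max 0 (- z))" using True by (auto simp: exit_abs_def side_def fun_eq_iff)
    then show ?thesis using C1(2)[of "{0..}" y n] C2(1) True by (simp add: side_def)
  next
    case False
    have "exit_abs y = (\<lambda>z. max 0 (- (- z)))" using False by (auto simp: exit_abs_def side_def fun_eq_iff)
    then have "stopped M (X 0) (side y) (exit_abs y) n y = stopped M (\<lambda>\<omega>. - X 0 \<omega>) {0<..} (\<lambda>z. max 0 (- z)) n (- y)"
      unfolding stopped_reflect uminus_image_halfline using False by (simp add: side_def)
    also have "\<dots> \<le> e * (- y) + C2" using False by (intro C2(2)) auto
    finally show ?thesis using C1(1) False by simp
  qed
  then show ?thesis using C1(1) C2(1) by (intro exI[of _ "C1 + C2"]) auto
qed

lemma stay_prob_bound: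
  "\<exists>C\<ge>0. \<forall>n y. sqrt (real n) * stopped M (X 0) (side y) (indicator (side y)) n y \<le> C * (1 + \<bar>y\<bar>)"
proof -
  obtain c N where c: "0 < c" "\<And>n. N \<le> n \<Longrightarrow> c * sqrt (real n) \<le> stopped M (X 0) UNIV (\<lambda>z. max 0 (- z)) n 0"
    using free_neg_lower by blast
  \<comment> \<open>The positive and the negative part of a centred sum have the same mean, so one
    constant \<open>c\<close> serves the walk and its reflection.\<close>
  have pos: "stopped M (X 0) UNIV (\<lambda>z. max 0 z) n 0 = stopped M (X 0) UNIV (\<lambda>z. max 0 (- z)) n 0" for n
  proof -
    have "stopped M (X 0) UNIV (\<lambda>z. max 0 z) n 0 = stopped M (X 0) UNIV (\<lambda>z. z + max 0 (- z)) n 0"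
      by (intro arg_cong[where f = "\<lambda>f. stopped M (X 0) UNIV f n 0"]) auto
    then show ?thesis by (simp add: step.stopped_add[OF lin_growth_id lin_growth_neg] step.stopped_id)
  qed
  have pos': "stopped M (\<lambda>\<omega>. - X 0 \<omega>) UNIV (\<lambda>z. max 0 z) n 0 = stopped M (X 0) UNIV (\<lambda>z. max 0 (- z)) n 0" for n
    unfolding stopped_reflect by (simp add: surj_uminus)
  obtain C1 where C1: "0 \<le> C1" "\<And>D n y. D \<in> sets borel \<Longrightarrow> {0<..} \<subseteq> D \<Longrightarrow> D \<subseteq> {0..} \<Longrightarrow> 0 \<le> y \<Longrightarrow>
           sqrt (real n) * stopped M (X 0) D (indicator D) n y \<le> C1 * (1 + y)"
    using step.stay_bound[OF c(1), of N] c(2) unfolding pos by blast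
  obtain C2 where C2: "0 \<le> C2" "\<And>D n y. D \<in> sets borel \<Longrightarrow> {0<..} \<subseteq> D \<Longrightarrow> D \<subseteq> {0..} \<Longrightarrow> 0 \<le> y \<Longrightarrow>
           sqrt (real n) * stopped M (\<lambda>\<omega>. - X 0 \<omega>) D (indicator D) n y \<le> C2 * (1 + y)"
    using step_neg.stay_bound[OF c(1), of N] c(2) unfolding pos' by blast
  have "sqrt (real n) * stopped M (X 0) (side y) (indicator (side y)) n y \<le> (C1 + C2) * (1 + \<bar>y\<bar>)" for n y
  proof (cases "0 \<le> y")
    case True
    have "sqrt (real n) * stopped M (X 0) (side y) (indicator (side y)) n y \<le> C1 * (1 + \<bar>y\<bar>)"
      using C1(2)[of "{0..}" y n] True by (simp add: side_def subset_eq)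
    also have "\<dots> \<le> (C1 + C2) * (1 + \<bar>y\<bar>)" using C2(1) by (intro mult_right_mono) auto
    finally show ?thesis .
  next
    case False
    have ind: "(\<lambda>z. indicator {0<..} (- z)) = (indicator {..<0} :: real \<Rightarrow> real)" by (auto simp: indicator_def fun_eq_iff)
    have "stopped M (\<lambda>\<omega>. - X 0 \<omega>) {0<..} (indicator {0<..}) n (- y) = stopped M (X 0) (side y) (indicator (side y)) n y"
      unfolding stopped_reflect uminus_image_halfline ind using False by (simp add: side_def)
    then have "sqrt (real n) * stopped M (X 0) (side y) (indicator (side y)) n y \<le> C2 * (1 + \<bar>y\<bar>)"
      using C2(2)[of "{0<..}" "- y" n] False by (simp add: subset_eq)
    also have "\<dots> \<le> (C1 + C2) * (1 + \<bar>y\<bar>)" using C1(1) by (intro mult_right_mono) auto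
    finally show ?thesis .
  qed
  then show ?thesis using C1(1) C2(1) by (intro exI[of _ "C1 + C2"]) auto
qed

subsection \<open>The Markov property at a crossing\<close>

abbreviation R :: "real \<Rightarrow> nat \<Rightarrow> nat \<Rightarrow> 'a \<Rightarrow> bool" where
  "R x k j \<omega> \<equiv> reach K (wpath x (Xs \<omega>)) (Us \<omega>) k j"

abbreviation S :: "real \<Rightarrow> 'a \<Rightarrow> nat \<Rightarrow> real" where
  "S x \<omega> n \<equiv> wpath x (Xs \<omega>) n"

lemma pred_R [measurable]: "Measurable.pred M (R x k j)"
  using measurable_compose[OF measurable_Pair[OF Xs_measurable Us_measurable] pred_reach[OF K_meas]] by simp

text \<open>By \<open>reach_cong\<close> the indicator is determined by the first sample and can be
  taken out of the inner integral.\<close>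

lemma markov_reach:
  fixes H :: "(nat \<Rightarrow> real) \<times> (nat \<Rightarrow> nat \<Rightarrow> real) \<Rightarrow> real"
  assumes H: "H \<in> borel_measurable paths" and int: "integrable M (\<lambda>\<omega>. of_bool (R x k j \<omega>) * H (Xs \<omega>, Us \<omega>))"
  shows "(\<integral>\<omega>. of_bool (R x k j \<omega>) * H (Xs \<omega>, Us \<omega>) \<partial>M)
      = (\<integral>\<omega>. of_bool (R x k j \<omega>) * (\<integral>\<omega>'. H (comb_seq j (Xs \<omega>) (Xs \<omega>'), comb_seq k (Us \<omega>) (Us \<omega>')) \<partial>M) \<partial>M)"
    and "integrable M (\<lambda>\<omega>. of_bool (R x k j \<omega>) * (\<integral>\<omega>'. H (comb_seq j (Xs \<omega>) (Xs \<omega>'), comb_seq k (Us \<omega>) (Us \<omega>')) \<partial>M))"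
proof -
  let ?G = "\<lambda>p. of_bool (reach K (wpath x (fst p)) (snd p) k j) * H p :: real"
  note [measurable] = pred_reach[OF K_meas] H
  have Gm: "?G \<in> borel_measurable paths" by measurable
  have cong: "reach K (wpath x (comb_seq j \<xi> \<xi>')) (comb_seq k \<upsilon> \<upsilon>') k j \<longleftrightarrow> reach K (wpath x \<xi>) \<upsilon> k j" for \<xi> \<xi>' \<upsilon> \<upsilon>'
    by (rule reach_cong) (auto simp: wpath_comb_le comb_seq_def)
  have int': "integrable M (\<lambda>\<omega>. ?G (Xs \<omega>, Us \<omega>))" using int by simp
  show "(\<integral>\<omega>. of_bool (R x k j \<omega>) * H (Xs \<omega>, Us \<omega>) \<partial>M)
      = (\<integral>\<omega>. of_bool (R x k j \<omega>) * (\<integral>\<omega>'. H (comb_seq j (Xs \<omega>) (Xs \<omega>'), comb_seq k (Us \<omega>) (Us \<omega>')) \<partial>M) \<partial>M)"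
    using markov(1)[OF Gm int', of j k] by (simp add: cong)
  show "integrable M (\<lambda>\<omega>. of_bool (R x k j \<omega>) * (\<integral>\<omega>'. H (comb_seq j (Xs \<omega>) (Xs \<omega>'), comb_seq k (Us \<omega>) (Us \<omega>')) \<partial>M))"
    using markov(2)[OF Gm int', of j k] by (simp add: cong)
qed

subsection \<open>Moments of the walk at the crossing times\<close>

lemma integrable_reach_abs: "integrable M (\<lambda>\<omega>. of_bool (R x k j \<omega>) * \<bar>S x \<omega> j\<bar>)"
  by (rule Bochner_Integration.integrable_bound[OF integrable_path_abs[of x j]]) auto

lemma integrable_reach: "integrable M (\<lambda>\<omega>. of_bool (R x k j \<omega>) :: real)"
  by (rule integrable_const_bound[of _ 1]) auto

text \<open>The (k+1)-st crossing is the exit of the excursion begun at the k-th. Only an inequality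
  holds because the right side ignores absorption during that excursion.\<close>

lemma exit_path_ge:
  "(\<Sum>j\<le>n. of_bool (R x (Suc k) j \<omega>) * \<bar>S x \<omega> j\<bar>)
     \<le> (\<Sum>i\<le>n. of_bool (R x k i \<omega>) * stopped_path (side (S x \<omega> i)) (exit_abs (S x \<omega> i)) (n - i) (S x \<omega> i) (\<lambda>m. X (i + m) \<omega>))"
    (is "?L \<le> ?R")
proof (cases "\<exists>j\<le>n. R x (Suc k) j \<omega>")
  case False
  have "0 \<le> stopped_path D (exit_abs z) m y \<xi>" for D z m y \<xi>
    by (induction m arbitrary: y \<xi>) (auto simp: exit_abs_def)
  then have "0 \<le> ?R" by (intro sum_nonneg) auto
  moreover have "?L = 0" using False by (intro sum.neutral) auto
  ultimately show ?thesis by simp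
next
  case True
  then obtain j where j: "j \<le> n" "R x (Suc k) j \<omega>" by blast
  then obtain i where i: "i < j" "R x k i \<omega>" "alive K (wpath x (Xs \<omega>)) i (U k \<omega>) (j - 1)"
      "\<not> (0 \<le> S x \<omega> j \<longleftrightarrow> 0 \<le> S x \<omega> i)" by auto
  have nn: "0 \<le> stopped_path D (exit_abs z) m y \<xi>" for D z m y \<xi>
    by (induction m arbitrary: y \<xi>) (auto simp: exit_abs_def)
  have side: "S x \<omega> m \<in> side (S x \<omega> i) \<longleftrightarrow> (0 \<le> S x \<omega> m \<longleftrightarrow> 0 \<le> S x \<omega> i)" for m by (auto simp: side_def)
  have "?L = \<bar>S x \<omega> j\<bar>" using j by (rule sum_reach)
  also have "\<dots> = stopped_path (side (S x \<omega> i)) (exit_abs (S x \<omega> i)) (n - i) (S x \<omega> i) (\<lambda>m. X (i + m) \<omega>)"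
  proof -
    have p: "wpath (S x \<omega> i) (\<lambda>m. X (i + m) \<omega>) d = S x \<omega> (i + d)" for d by (rule wpath_add[symmetric])
    have "stopped_path (side (S x \<omega> i)) (exit_abs (S x \<omega> i)) (n - i) (S x \<omega> i) (\<lambda>m. X (i + m) \<omega>)
        = exit_abs (S x \<omega> i) (wpath (S x \<omega> i) (\<lambda>m. X (i + m) \<omega>) (j - i))"
    proof (rule stopped_path_exit)
      show "wpath (S x \<omega> i) (\<lambda>m. X (i + m) \<omega>) (j - i) \<notin> side (S x \<omega> i)"
        unfolding p side using i by simp
      show "wpath (S x \<omega> i) (\<lambda>m. X (i + m) \<omega>) e \<in> side (S x \<omega> i)" if "e < j - i" for e
      proof -
        have "i + e \<in> {i..j - 1}" using that by auto
        then show ?thesis unfolding p side using i(3) unfolding alive_def by blast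
      qed
    qed (use j in auto)
    also have "\<dots> = \<bar>S x \<omega> j\<bar>" unfolding p using i by (auto simp: exit_abs_def side)
    finally show ?thesis by simp
  qed
  also have "\<dots> \<le> ?R"
    using member_le_sum[of i "{..n}" "\<lambda>i. of_bool (R x k i \<omega>) * stopped_path (side (S x \<omega> i)) (exit_abs (S x \<omega> i)) (n - i) (S x \<omega> i) (\<lambda>m. X (i + m) \<omega>)"]
      i j nn by auto
  finally show ?thesis .
qed

lemma integral_exit_path:
  fixes x :: real and k i n :: nat
  defines "E \<equiv> \<lambda>\<omega>. of_bool (R x k i \<omega>) * stopped_path (side (S x \<omega> i)) (exit_abs (S x \<omega> i)) n (S x \<omega> i) (\<lambda>m. X (i + m) \<omega>)"
  shows "integrable M E"
    and "(\<integral>\<omega>. E \<omega> \<partial>M) = (\<integral>\<omega>. of_bool (R x k i \<omega>) * stopped M (X 0) (side (S x \<omega> i)) (exit_abs (S x \<omega> i)) n (S x \<omega> i) \<partial>M)"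
    and "integrable M (\<lambda>\<omega>. of_bool (R x k i \<omega>) * stopped M (X 0) (side (S x \<omega> i)) (exit_abs (S x \<omega> i)) n (S x \<omega> i))"
proof -
  let ?H = "\<lambda>p. stopped_path (side (wpath x (fst p) i)) (exit_abs (wpath x (fst p) i)) n (wpath x (fst p) i) (\<lambda>m. fst p (i + m))"
  have sh: "(\<lambda>p. (wpath x (fst p) i, \<lambda>m. fst p (i + m))) \<in> measurable paths (borel \<Otimes>\<^sub>M marks)"
    by (intro measurable_Pair measurable_PiM_single') (auto simp: space_PiM)
  have m1: "(\<lambda>p. stopped_path (side y) (exit_abs y) n (wpath x (fst p) i) (\<lambda>m. fst p (i + m))) \<in> borel_measurable paths" for y
    using measurable_compose[OF sh measurable_stopped_path[OF lin_growth_measurable[OF lin_growth_exit_abs[of y]] side_measurable[of y], of n]]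
    by simp
  \<comment> \<open>The half-line depends on the starting point through its sign only, so two fixed
    sets suffice for measurability.\<close>
  have eq: "?H = (\<lambda>p. if 0 \<le> wpath x (fst p) i
      then stopped_path (side 0) (exit_abs 0) n (wpath x (fst p) i) (\<lambda>m. fst p (i + m))
      else stopped_path (side (-1)) (exit_abs (-1)) n (wpath x (fst p) i) (\<lambda>m. fst p (i + m)))"
    by (auto simp: fun_eq_iff side_def exit_abs_def[abs_def])
  have Hm: "?H \<in> borel_measurable paths" unfolding eq using m1 by measurable
  have E_eq: "E = (\<lambda>\<omega>. of_bool (R x k i \<omega>) * ?H (Xs \<omega>, Us \<omega>))" unfolding E_def by simp
  have bnd: "\<bar>?H (Xs \<omega>, Us \<omega>)\<bar> \<le> \<bar>S x \<omega> i\<bar> + (\<Sum>m<n. \<bar>X (i + m) \<omega>\<bar>)" for \<omega>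
    using stopped_path_bound[of "exit_abs (S x \<omega> i)" 0 1 "side (S x \<omega> i)" n "S x \<omega> i" "\<lambda>m. X (i + m) \<omega>"]
    by (auto simp: exit_abs_def)
  have Em: "E \<in> borel_measurable M"
    unfolding E_eq using measurable_compose[OF measurable_Pair[OF Xs_measurable Us_measurable] Hm] by measurable
  show int: "integrable M E"
  proof (rule Bochner_Integration.integrable_bound[of _ "\<lambda>\<omega>. \<bar>S x \<omega> i\<bar> + (\<Sum>m<n. \<bar>X (i + m) \<omega>\<bar>)"])
    show "integrable M (\<lambda>\<omega>. \<bar>S x \<omega> i\<bar> + (\<Sum>m<n. \<bar>X (i + m) \<omega>\<bar>))"
      by (intro Bochner_Integration.integrable_add Bochner_Integration.integrable_sum integrable_abs integrable_X integrable_path_abs)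
    show "AE \<omega> in M. norm (E \<omega>) \<le> norm (\<bar>S x \<omega> i\<bar> + (\<Sum>m<n. \<bar>X (i + m) \<omega>\<bar>))"
    proof (rule AE_I2)
      fix \<omega>
      have "\<bar>E \<omega>\<bar> \<le> \<bar>?H (Xs \<omega>, Us \<omega>)\<bar>" unfolding E_eq by (auto simp: of_bool_def)
      also have "\<dots> \<le> \<bar>S x \<omega> i\<bar> + (\<Sum>m<n. \<bar>X (i + m) \<omega>\<bar>)" by (rule bnd)
      finally show "norm (E \<omega>) \<le> norm (\<bar>S x \<omega> i\<bar> + (\<Sum>m<n. \<bar>X (i + m) \<omega>\<bar>))"
        by (simp add: order_trans[OF _ abs_ge_self])
    qed
  qed (rule Em)
  have inner: "(\<integral>\<omega>'. ?H (comb_seq i (Xs \<omega>) (Xs \<omega>'), comb_seq k (Us \<omega>) (Us \<omega>')) \<partial>M)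
      = stopped M (X 0) (side (S x \<omega> i)) (exit_abs (S x \<omega> i)) n (S x \<omega> i)" for \<omega>
  proof -
    have "?H (comb_seq i (Xs \<omega>) (Xs \<omega>'), comb_seq k (Us \<omega>) (Us \<omega>'))
        = stopped_path (side (S x \<omega> i)) (exit_abs (S x \<omega> i)) n (S x \<omega> i) (Xs \<omega>')" for \<omega>'
      by (simp add: wpath_comb_le comb_seq_def)
    then show ?thesis by (simp only: stopped_path_integral(2)[OF lin_growth_exit_abs side_measurable])
  qed
  show "(\<integral>\<omega>. E \<omega> \<partial>M) = (\<integral>\<omega>. of_bool (R x k i \<omega>) * stopped M (X 0) (side (S x \<omega> i)) (exit_abs (S x \<omega> i)) n (S x \<omega> i) \<partial>M)"
    unfolding E_eq using markov_reach(1)[OF Hm int[unfolded E_eq]] unfolding inner .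
  show "integrable M (\<lambda>\<omega>. of_bool (R x k i \<omega>) * stopped M (X 0) (side (S x \<omega> i)) (exit_abs (S x \<omega> i)) n (S x \<omega> i))"
    using markov_reach(2)[OF Hm int[unfolded E_eq]] unfolding inner .
qed

text \<open>For different \<open>j\<close> the events are disjoint, and each is contained in the
  event of (C1).\<close>

lemma sum_prob_reach_le:
  "(\<Sum>j\<le>n. \<integral>\<omega>. of_bool (R x k j \<omega>) \<partial>M)
     \<le> prob {\<omega>\<in>space M. zc_time (wpath x (Xs \<omega>)) k \<le> absorb_time (wpath x (Xs \<omega>)) (Us \<omega>) K}"
proof -
  have m: "{\<omega>\<in>space M. \<exists>j\<le>n. R x k j \<omega>} \<in> events" by measurable
  have zm: "{\<omega>\<in>space M. zc_time (wpath x (Xs \<omega>)) k \<le> absorb_time (wpath x (Xs \<omega>)) (Us \<omega>) K} \<in> events"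
    using measurable_compose[OF measurable_Pair[OF Xs_measurable Us_measurable] pred_zc_time_le_absorb_time[OF K_meas]] by simp
  have "(\<Sum>j\<le>n. \<integral>\<omega>. of_bool (R x k j \<omega>) \<partial>M) = (\<integral>\<omega>. (\<Sum>j\<le>n. of_bool (R x k j \<omega>) :: real) \<partial>M)"
    by (rule Bochner_Integration.integral_sum[symmetric]) (simp add: integrable_reach)
  also have "\<dots> = (\<integral>\<omega>. indicator {\<omega>\<in>space M. \<exists>j\<le>n. R x k j \<omega>} \<omega> \<partial>M)"
  proof (rule Bochner_Integration.integral_cong[OF refl])
    fix \<omega> assume sp: "\<omega> \<in> space M"
    show "(\<Sum>j\<le>n. of_bool (R x k j \<omega>)) = (indicator {\<omega>\<in>space M. \<exists>j\<le>n. R x k j \<omega>} \<omega> :: real)"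
    proof (cases "\<exists>j\<le>n. R x k j \<omega>")
      case True
      then obtain j where j: "j \<le> n" "R x k j \<omega>" by blast
      have "(\<Sum>j\<le>n. of_bool (R x k j \<omega>)) = (1 :: real)" using sum_reach[OF j, of "\<lambda>_. 1"] by simp
      then show ?thesis using j sp by (auto simp: indicator_def)
    next
      case False then show ?thesis by (auto simp: indicator_def)
    qed
  qed
  also have "\<dots> = prob {\<omega>\<in>space M. \<exists>j\<le>n. R x k j \<omega>}" using m by simp
  also have "\<dots> \<le> prob {\<omega>\<in>space M. zc_time (wpath x (Xs \<omega>)) k \<le> absorb_time (wpath x (Xs \<omega>)) (Us \<omega>) K}"
    using zm by (intro finite_measure_mono) (auto simp: reach_iff)
  finally show ?thesis .
qed

end

section \<open>Monotone sequences and their averages\<close>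

lemma sum_sqrt_diff: "(\<Sum>m<N. 2 * (sqrt (real m + 1) - sqrt (real m))) = 2 * sqrt (real N)"
  by (induction N) (auto simp: algebra_simps)

text \<open>A Cesaro argument: \<open>a\<close> is compared with \<open>u * w\<close>, where
  \<open>w m\<close> is asymptotic to \<open>1 / sqrt m\<close> and telescopes to exactly
  \<open>2 * sqrt N\<close>.\<close>

lemma sum_div_sqrt_tendsto:
  fixes a :: "nat \<Rightarrow> real"
  assumes "(\<lambda>m. sqrt (real m) * a m) \<longlonglongrightarrow> u"
  shows "(\<lambda>N. (\<Sum>m<N. a m) / sqrt (real N)) \<longlonglongrightarrow> 2 * u"
proof -
  define w where "w m = 2 * (sqrt (real m + 1) - sqrt (real m))" for m :: nat
  define d where "d m = a m - u * w m" for m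
  have w1: "(\<lambda>m. sqrt (real m) * w m) \<longlonglongrightarrow> 1" unfolding w_def by real_asymp
  have sw: "(\<Sum>m<N. w m) = 2 * sqrt (real N)" for N unfolding w_def by (rule sum_sqrt_diff)
  have wpos: "0 < w m" for m unfolding w_def by simp
  have "(\<lambda>m. sqrt (real m) * a m - u * (sqrt (real m) * w m)) \<longlonglongrightarrow> u - u * 1"
    by (intro tendsto_intros assms w1)
  then have d0: "(\<lambda>m. sqrt (real m) * d m) \<longlonglongrightarrow> 0" by (simp add: d_def algebra_simps)
  have "(\<lambda>N. (\<Sum>m<N. d m) / sqrt (real N)) \<longlonglongrightarrow> 0"
  proof (rule LIMSEQ_I)
    fix e :: real assume e: "0 < e"
    have "\<forall>\<^sub>F m in sequentially. \<bar>sqrt (real m) * d m\<bar> < e / 8"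
      using tendstoD[OF d0, of "e / 8"] e by (simp add: dist_real_def)
    moreover have "\<forall>\<^sub>F m in sequentially. 1 / 2 < sqrt (real m) * w m"
      using w1 by (rule order_tendstoD) simp
    ultimately have "\<forall>\<^sub>F m in sequentially. \<bar>d m\<bar> \<le> e / 4 * w m"
      using eventually_gt_at_top[of 0]
    proof eventually_elim
      case (elim m)
      have "sqrt (real m) * \<bar>d m\<bar> < e / 8" using elim(1) by (simp add: abs_mult)
      also have "\<dots> \<le> e / 4 * (sqrt (real m) * w m)" using mult_left_mono[OF less_imp_le[OF elim(2)], of "e / 4"] e by simp
      finally have "sqrt (real m) * \<bar>d m\<bar> \<le> sqrt (real m) * (e / 4 * w m)" by (simp add: algebra_simps)
      then show ?case using elim(3) by simp
    qed
    then obtain m0 where m0: "\<And>m. m0 \<le> m \<Longrightarrow> \<bar>d m\<bar> \<le> e / 4 * w m" by (auto simp: eventually_sequentially)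
    \<comment> \<open>The finitely many terms without a good estimate contribute a constant, which
      the division by \<open>sqrt N\<close> removes.\<close>
    define D where "D = (\<Sum>m<m0. \<bar>d m\<bar>)"
    have bnd: "\<bar>\<Sum>m<N. d m\<bar> \<le> D + e / 2 * sqrt (real N)" for N
    proof -
      have "\<bar>d m\<bar> \<le> (if m < m0 then \<bar>d m\<bar> else 0) + e / 4 * w m" for m
        using m0[of m] wpos[of m] e by (cases "m < m0") auto
      then have "\<bar>\<Sum>m<N. d m\<bar> \<le> (\<Sum>m<N. (if m < m0 then \<bar>d m\<bar> else 0) + e / 4 * w m)"
        by (intro order_trans[OF sum_abs] sum_mono)
      also have "\<dots> = (\<Sum>m<N. if m < m0 then \<bar>d m\<bar> else 0) + e / 4 * (2 * sqrt (real N))"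
        unfolding sum.distrib sum_distrib_left[symmetric] sw ..
      also have "(\<Sum>m<N. if m < m0 then \<bar>d m\<bar> else 0) = (\<Sum>m\<in>{..<N} \<inter> {m. m < m0}. \<bar>d m\<bar>)"
        by (subst sum.If_cases) auto
      also have "\<dots> \<le> D" unfolding D_def by (intro sum_mono2) auto
      finally show ?thesis by simp
    qed
    have "(\<lambda>N. D / sqrt (real N)) \<longlonglongrightarrow> 0" by real_asymp
    then have "\<forall>\<^sub>F N in sequentially. D / sqrt (real N) < e / 2" using e by (intro order_tendstoD) auto
    then have "\<forall>\<^sub>F N in sequentially. norm ((\<Sum>m<N. d m) / sqrt (real N) - 0) < e"
      using eventually_gt_at_top[of 0]
    proof eventually_elim
      case (elim N)
      have "\<bar>\<Sum>m<N. d m\<bar> / sqrt (real N) \<le> (D + e / 2 * sqrt (real N)) / sqrt (real N)"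
        by (intro divide_right_mono bnd) auto
      also have "\<dots> = D / sqrt (real N) + e / 2" using elim(2) by (simp add: add_divide_distrib)
      finally have "\<bar>\<Sum>m<N. d m\<bar> / sqrt (real N) < e" using elim(1) by linarith
      then show ?case by simp
    qed
    then show "\<exists>N0. \<forall>N\<ge>N0. norm ((\<Sum>m<N. d m) / sqrt (real N) - 0) < e" by (simp add: eventually_sequentially)
  qed
  then have "(\<lambda>N. (\<Sum>m<N. d m) / sqrt (real N) + 2 * u) \<longlonglongrightarrow> 0 + 2 * u" by (intro tendsto_intros)
  moreover have "\<forall>\<^sub>F N in sequentially. (\<Sum>m<N. d m) / sqrt (real N) + 2 * u = (\<Sum>m<N. a m) / sqrt (real N)"
    using eventually_gt_at_top[of 0]
  proof eventually_elim
    case (elim N)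
    have "(\<Sum>m<N. d m) = (\<Sum>m<N. a m) - u * (2 * sqrt (real N))"
      unfolding d_def sum_subtractf sum_distrib_left[symmetric] sw ..
    then show ?case using elim by (simp add: field_simps)
  qed
  ultimately show ?thesis by (simp add: tendsto_cong)
qed

text \<open>The upper half of a monotone density theorem. \<open>q N\<close> is at most the mean of
  \<open>q\<close> over a window of relative length \<theta> ending at \<open>N\<close>; scaled by
  \<open>sqrt N\<close>, this mean tends to
  \<open>2 * V * (1 - sqrt (1 - \<theta>)) / \<theta>\<close>, which is at most
  \<open>V * (1 + \<theta>)\<close>.\<close>

lemma monotone_density_upper:
  fixes q :: "nat \<Rightarrow> real"
  assumes q: "decseq q" and lim: "(\<lambda>N. (\<Sum>n<N. q n) / sqrt (real N)) \<longlonglongrightarrow> 2 * V" and V: "0 \<le> V" and e: "0 < e"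
  shows "\<forall>\<^sub>F N in sequentially. sqrt (real N) * q N < V + e"
proof -
  \<comment> \<open>The excess \<open>V * \<theta>\<close> has to stay below \<open>e\<close>; the
    denominator \<open>V + 1\<close> covers \<open>V = 0\<close>.\<close>
  define \<theta> where "\<theta> = min (1/2) (e / (2 * (V + 1)))"
  have \<theta>: "0 < \<theta>" "\<theta> \<le> 1/2" and Vt: "V * \<theta> < e"
  proof -
    show "\<theta> \<le> 1/2" unfolding \<theta>_def by (rule min.cobounded1)
    show "0 < \<theta>" unfolding \<theta>_def using e V by auto
    have "V * \<theta> \<le> V * (e / (2 * (V + 1)))" unfolding \<theta>_def using V by (intro mult_left_mono) auto
    also have "\<dots> < e"
    proof -
      have "V * e < e * (2 * (V + 1))" using V e by (simp add: algebra_simps add_nonneg_pos)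
      then show ?thesis using V by (simp add: field_simps)
    qed
    finally show "V * \<theta> < e" .
  qed
  define N' where "N' N = nat \<lfloor>(1 - \<theta>) * real N\<rfloor>" for N :: nat
  have N'1: "real (N' N) \<le> (1 - \<theta>) * real N" for N unfolding N'_def using \<theta> by simp
  have N'2: "(1 - \<theta>) * real N - 1 \<le> real (N' N)" for N unfolding N'_def using \<theta> by linarith
  have ratio: "(\<lambda>N. real (N' N) / real N) \<longlonglongrightarrow> 1 - \<theta>"
  proof (rule tendsto_sandwich)
    show "\<forall>\<^sub>F N in sequentially. (1 - \<theta>) - 1 / real N \<le> real (N' N) / real N"
      using eventually_gt_at_top[of 0]
    proof eventually_elim
      case (elim N)
      have "((1 - \<theta>) * real N - 1) / real N \<le> real (N' N) / real N" by (intro divide_right_mono N'2) auto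
      then show ?case using elim by (simp add: diff_divide_distrib)
    qed
    show "\<forall>\<^sub>F N in sequentially. real (N' N) / real N \<le> 1 - \<theta>"
      using eventually_gt_at_top[of 0]
    proof eventually_elim
      case (elim N)
      have "real (N' N) / real N \<le> ((1 - \<theta>) * real N) / real N" by (intro divide_right_mono N'1) auto
      then show ?case using elim by simp
    qed
    show "(\<lambda>N. (1 - \<theta>) - 1 / real N) \<longlonglongrightarrow> 1 - \<theta>" by real_asymp
  qed simp
  have N'top: "filterlim N' at_top sequentially"
  proof -
    have "filterlim (\<lambda>N. (1 - \<theta>) * real N - 1) at_top sequentially" using \<theta> by real_asymp
    then have "filterlim (\<lambda>N. real (N' N)) at_top sequentially"
      by (rule filterlim_at_top_mono) (use N'2 in auto)
    then show ?thesis by (simp add: filterlim_sequentially_iff_filterlim_real)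
  qed
  let ?Q = "\<lambda>N. \<Sum>n<N. q n"
  have "(\<lambda>N. ?Q (N' N) / sqrt (real (N' N)) * sqrt (real (N' N) / real N)) \<longlonglongrightarrow> 2 * V * sqrt (1 - \<theta>)"
    by (intro tendsto_mult filterlim_compose[OF lim N'top] tendsto_real_sqrt ratio)
  moreover have "\<forall>\<^sub>F N in sequentially. ?Q (N' N) / sqrt (real (N' N)) * sqrt (real (N' N) / real N) = ?Q (N' N) / sqrt (real N)"
    using eventually_compose_filterlim[OF eventually_gt_at_top[of 0] N'top]
    by eventually_elim (auto simp: real_sqrt_divide)
  ultimately have lim': "(\<lambda>N. ?Q (N' N) / sqrt (real N)) \<longlonglongrightarrow> 2 * V * sqrt (1 - \<theta>)" by (simp add: tendsto_cong)
  have "(\<lambda>N. (?Q N / sqrt (real N) - ?Q (N' N) / sqrt (real N)) / \<theta>) \<longlonglongrightarrow> (2 * V - 2 * V * sqrt (1 - \<theta>)) / \<theta>"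
    using \<theta> by (intro tendsto_intros lim lim') auto
  moreover have "(2 * V - 2 * V * sqrt (1 - \<theta>)) / \<theta> < V + e"
  proof -
    have "1 - \<theta> \<le> sqrt (1 - \<theta>)" using \<theta> by (intro real_le_rsqrt) (auto simp: power2_eq_square mult_left_le)
    have s: "(1 - sqrt (1 - \<theta>)) * (1 + sqrt (1 - \<theta>)) = \<theta>" using \<theta> by (simp add: algebra_simps)
    \<comment> \<open>From \<open>s\<close> with
      \<open>1 + sqrt (1 - \<theta>) \<ge> 2 - \<theta>\<close>; the division by
      \<open>2 - \<theta>\<close> is avoided by
      \<open>(2 - \<theta>) * (1 + \<theta>) \<ge> 2\<close>, valid as
      \<open>\<theta> \<le> 1\<close>.\<close>
    have "2 * (1 - sqrt (1 - \<theta>)) \<le> \<theta> * (1 + \<theta>)"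
    proof -
      have "(1 - sqrt (1 - \<theta>)) * (2 - \<theta>) \<le> (1 - sqrt (1 - \<theta>)) * (1 + sqrt (1 - \<theta>))"
        using \<open>1 - \<theta> \<le> sqrt (1 - \<theta>)\<close> \<theta> by (intro mult_left_mono) auto
      then have "(1 - sqrt (1 - \<theta>)) * (2 - \<theta>) \<le> \<theta>" using s by simp
      then have "(1 - sqrt (1 - \<theta>)) * (2 - \<theta>) * (1 + \<theta>) \<le> \<theta> * (1 + \<theta>)" using \<theta> by (intro mult_right_mono) auto
      moreover have "2 \<le> (2 - \<theta>) * (1 + \<theta>)" using \<theta> by (simp add: algebra_simps mult_left_le)
      then have "(1 - sqrt (1 - \<theta>)) * 2 \<le> (1 - sqrt (1 - \<theta>)) * ((2 - \<theta>) * (1 + \<theta>))"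
        using \<theta> by (intro mult_left_mono) auto
      ultimately show ?thesis unfolding mult.assoc mult.commute[of 2] by (rule order_trans[rotated])
    qed
    from mult_left_mono[OF this V] have "(2 * V - 2 * V * sqrt (1 - \<theta>)) \<le> (V + V * \<theta>) * \<theta>"
      by (simp add: algebra_simps)
    then have "(2 * V - 2 * V * sqrt (1 - \<theta>)) / \<theta> \<le> V + V * \<theta>" using \<theta> by (simp add: pos_divide_le_eq)
    then show ?thesis using Vt by simp
  qed
  ultimately have "\<forall>\<^sub>F N in sequentially. (?Q N / sqrt (real N) - ?Q (N' N) / sqrt (real N)) / \<theta> < V + e"
    by (rule order_tendstoD)
  then show ?thesis using eventually_gt_at_top[of 0]
  proof eventually_elim
    case (elim N)
    have "(1 - \<theta>) * real N \<le> 1 * real N" using \<theta> by (intro mult_right_mono) auto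
    then have NN: "real (N' N) \<le> real N" using N'1[of N] by linarith
    then have le: "N' N \<le> N" by simp
    have q0: "?Q N - ?Q (N' N) = (\<Sum>n\<in>{N' N..<N}. q n)"
      using sum.atLeastLessThan_concat[of 0 "N' N" N q] le by (simp add: atLeast0LessThan)
    have "(\<Sum>n\<in>{N' N..<N}. q N) \<le> (\<Sum>n\<in>{N' N..<N}. q n)"
      by (intro sum_mono decseqD[OF q]) auto
    then have h: "(real N - real (N' N)) * q N \<le> ?Q N - ?Q (N' N)" unfolding q0 using le by (simp add: of_nat_diff)
    show ?case
    proof (cases "0 \<le> q N")
      case True
      have "\<theta> * real N \<le> real N - real (N' N)" using N'1[of N] by (simp add: algebra_simps)
      then have "\<theta> * real N * q N \<le> ?Q N - ?Q (N' N)" using h True by (meson mult_right_mono order_trans)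
      then have "\<theta> * real N * q N / sqrt (real N) \<le> (?Q N - ?Q (N' N)) / sqrt (real N)" by (intro divide_right_mono) auto
      moreover have "\<theta> * real N * q N / sqrt (real N) = (sqrt (real N) * q N) * \<theta>"
      proof -
        have "\<theta> * real N * q N / sqrt (real N) = real N / sqrt (real N) * q N * \<theta>" by simp
        then show ?thesis by (simp only: real_div_sqrt[OF of_nat_0_le_iff])
      qed
      ultimately have "sqrt (real N) * q N \<le> (?Q N / sqrt (real N) - ?Q (N' N) / sqrt (real N)) / \<theta>"
        unfolding pos_le_divide_eq[OF \<theta>(1)] diff_divide_distrib[symmetric] by linarith
      then show ?thesis using elim(1) by simp
    next
      case False
      then have "sqrt (real N) * q N \<le> 0" by (intro mult_nonneg_nonpos) auto
      then show ?thesis using V e by linarith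
    qed
  qed
qed

lemma inverse_sqrt_le_diff: "1 / sqrt (real m + 1) \<le> 2 * (sqrt (real m + 1) - sqrt (real m))"
proof -
  define a b where "a = sqrt (real m + 1)" and "b = sqrt (real m)"
  have ab: "0 < a" "0 \<le> b" "b \<le> a" "a * a = b * b + 1" by (auto simp: a_def b_def)
  have "1 = (a - b) * (a + b)" using ab by (simp add: algebra_simps)
  also have "\<dots> \<le> (a - b) * (2 * a)" using ab by (intro mult_left_mono) auto
  finally have "1 \<le> 2 * (a - b) * a" by (simp only: mult_ac)
  then show ?thesis unfolding a_def[symmetric] b_def[symmetric] pos_divide_le_eq[OF ab(1)] .
qed

text \<open>Reorders a sum over horizons \<open>n\<close> and crossing times \<open>j\<close> by
  \<open>j\<close> and the remaining length \<open>m = n - j\<close>.\<close>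

lemma sum_shifted_diagonal:
  fixes f :: "nat \<Rightarrow> nat \<Rightarrow> real"
  shows "(\<Sum>n<N. \<Sum>j\<le>n. f j (n - j)) = (\<Sum>j<N. \<Sum>m<N - j. f j m)"
proof (induction N)
  case (Suc N)
  have "(\<Sum>j<N. \<Sum>m<Suc N - j. f j m) = (\<Sum>j<N. (\<Sum>m<N - j. f j m) + f j (N - j))"
    by (intro sum.cong) (auto simp: Suc_diff_le)
  then have "(\<Sum>j<Suc N. \<Sum>m<Suc N - j. f j m) = (\<Sum>j<N. (\<Sum>m<N - j. f j m) + f j (N - j)) + f N 0" by simp
  then show ?case using Suc by (simp add: sum.distrib lessThan_Suc_atMost[symmetric])
qed simp

text \<open>A surviving path has exactly one current excursion. The range of \<open>k\<close> may
  exceed \<open>n\<close>, so that one \<open>N\<close> serves all horizons when sums over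
  \<open>n\<close> and \<open>k\<close> are exchanged.\<close>

lemma sum_reach_alive:
  assumes "n \<le> N"
  shows "(\<Sum>k\<le>N. \<Sum>j\<le>n. of_bool (reach K s us k j) * of_bool (alive K s j (us k) n))
       = (of_bool (enat n < absorb_time s us K) :: real)"
proof (cases "enat n < absorb_time s us K")
  case True
  then obtain k0 j0 where kj: "k0 \<le> n" "j0 \<le> n" "reach K s us k0 j0" "alive K s j0 (us k0) n"
    unfolding less_absorb_time_decomp by blast
  have "(\<Sum>k\<le>N. \<Sum>j\<le>n. of_bool (reach K s us k j) * of_bool (alive K s j (us k) n))
      = (\<Sum>k\<le>N. \<Sum>j\<le>n. if k = k0 then if j = j0 then 1 else 0 else (0::real))"
  proof (intro sum.cong refl)
    fix k j assume "j \<in> {..n}"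
    then have "reach K s us k j \<and> alive K s j (us k) n \<longleftrightarrow> k = k0 \<and> j = j0"
      using kj reach_alive_unique[of K s us k j n k0 j0] by auto
    then show "of_bool (reach K s us k j) * of_bool (alive K s j (us k) n) = (if k = k0 then if j = j0 then 1 else 0 else (0::real))"
      by (auto simp: of_bool_def)
  qed
  also have "\<dots> = (\<Sum>k\<le>N. if k = k0 then 1 else 0)" using kj(2) by (intro sum.cong refl) (auto simp: sum.delta)
  also have "\<dots> = 1" using kj(1) assms by (simp add: sum.delta)
  finally show ?thesis using True by simp
next
  case False
  then have "\<not> (reach K s us k j \<and> alive K s j (us k) n)" if "j \<le> n" for k j
    using that less_absorb_time_iff reach_iff[of K s us k j] alive_iff[of s k j n K us]
    by (metis atLeastAtMost_iff le_absorb_time_iff leI)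
  then have "(\<Sum>k\<le>N. \<Sum>j\<le>n. of_bool (reach K s us k j) * of_bool (alive K s j (us k) n)) = (0 :: real)"
    by (intro sum.neutral ballI) (auto simp: of_bool_def)
  then show ?thesis using False by simp
qed

lemma alive_wpath_comb:
  assumes "j \<le> n"
  shows "alive K (wpath x (comb_seq j \<xi> \<xi>')) j (comb_seq k \<upsilon> \<upsilon>' k) n \<longleftrightarrow> alive K (wpath (wpath x \<xi> j) \<xi>') 0 (\<upsilon>' 0) (n - j)"
  unfolding alive_shift[OF assms] wpath_comb_add by (simp add: comb_seq_def)

section \<open>Geometric decay of the moments at the crossings\<close>

context killed_walk
begin

text \<open>The first moment at the next crossing is at most \<open>l / 2\<close> times the present
  one plus \<open>C\<close> times the probability of the present one, and (C1) makes that
  probability decay. The bound is uniform in the time horizon \<open>n\<close>.\<close>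

lemma reach_moments:
  assumes c: "0 < c" "0 < \<gamma>" "\<gamma> < 1"
    and C1: "\<And>k. prob {\<omega>\<in>space M. zc_time (wpath x (Xs \<omega>)) k \<le> absorb_time (wpath x (Xs \<omega>)) (Us \<omega>) K} \<le> c * \<gamma> ^ k"
  shows "\<exists>B l. 0 \<le> B \<and> 0 < l \<and> l < 1 \<and>
    (\<forall>k n. (\<Sum>j\<le>n. \<integral>\<omega>. of_bool (R x k j \<omega>) * (1 + \<bar>S x \<omega> j\<bar>) \<partial>M) \<le> B * l ^ k)"
proof -
  define l where "l = max \<gamma> (1/2)"
  have l: "0 < l" "l < 1" "\<gamma> \<le> l" using c by (auto simp: l_def)
  obtain C where C: "0 \<le> C" "\<And>n y. stopped M (X 0) (side y) (exit_abs y) n y \<le> l / 2 * \<bar>y\<bar> + C"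
    using exit_abs_stopped_bound[of "l / 2"] l by auto
  define r :: "nat \<Rightarrow> nat \<Rightarrow> real" where "r k n = (\<Sum>j\<le>n. \<integral>\<omega>. of_bool (R x k j \<omega>) \<partial>M)" for k n
  define b where "b k n = (\<Sum>j\<le>n. \<integral>\<omega>. of_bool (R x k j \<omega>) * \<bar>S x \<omega> j\<bar> \<partial>M)" for k n :: nat
  have r: "r k n \<le> c * l ^ k" for k n
  proof -
    have "r k n \<le> c * \<gamma> ^ k" unfolding r_def using sum_prob_reach_le[of x k n] C1[of k] by simp
    also have "\<dots> \<le> c * l ^ k" using c l by (intro mult_left_mono power_mono) auto
    finally show ?thesis .
  qed
  \<comment> \<open>|x| starts the induction; the other value gives
    \<open>C * c \<le> l / 2 * B\<close>, so the inhomogeneous term takes the half of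
    \<open>l\<close> that the contraction leaves free.\<close>
  define B where "B = max \<bar>x\<bar> (2 * C * c / l)"
  have b: "b k n \<le> B * l ^ k" for k n
  proof (induction k)
    case 0
    have "b 0 n = (\<Sum>j\<le>n. if j = 0 then \<bar>x\<bar> else 0)"
      unfolding b_def by (intro sum.cong refl) (auto simp: prob_space)
    then show ?case by (simp add: B_def sum.delta)
  next
    case (Suc k)
    have "b (Suc k) n = (\<integral>\<omega>. (\<Sum>j\<le>n. of_bool (R x (Suc k) j \<omega>) * \<bar>S x \<omega> j\<bar>) \<partial>M)"
      unfolding b_def by (rule Bochner_Integration.integral_sum[symmetric]) (rule integrable_reach_abs)
    also have "\<dots> \<le> (\<integral>\<omega>. (\<Sum>i\<le>n. of_bool (R x k i \<omega>) * stopped_path (side (S x \<omega> i)) (exit_abs (S x \<omega> i)) (n - i) (S x \<omega> i) (\<lambda>m. X (i + m) \<omega>)) \<partial>M)"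
      by (intro integral_mono Bochner_Integration.integrable_sum integrable_reach_abs integral_exit_path(1) exit_path_ge)
    also have "\<dots> = (\<Sum>i\<le>n. \<integral>\<omega>. of_bool (R x k i \<omega>) * stopped_path (side (S x \<omega> i)) (exit_abs (S x \<omega> i)) (n - i) (S x \<omega> i) (\<lambda>m. X (i + m) \<omega>) \<partial>M)"
      by (rule Bochner_Integration.integral_sum) (rule integral_exit_path(1))
    also have "\<dots> \<le> (\<Sum>i\<le>n. l / 2 * (\<integral>\<omega>. of_bool (R x k i \<omega>) * \<bar>S x \<omega> i\<bar> \<partial>M) + C * (\<integral>\<omega>. of_bool (R x k i \<omega>) \<partial>M))"
    proof (rule sum_mono)
      fix i
      have "(\<integral>\<omega>. of_bool (R x k i \<omega>) * stopped_path (side (S x \<omega> i)) (exit_abs (S x \<omega> i)) (n - i) (S x \<omega> i) (\<lambda>m. X (i + m) \<omega>) \<partial>M)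
          = (\<integral>\<omega>. of_bool (R x k i \<omega>) * stopped M (X 0) (side (S x \<omega> i)) (exit_abs (S x \<omega> i)) (n - i) (S x \<omega> i) \<partial>M)"
        by (rule integral_exit_path(2))
      also have "\<dots> \<le> (\<integral>\<omega>. l / 2 * (of_bool (R x k i \<omega>) * \<bar>S x \<omega> i\<bar>) + C * of_bool (R x k i \<omega>) \<partial>M)"
      proof (rule integral_mono)
        show "integrable M (\<lambda>\<omega>. l / 2 * (of_bool (R x k i \<omega>) * \<bar>S x \<omega> i\<bar>) + C * of_bool (R x k i \<omega>))"
          by (intro Bochner_Integration.integrable_add integrable_mult_right integrable_reach_abs integrable_reach)
        show "of_bool (R x k i \<omega>) * stopped M (X 0) (side (S x \<omega> i)) (exit_abs (S x \<omega> i)) (n - i) (S x \<omega> i)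
            \<le> l / 2 * (of_bool (R x k i \<omega>) * \<bar>S x \<omega> i\<bar>) + C * of_bool (R x k i \<omega>)" for \<omega>
          using C(2)[of "S x \<omega> i" "n - i"] by (cases "R x k i \<omega>") auto
      qed (rule integral_exit_path(3))
      also have "\<dots> = l / 2 * (\<integral>\<omega>. of_bool (R x k i \<omega>) * \<bar>S x \<omega> i\<bar> \<partial>M) + C * (\<integral>\<omega>. of_bool (R x k i \<omega>) \<partial>M)"
        using integrable_reach_abs[of x k i] integrable_reach[of x k i] by simp
      finally show "(\<integral>\<omega>. of_bool (R x k i \<omega>) * stopped_path (side (S x \<omega> i)) (exit_abs (S x \<omega> i)) (n - i) (S x \<omega> i) (\<lambda>m. X (i + m) \<omega>) \<partial>M)
          \<le> l / 2 * (\<integral>\<omega>. of_bool (R x k i \<omega>) * \<bar>S x \<omega> i\<bar> \<partial>M) + C * (\<integral>\<omega>. of_bool (R x k i \<omega>) \<partial>M)" .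
    qed
    also have "\<dots> = l / 2 * b k n + C * r k n" unfolding b_def r_def by (simp add: sum.distrib sum_distrib_left)
    also have "\<dots> \<le> l / 2 * (B * l ^ k) + C * (c * l ^ k)"
      using Suc r[of k n] C(1) l by (intro add_mono mult_left_mono) auto
    also have "\<dots> \<le> B * l ^ Suc k"
    proof -
      have "2 * C * c / l \<le> B" by (simp add: B_def)
      then have "2 * C * c \<le> B * l" using l by (simp add: pos_divide_le_eq)
      then have "C * c \<le> l / 2 * B" by (simp add: mult_ac)
      then have "C * c * l ^ k \<le> l / 2 * B * l ^ k" using l by (intro mult_right_mono) auto
      then show ?thesis by (simp add: algebra_simps)
    qed
    finally show ?case .
  qed
  have "(\<Sum>j\<le>n. \<integral>\<omega>. of_bool (R x k j \<omega>) * (1 + \<bar>S x \<omega> j\<bar>) \<partial>M) \<le> (c + B) * l ^ k" for k n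
  proof -
    have "(\<integral>\<omega>. of_bool (R x k j \<omega>) * (1 + \<bar>S x \<omega> j\<bar>) \<partial>M)
        = (\<integral>\<omega>. of_bool (R x k j \<omega>) \<partial>M) + (\<integral>\<omega>. of_bool (R x k j \<omega>) * \<bar>S x \<omega> j\<bar> \<partial>M)" for j
      using integrable_reach[of x k j] integrable_reach_abs[of x k j] by (simp add: distrib_left)
    then have "(\<Sum>j\<le>n. \<integral>\<omega>. of_bool (R x k j \<omega>) * (1 + \<bar>S x \<omega> j\<bar>) \<partial>M) = r k n + b k n"
      unfolding r_def b_def by (simp add: sum.distrib)
    then show ?thesis using r[of k n] b[of k n] by (simp add: distrib_right)
  qed
  moreover have "0 \<le> c + B" using c by (simp add: B_def le_max_iff_disj)
  ultimately show ?thesis using l by blast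
qed

subsection \<open>Surviving one excursion\<close>

text \<open>The probability in (C2), by \<open>first_excursion_iff\<close>.\<close>

definition g :: "nat \<Rightarrow> real \<Rightarrow> real" where
  "g n y = (\<integral>\<omega>. of_bool (alive K (wpath y (Xs \<omega>)) 0 (U 0 \<omega>) n) \<partial>M)"

lemma pred_alive_start:
  assumes [measurable]: "f \<in> borel_measurable N" "h \<in> measurable N M"
  shows "Measurable.pred N (\<lambda>p. alive K (wpath (f p) (Xs (h p))) 0 (U 0 (h p)) n)"
proof (rule pred_alive[OF K_meas])
  show "(\<lambda>p. wpath (f p) (Xs (h p)) m) \<in> borel_measurable N" for m
    by (intro measurable_wpath assms measurable_compose[OF assms(2) Xs_measurable])
  show "(\<lambda>p. U 0 (h p)) \<in> measurable N marks" by (rule measurable_compose[OF assms(2) U_measurable])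
qed

lemma pred_alive_M [measurable]: "Measurable.pred M (\<lambda>\<omega>. alive K (wpath y (Xs \<omega>)) 0 (U 0 \<omega>) n)"
  by (rule pred_alive_start) auto

lemma g_measurable [measurable]: "g n \<in> borel_measurable borel"
proof -
  have [measurable]: "Measurable.pred (borel \<Otimes>\<^sub>M M) (\<lambda>p. alive K (wpath (fst p) (Xs (snd p))) 0 (U 0 (snd p)) n)"
    by (rule pred_alive_start) auto
  have "(\<lambda>p. of_bool (alive K (wpath (fst p) (Xs (snd p))) 0 (U 0 (snd p)) n) :: real) \<in> borel_measurable (borel \<Otimes>\<^sub>M M)"
    by measurable
  then show ?thesis
    unfolding g_def[abs_def] by (intro borel_measurable_lebesgue_integral) (simp add: case_prod_beta')
qed

lemma integrable_alive: "integrable M (\<lambda>\<omega>. of_bool (alive K (wpath y (Xs \<omega>)) 0 (U 0 \<omega>) n) :: real)"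
  by (rule integrable_const_bound[of _ 1]) auto

lemma g_eq_prob: "g n y = prob {\<omega>\<in>space M. alive K (wpath y (Xs \<omega>)) 0 (U 0 \<omega>) n}"
proof -
  have "g n y = (\<integral>\<omega>. indicator {\<omega>\<in>space M. alive K (wpath y (Xs \<omega>)) 0 (U 0 \<omega>) n} \<omega> \<partial>M)"
    unfolding g_def by (intro Bochner_Integration.integral_cong) (auto simp: indicator_def)
  then show ?thesis by simp
qed

lemma g_bounds: "0 \<le> g n y" "g n y \<le> 1"
  by (auto simp: g_eq_prob)

text \<open>Without absorption what remains is the probability of staying on one side.\<close>

lemma g_sqrt_bound: "\<exists>C\<ge>0. \<forall>n y. sqrt (real n) * g n y \<le> C * (1 + \<bar>y\<bar>)"
proof -
  obtain C where C: "0 \<le> C" "\<And>n y. sqrt (real n) * stopped M (X 0) (side y) (indicator (side y)) n y \<le> C * (1 + \<bar>y\<bar>)"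
    using stay_prob_bound by blast
  have "g n y \<le> stopped M (X 0) (side y) (indicator (side y)) n y" for n y
  proof -
    have "g n y \<le> (\<integral>\<omega>. stopped_path (side y) (indicator (side y)) n y (Xs \<omega>) \<partial>M)"
      unfolding g_def
    proof (rule integral_mono)
      show "integrable M (\<lambda>\<omega>. stopped_path (side y) (indicator (side y)) n y (Xs \<omega>))"
        by (intro stopped_path_integral lin_growth_indicator) auto
      show "of_bool (alive K (wpath y (Xs \<omega>)) 0 (U 0 \<omega>) n) \<le> stopped_path (side y) (indicator (side y)) n y (Xs \<omega>)" for \<omega>
        unfolding stopped_path_indicator alive_def by (force simp: side_def of_bool_def not_le)
    qed (rule integrable_alive)
    then show ?thesis by (simp add: stopped_path_integral(2)[OF lin_growth_indicator])
  qed
  then have "sqrt (real n) * g n y \<le> C * (1 + \<bar>y\<bar>)" for n y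
    using C(2)[of n y] by (smt (verit) mult_left_mono real_sqrt_ge_zero of_nat_0_le_iff)
  then show ?thesis using C(1) by blast
qed

text \<open>The bound of \<open>g_sqrt_bound\<close> is void at \<open>m = 0\<close>; together with
  \<open>g \<le> 1\<close> it gives one with \<open>sqrt (m + 1)\<close> and the constant
  \<open>C + 1\<close>. Summed, it also covers short excursions, and this makes averages over
  \<open>n\<close> dominated.\<close>

lemma sum_g_bound: "\<exists>C\<ge>0. \<forall>n y. (\<Sum>m<n. g m y) \<le> C * (1 + \<bar>y\<bar>) * sqrt (real n)"
proof -
  obtain C where C: "0 \<le> C" "\<And>n y. sqrt (real n) * g n y \<le> C * (1 + \<bar>y\<bar>)" using g_sqrt_bound by blast
  have "(\<Sum>m<n. g m y) \<le> (2 * (C + 1)) * (1 + \<bar>y\<bar>) * sqrt (real n)" for n y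
  proof -
    have "g m y \<le> (C + 1) * (1 + \<bar>y\<bar>) * (2 * (sqrt (real m + 1) - sqrt (real m)))" for m
    proof -
      have "sqrt (real m + 1) \<le> sqrt (real m) + 1" using sqrt_add_le_add_sqrt[of "real m" 1] by simp
      then have "sqrt (real m + 1) * g m y \<le> (sqrt (real m) + 1) * g m y" using g_bounds by (intro mult_right_mono) auto
      also have "\<dots> \<le> (C + 1) * (1 + \<bar>y\<bar>)" using C(2)[of m y] g_bounds[of m y] by (simp add: algebra_simps)
      finally have "g m y \<le> (C + 1) * (1 + \<bar>y\<bar>) * (1 / sqrt (real m + 1))" by (simp add: pos_le_divide_eq mult.commute)
      also have "\<dots> \<le> (C + 1) * (1 + \<bar>y\<bar>) * (2 * (sqrt (real m + 1) - sqrt (real m)))"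
        using C(1) by (intro mult_left_mono inverse_sqrt_le_diff) auto
      finally show ?thesis .
    qed
    then have "(\<Sum>m<n. g m y) \<le> (\<Sum>m<n. (C + 1) * (1 + \<bar>y\<bar>) * (2 * (sqrt (real m + 1) - sqrt (real m))))" by (intro sum_mono)
    also have "\<dots> = (C + 1) * (1 + \<bar>y\<bar>) * (2 * sqrt (real n))"
      unfolding sum_distrib_left[symmetric, where r = "(C + 1) * (1 + \<bar>y\<bar>)"] sum_sqrt_diff ..
    finally show ?thesis by (simp add: algebra_simps)
  qed
  then show ?thesis using C(1) by (intro exI[of _ "2 * (C + 1)"]) auto
qed

text \<open>\<open>\<Phi>\<close> may depend on the whole path, including the part before
  \<open>j\<close>: the rescaled path of the theorem starts at \<open>x\<close>, not at the
  crossing.\<close>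

lemma reach_alive_integral:
  fixes \<Phi> :: "(nat \<Rightarrow> real) \<times> (nat \<Rightarrow> nat \<Rightarrow> real) \<Rightarrow> real"
  assumes \<Phi>: "\<Phi> \<in> borel_measurable paths" "\<And>p. \<bar>\<Phi> p\<bar> \<le> B" and jn: "j \<le> n"
  shows "(\<integral>\<omega>. of_bool (R x k j \<omega>) * (of_bool (alive K (wpath x (Xs \<omega>)) j (U k \<omega>) n) * \<Phi> (Xs \<omega>, Us \<omega>)) \<partial>M)
    = (\<integral>\<omega>. of_bool (R x k j \<omega>) * (\<integral>\<omega>'. of_bool (alive K (wpath (S x \<omega> j) (Xs \<omega>')) 0 (U 0 \<omega>') (n - j)) *
          \<Phi> (comb_seq j (Xs \<omega>) (Xs \<omega>'), comb_seq k (Us \<omega>) (Us \<omega>')) \<partial>M) \<partial>M)"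
    and "integrable M (\<lambda>\<omega>. of_bool (R x k j \<omega>) * (of_bool (alive K (wpath x (Xs \<omega>)) j (U k \<omega>) n) * \<Phi> (Xs \<omega>, Us \<omega>)))"
    and "integrable M (\<lambda>\<omega>. of_bool (R x k j \<omega>) * (\<integral>\<omega>'. of_bool (alive K (wpath (S x \<omega> j) (Xs \<omega>')) 0 (U 0 \<omega>') (n - j)) *
          \<Phi> (comb_seq j (Xs \<omega>) (Xs \<omega>'), comb_seq k (Us \<omega>) (Us \<omega>')) \<partial>M))"
proof -
  let ?H = "\<lambda>p. of_bool (alive K (wpath x (fst p)) j (snd p k) n) * \<Phi> p"
  note [measurable] = pred_alive_wpath[OF K_meas] \<Phi>(1)
  have Hm: "?H \<in> borel_measurable paths" by measurable
  have B: "0 \<le> B" using \<Phi>(2)[of undefined] by linarith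
  have "of_bool (R x k j \<omega>) * (of_bool (alive K (wpath x (Xs \<omega>)) j (U k \<omega>) n) * \<Phi> (Xs \<omega>, Us \<omega>)) \<in> {-B..B}" for \<omega>
    using \<Phi>(2)[of "(Xs \<omega>, Us \<omega>)"] B by (auto simp: of_bool_def abs_le_iff)
  then have bnd: "\<bar>of_bool (R x k j \<omega>) * (of_bool (alive K (wpath x (Xs \<omega>)) j (U k \<omega>) n) * \<Phi> (Xs \<omega>, Us \<omega>))\<bar> \<le> B" for \<omega>
    by (simp add: abs_le_iff minus_le_iff)
  have "(\<lambda>\<omega>. ?H (Xs \<omega>, Us \<omega>)) \<in> borel_measurable M"
    using measurable_compose[OF measurable_Pair[OF Xs_measurable Us_measurable] Hm] .
  then have m: "(\<lambda>\<omega>. of_bool (R x k j \<omega>) * ?H (Xs \<omega>, Us \<omega>)) \<in> borel_measurable M" by measurable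
  have int: "integrable M (\<lambda>\<omega>. of_bool (R x k j \<omega>) * ?H (Xs \<omega>, Us \<omega>))"
    by (rule integrable_const_bound[of _ B]) (use bnd m in auto)
  then show "integrable M (\<lambda>\<omega>. of_bool (R x k j \<omega>) * (of_bool (alive K (wpath x (Xs \<omega>)) j (U k \<omega>) n) * \<Phi> (Xs \<omega>, Us \<omega>)))"
    by simp
  note markov_reach[OF Hm int]
  then show "(\<integral>\<omega>. of_bool (R x k j \<omega>) * (of_bool (alive K (wpath x (Xs \<omega>)) j (U k \<omega>) n) * \<Phi> (Xs \<omega>, Us \<omega>)) \<partial>M)
    = (\<integral>\<omega>. of_bool (R x k j \<omega>) * (\<integral>\<omega>'. of_bool (alive K (wpath (S x \<omega> j) (Xs \<omega>')) 0 (U 0 \<omega>') (n - j)) *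
          \<Phi> (comb_seq j (Xs \<omega>) (Xs \<omega>'), comb_seq k (Us \<omega>) (Us \<omega>')) \<partial>M) \<partial>M)"
    and "integrable M (\<lambda>\<omega>. of_bool (R x k j \<omega>) * (\<integral>\<omega>'. of_bool (alive K (wpath (S x \<omega> j) (Xs \<omega>')) 0 (U 0 \<omega>') (n - j)) *
          \<Phi> (comb_seq j (Xs \<omega>) (Xs \<omega>'), comb_seq k (Us \<omega>) (Us \<omega>')) \<partial>M))"
    by (simp_all add: alive_wpath_comb[OF jn])
qed

lemma prob_reach_alive:
  assumes "j \<le> n"
  shows "(\<integral>\<omega>. of_bool (R x k j \<omega>) * of_bool (alive K (wpath x (Xs \<omega>)) j (U k \<omega>) n) \<partial>M)
       = (\<integral>\<omega>. of_bool (R x k j \<omega>) * g (n - j) (S x \<omega> j) \<partial>M)"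
    and "integrable M (\<lambda>\<omega>. of_bool (R x k j \<omega>) * of_bool (alive K (wpath x (Xs \<omega>)) j (U k \<omega>) n) :: real)"
  using reach_alive_integral[of "\<lambda>_. 1" 1 j n x k] assms by (simp_all add: g_def)

definition q :: "real \<Rightarrow> nat \<Rightarrow> real" where
  "q x n = prob {\<omega>\<in>space M. enat n < absorb_time (wpath x (Xs \<omega>)) (Us \<omega>) K}"

lemma pred_survive [measurable]: "Measurable.pred M (\<lambda>\<omega>. enat n < absorb_time (wpath x (Xs \<omega>)) (Us \<omega>) K)"
  using measurable_compose[OF measurable_Pair[OF Xs_measurable Us_measurable] pred_less_absorb_time[OF K_meas]] by simp

lemma q_eq_integral: "q x n = (\<integral>\<omega>. of_bool (enat n < absorb_time (wpath x (Xs \<omega>)) (Us \<omega>) K) \<partial>M)"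
proof -
  have "(\<integral>\<omega>. of_bool (enat n < absorb_time (wpath x (Xs \<omega>)) (Us \<omega>) K) \<partial>M)
      = (\<integral>\<omega>. indicator {\<omega>\<in>space M. enat n < absorb_time (wpath x (Xs \<omega>)) (Us \<omega>) K} \<omega> \<partial>M :: real)"
    by (intro Bochner_Integration.integral_cong) (auto simp: indicator_def)
  then show ?thesis by (simp add: q_def)
qed

lemma q_eq_sum:
  assumes "n \<le> N"
  shows "q x n = (\<Sum>k\<le>N. \<Sum>j\<le>n. \<integral>\<omega>. of_bool (R x k j \<omega>) * g (n - j) (S x \<omega> j) \<partial>M)"
proof -
  have "q x n = (\<integral>\<omega>. (\<Sum>k\<le>N. \<Sum>j\<le>n. of_bool (R x k j \<omega>) * of_bool (alive K (wpath x (Xs \<omega>)) j (U k \<omega>) n)) \<partial>M)"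
    unfolding q_eq_integral sum_reach_alive[OF assms] ..
  also have "\<dots> = (\<Sum>k\<le>N. \<Sum>j\<le>n. \<integral>\<omega>. of_bool (R x k j \<omega>) * of_bool (alive K (wpath x (Xs \<omega>)) j (U k \<omega>) n) \<partial>M)"
  proof -
    have I: "integrable M (\<lambda>\<omega>. of_bool (R x k j \<omega>) * of_bool (alive K (wpath x (Xs \<omega>)) j (U k \<omega>) n) :: real)"
      if "j \<in> {..n}" for k j using that by (intro prob_reach_alive) auto
    show ?thesis
      by (simp only: Bochner_Integration.integral_sum[OF Bochner_Integration.integrable_sum[OF I]] Bochner_Integration.integral_sum[OF I])
  qed
  also have "\<dots> = (\<Sum>k\<le>N. \<Sum>j\<le>n. \<integral>\<omega>. of_bool (R x k j \<omega>) * g (n - j) (S x \<omega> j) \<partial>M)"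
    by (intro sum.cong refl prob_reach_alive) auto
  finally show ?thesis .
qed

lemma decseq_q: "decseq (q x)"
  unfolding decseq_def q_def
  by (intro allI impI finite_measure_mono) (auto intro: order_le_less_trans[of "enat m" "enat n" for m n])

end

section \<open>Limits for a fixed crossing\<close>

lemma modulus_mono:
  assumes "continuous_on {0..1} f" "0 \<le> d" "d \<le> d'" shows "modulus f d \<le> modulus f d'"
  by (rule modulus_least[OF assms(2)]) (use modulus_upper[OF assms(1)] assms(3) in force)

lemma abs_interp_le:
  assumes "0 \<le> r" "r \<le> real n" "\<And>i. i \<le> Suc (nat \<lfloor>r\<rfloor>) \<Longrightarrow> \<bar>s i\<bar> \<le> A"
  shows "\<bar>interp s n r\<bar> \<le> A"
proof -
  define m where "m = nat \<lfloor>r\<rfloor>"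
  define t where "t = r - real m"
  have t: "0 \<le> t" "t \<le> 1" unfolding t_def m_def using assms(1) by (auto intro: order.strict_implies_order) linarith
  have "interp s n r = (1 - t) * s m + t * s (Suc m)"
    unfolding interp_eq[OF assms(1,2)] m_def[symmetric] t_def[symmetric] by (simp add: algebra_simps)
  moreover have "\<bar>(1 - t) * s m\<bar> \<le> (1 - t) * A" using t assms(3)[of m] by (auto simp: abs_mult m_def intro!: mult_left_mono)
  moreover have "\<bar>t * s (Suc m)\<bar> \<le> t * A" using t assms(3)[of "Suc m"] by (auto simp: abs_mult m_def intro!: mult_left_mono)
  moreover have "(1 - t) * A + t * A = A" by (simp add: algebra_simps)
  ultimately show ?thesis by linarith
qed

lemma interp_shift:
  assumes s: "\<And>i. s (j + i) = s' i" and r: "real j \<le> r" "r \<le> real n"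
  shows "interp s n r = interp s' n (r - real j)"
proof -
  have "\<lfloor>r - real j\<rfloor> = \<lfloor>r\<rfloor> - int j" by linarith
  moreover have "int j \<le> \<lfloor>r\<rfloor>" using r by linarith
  ultimately have m: "nat \<lfloor>r\<rfloor> = j + nat \<lfloor>r - real j\<rfloor>" by simp
  define k where "k = nat \<lfloor>r - real j\<rfloor>"
  have sS: "s (Suc (j + k)) = s' (Suc k)" using s[of "Suc k"] by simp
  have 1: "interp s n r = s (j + k) + (r - real (j + k)) * (s (Suc (j + k)) - s (j + k))"
    using r unfolding k_def m[symmetric] by (intro interp_eq) auto
  have 2: "interp s' n (r - real j) = s' k + (r - real j - real k) * (s' (Suc k) - s' k)"
    using r unfolding k_def by (intro interp_eq) auto
  show ?thesis unfolding 1 2 sS s by (simp add: diff_diff_eq)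
qed

text \<open>After time \<open>j\<close> the paths agree up to a time shift of \<open>j / n\<close>.
  Before it, the first path is bounded by the largest early position, and the second has moved from
  its start \<open>s j\<close> by at most the modulus.\<close>

lemma dist01_rescaled_shift:
  assumes s: "\<And>i. s (j + i) = s' i" and n: "0 < n" and \<sigma>: "0 < \<sigma>"
  shows "dist01 (rescaled \<sigma> s n) (rescaled \<sigma> s' n)
     \<le> modulus (rescaled \<sigma> s' n) (real j / real n) + 2 * (\<Sum>i\<le>j. \<bar>s i\<bar>) / (\<sigma> * sqrt (real n))"
proof (rule dist01_le)
  define A where "A = (\<Sum>i\<le>j. \<bar>s i\<bar>)"
  define w where "w = modulus (rescaled \<sigma> s' n) (real j / real n)"
  define c where "c = \<sigma> * sqrt (real n)"
  have c: "0 < c" unfolding c_def using n \<sigma> by simp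
  have A0: "0 \<le> A" unfolding A_def by (intro sum_nonneg) auto
  have A: "\<bar>s i\<bar> \<le> A" if "i \<le> j" for i
    unfolding A_def using that by (intro member_le_sum) auto
  note cont = continuous_on_rescaled[of \<sigma> s' n]
  fix t :: real assume t: "t \<in> {0..1}"
  have nt: "0 \<le> real n * t" "real n * t \<le> real n" using t n by (auto simp: mult_left_le)
  have "\<bar>rescaled \<sigma> s n t - rescaled \<sigma> s' n t\<bar> \<le> w + 2 * A / c"
  proof (cases "real j \<le> real n * t")
    case True
    define t' where "t' = t - real j / real n"
    have t': "t' \<in> {0..1}" and nt': "real n * t' = real n * t - real j"
    proof -
      show "real n * t' = real n * t - real j" unfolding t'_def using n by (simp add: algebra_simps)
      have "real j / real n \<le> t" using True n by (simp add: field_simps)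
      moreover have "0 \<le> real j / real n" by simp
      ultimately have "0 \<le> t'" "t' \<le> 1" unfolding t'_def using t unfolding atLeastAtMost_iff by linarith+
      then show "t' \<in> {0..1}" by simp
    qed
    have "rescaled \<sigma> s n t = rescaled \<sigma> s' n t'"
      unfolding rescaled_eq_interp[OF t] rescaled_eq_interp[OF t'] nt'
      using interp_shift[of s j s', OF s True nt(2)] by simp
    moreover have "\<bar>rescaled \<sigma> s' n t' - rescaled \<sigma> s' n t\<bar> \<le> w"
      unfolding w_def by (rule modulus_upper[OF cont t' t]) (simp add: t'_def)
    moreover have "0 \<le> 2 * A / c" using A0 c by simp
    ultimately show ?thesis by simp
  next
    case False
    then have fl: "nat \<lfloor>real n * t\<rfloor> < j" using nt by linarith
    have "\<bar>interp s n (real n * t)\<bar> \<le> A" by (rule abs_interp_le[OF nt A]) (use fl in auto)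
    then have 1: "\<bar>rescaled \<sigma> s n t\<bar> \<le> A / c"
      unfolding rescaled_eq_interp[OF t] c_def[symmetric] using c by (simp add: divide_right_mono)
    have "rescaled \<sigma> s' n 0 = s j / c"
      unfolding rescaled_def c_def using s[of 0] by simp
    then have 2: "\<bar>rescaled \<sigma> s' n 0\<bar> \<le> A / c" using A[of j] c by (simp add: divide_right_mono)
    have "t \<le> real j / real n" using False n by (simp add: field_simps)
    then have "\<bar>rescaled \<sigma> s' n 0 - rescaled \<sigma> s' n t\<bar> \<le> w"
      unfolding w_def using t by (intro modulus_upper[OF cont]) auto
    then show ?thesis using 1 2 by (simp add: add_divide_distrib[symmetric])
  qed
  then show "\<bar>rescaled \<sigma> s n t - rescaled \<sigma> s' n t\<bar> \<le> w + 2 * (\<Sum>i\<le>j. \<bar>s i\<bar>) / (\<sigma> * sqrt (real n))"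
    unfolding A_def c_def .
qed

lemma sqrt_mult_offset_tendsto:
  fixes a :: "nat \<Rightarrow> real"
  assumes "(\<lambda>n. sqrt (real n) * a n) \<longlonglongrightarrow> u"
  shows "(\<lambda>n. sqrt (real n) * a (n - j)) \<longlonglongrightarrow> u"
proof (rule LIMSEQ_offset[of _ j])
  have "(\<lambda>n. (sqrt (real n + real j) / sqrt (real n)) * (sqrt (real n) * a n)) \<longlonglongrightarrow> 1 * u"
    by (intro tendsto_mult assms) real_asymp
  moreover have "\<forall>\<^sub>F n in sequentially. (sqrt (real n + real j) / sqrt (real n)) * (sqrt (real n) * a n) = sqrt (real (n + j)) * a (n + j - j)"
    using eventually_gt_at_top[of 0] by eventually_elim simp
  ultimately show "(\<lambda>n. sqrt (real (n + j)) * a (n + j - j)) \<longlonglongrightarrow> u" by (simp add: tendsto_cong)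
qed

lemma (in prob_space) integral_uniform_measure:
  fixes f :: "'a \<Rightarrow> real"
  assumes A: "Measurable.pred M A" and pos: "0 < prob {\<omega>\<in>space M. A \<omega>}" and f: "f \<in> borel_measurable M"
  shows "(\<integral>\<omega>. f \<omega> \<partial>uniform_measure M {\<omega>\<in>space M. A \<omega>}) = (\<integral>\<omega>. of_bool (A \<omega>) * f \<omega> \<partial>M) / prob {\<omega>\<in>space M. A \<omega>}"
proof -
  let ?A = "{\<omega>\<in>space M. A \<omega>}"
  have Am: "?A \<in> events" using A by measurable
  have "uniform_measure M ?A = density M (\<lambda>\<omega>. ennreal (indicator ?A \<omega> / prob ?A))"
    unfolding uniform_measure_def
    by (intro arg_cong2[where f = density] refl ext)
       (auto simp: emeasure_eq_measure indicator_def divide_ennreal[symmetric] pos ennreal_1[symmetric] simp del: ennreal_1)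
  then have "(\<integral>\<omega>. f \<omega> \<partial>uniform_measure M ?A) = (\<integral>\<omega>. (indicator ?A \<omega> / prob ?A) *\<^sub>R f \<omega> \<partial>M)"
    using Am f by (simp only:) (subst integral_density; auto)
  also have "\<dots> = (\<integral>\<omega>. of_bool (A \<omega>) * f \<omega> / prob ?A \<partial>M)"
    by (intro Bochner_Integration.integral_cong) (auto simp: indicator_def)
  finally show ?thesis by simp
qed

context killed_walk
begin

lemma rescaled_measurable [measurable]:
  "(\<lambda>\<xi>. rescaled \<sigma> (wpath y \<xi>) n t) \<in> borel_measurable marks"
  unfolding rescaled_def Let_def by measurable

lemma functional_measurable:
  assumes F: "bcont_C01 F"
  shows "(\<lambda>\<xi>. F (rescaled \<sigma> (wpath y \<xi>) n)) \<in> borel_measurable marks"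
  by (rule bcont_C01_measurable[OF F continuous_on_rescaled rescaled_measurable])

lemma functional_measurable_M:
  assumes F: "bcont_C01 F"
  shows "(\<lambda>\<omega>. F (rescaled \<sigma> (wpath y (Xs \<omega>)) n)) \<in> borel_measurable M"
  by (rule measurable_compose[OF Xs_measurable functional_measurable[OF F]])

lemma integrable_alive_mult:
  assumes "f \<in> borel_measurable M" "\<And>\<omega>. \<bar>f \<omega>\<bar> \<le> (B::real)"
  shows "integrable M (\<lambda>\<omega>. of_bool (alive K (wpath y (Xs \<omega>)) 0 (U 0 \<omega>) n) * f \<omega>)"
proof -
  note [measurable] = assms(1)
  have "\<bar>of_bool P * f \<omega>\<bar> \<le> B" for P \<omega> using assms(2)[of \<omega>] abs_ge_zero[of "f \<omega>"] by (cases P) auto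
  then show ?thesis by (intro integrable_const_bound[of _ B]) auto
qed

text \<open>(C2) times (C4): a conditional expectation multiplied by the probability of its
  condition. As \<open>u > 0\<close>, the condition eventually has positive probability.\<close>

lemma excursion_conditional_limit:
  assumes C2: "(\<lambda>n. sqrt (real n) * g n y) \<longlonglongrightarrow> u" and u: "0 < u" and F: "bcont_C01 F"
    and conv: "law_conv_C01 (\<lambda>n. uniform_measure M {\<omega>\<in>space M. alive K (wpath y (Xs \<omega>)) 0 (U 0 \<omega>) n})
                 (\<lambda>n \<omega>. rescaled \<sigma> (wpath y (Xs \<omega>)) n) N W"
  shows "(\<lambda>n. sqrt (real n) * (\<integral>\<omega>. of_bool (alive K (wpath y (Xs \<omega>)) 0 (U 0 \<omega>) n) * F (rescaled \<sigma> (wpath y (Xs \<omega>)) n) \<partial>M))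
     \<longlonglongrightarrow> u * (\<integral>\<omega>. F (W \<omega>) \<partial>N)"
proof -
  let ?A = "\<lambda>n. {\<omega>\<in>space M. alive K (wpath y (Xs \<omega>)) 0 (U 0 \<omega>) n}"
  have "(\<lambda>n. (sqrt (real n) * g n y) * (\<integral>\<omega>. F (rescaled \<sigma> (wpath y (Xs \<omega>)) n) \<partial>uniform_measure M (?A n))) \<longlonglongrightarrow> u * (\<integral>\<omega>. F (W \<omega>) \<partial>N)"
    using conv F unfolding law_conv_C01_def by (intro tendsto_mult C2) auto
  moreover have "\<forall>\<^sub>F n in sequentially. (sqrt (real n) * g n y) * (\<integral>\<omega>. F (rescaled \<sigma> (wpath y (Xs \<omega>)) n) \<partial>uniform_measure M (?A n))
      = sqrt (real n) * (\<integral>\<omega>. of_bool (alive K (wpath y (Xs \<omega>)) 0 (U 0 \<omega>) n) * F (rescaled \<sigma> (wpath y (Xs \<omega>)) n) \<partial>M)"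
    using order_tendstoD(1)[OF C2 u]
  proof eventually_elim
    case (elim n)
    then have "g n y \<noteq> 0" by auto
    then have pos: "0 < g n y" using g_bounds(1)[of n y] by simp
    then show ?case
      by (subst integral_uniform_measure[OF pred_alive_M _ functional_measurable_M[OF F]]) (auto simp: g_eq_prob)
  qed
  ultimately show ?thesis by (simp add: tendsto_cong)
qed

text \<open>Differs from \<open>excursion_conditional_limit\<close> in two ways: the excursion lasts
  \<open>n - j\<close> steps while the scaling uses \<open>n\<close>, and the path carries the
  initial piece \<open>\<xi>\<close>. Both effects vanish for fixed \<open>j\<close>.\<close>

lemma excursion_limit:
  fixes \<xi> :: "nat \<Rightarrow> real" and x :: real and j :: nat
  defines "y \<equiv> wpath x \<xi> j"
  assumes F: "lip_C01 F B L" and L: "0 \<le> L" and W: "cont_process N W"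
    and C2: "(\<lambda>n. sqrt (real n) * g n y) \<longlonglongrightarrow> u" and u: "0 \<le> u"
    and conv: "0 < u \<Longrightarrow> law_conv_C01 (\<lambda>n. uniform_measure M {\<omega>\<in>space M. alive K (wpath y (Xs \<omega>)) 0 (U 0 \<omega>) n})
                 (\<lambda>n \<omega>. rescaled \<sigma> (wpath y (Xs \<omega>)) n) N W"
  shows "(\<lambda>n. sqrt (real n) * (\<integral>\<omega>. of_bool (alive K (wpath y (Xs \<omega>)) 0 (U 0 \<omega>) (n - j)) *
            F (rescaled \<sigma> (wpath x (comb_seq j \<xi> (Xs \<omega>))) n) \<partial>M)) \<longlonglongrightarrow> u * (\<integral>\<omega>. F (W \<omega>) \<partial>N)"
proof -
  interpret N: prob_space N using W by (simp add: cont_process_def)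
  note bF = lip_C01_bcont[OF F]
  let ?a = "\<lambda>n \<omega>. of_bool (alive K (wpath y (Xs \<omega>)) 0 (U 0 \<omega>) n) :: real"
  let ?s = "\<lambda>\<omega>. wpath x (comb_seq j \<xi> (Xs \<omega>))" and ?s' = "\<lambda>\<omega>. wpath y (Xs \<omega>)"
  have B: "\<bar>F (rescaled \<sigma> s n)\<bar> \<le> B" for s n
    using F continuous_on_rescaled[of \<sigma> s n] unfolding lip_C01_def by blast
  have B0: "0 \<le> B" using B[of undefined undefined] by linarith
  have m1: "(\<lambda>\<omega>. F (rescaled \<sigma> (?s \<omega>) n)) \<in> borel_measurable M" for n
  proof (rule measurable_compose[OF _ functional_measurable[OF bF]])
    show "(\<lambda>\<omega>. comb_seq j \<xi> (Xs \<omega>)) \<in> measurable M marks"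
      by (intro measurable_comb_seq' measurable_const Xs_measurable) (simp add: space_PiM)
  qed
  note m2 = functional_measurable_M[OF bF]
  have I1: "integrable M (\<lambda>\<omega>. ?a k \<omega> * F (rescaled \<sigma> (?s \<omega>) n))" for k n
    by (rule integrable_alive_mult[OF m1 B])
  have I2: "integrable M (\<lambda>\<omega>. ?a k \<omega> * F (rescaled \<sigma> (?s' \<omega>) n))" for k n
    by (rule integrable_alive_mult[OF m2 B])
  have lim_j: "(\<lambda>n. sqrt (real n) * g (n - j) y) \<longlonglongrightarrow> u" by (rule sqrt_mult_offset_tendsto[OF C2])
  show ?thesis
  proof (cases "u = 0")
    \<comment> \<open>For such \<open>y\<close> (C4) says nothing, but the weight itself tends to
      zero.\<close>
    case True
    have "(\<lambda>n. sqrt (real n) * (\<integral>\<omega>. ?a (n - j) \<omega> * F (rescaled \<sigma> (?s \<omega>) n) \<partial>M)) \<longlonglongrightarrow> 0"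
    proof (rule tendsto_rabs_zero_cancel, rule tendsto_sandwich[OF _ _ tendsto_const])
      show "(\<lambda>n. B * (sqrt (real n) * g (n - j) y)) \<longlonglongrightarrow> 0"
        using tendsto_mult_right_zero[of "\<lambda>n. sqrt (real n) * g (n - j) y" sequentially B] lim_j True by simp
      show "\<forall>\<^sub>F n in sequentially. \<bar>sqrt (real n) * (\<integral>\<omega>. ?a (n - j) \<omega> * F (rescaled \<sigma> (?s \<omega>) n) \<partial>M)\<bar> \<le> B * (sqrt (real n) * g (n - j) y)"
      proof (intro always_eventually allI)
        fix n
        have "\<bar>\<integral>\<omega>. ?a (n - j) \<omega> * F (rescaled \<sigma> (?s \<omega>) n) \<partial>M\<bar> \<le> (\<integral>\<omega>. \<bar>?a (n - j) \<omega> * F (rescaled \<sigma> (?s \<omega>) n)\<bar> \<partial>M)"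
          by (rule integral_abs_bound)
        also have "\<dots> \<le> (\<integral>\<omega>. B * ?a (n - j) \<omega> \<partial>M)"
          by (intro integral_mono integrable_abs I1 integrable_mult_right integrable_alive) (use B in auto)
        also have "\<dots> = B * g (n - j) y" by (simp add: g_def)
        finally have "\<bar>\<integral>\<omega>. ?a (n - j) \<omega> * F (rescaled \<sigma> (?s \<omega>) n) \<partial>M\<bar> \<le> B * g (n - j) y" .
        from mult_left_mono[OF this, of "sqrt (real n)"]
        show "\<bar>sqrt (real n) * (\<integral>\<omega>. ?a (n - j) \<omega> * F (rescaled \<sigma> (?s \<omega>) n) \<partial>M)\<bar> \<le> B * (sqrt (real n) * g (n - j) y)"
          by (simp add: abs_mult mult.left_commute)
      qed
    qed auto
    then show ?thesis using True by simp
  next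
    case False
    then have up: "0 < u" using u by simp
    note cl = excursion_conditional_limit[OF C2 up _ conv[OF up]]
    define A where "A = (\<Sum>i\<le>j. \<bar>wpath x \<xi> i\<bar>)"
    define H where "H m f = min (2 * B) (L * modulus f (1 / real (Suc m)))" for m and f :: "real \<Rightarrow> real"
    have lH: "lip_C01 (H m) (2 * B) (2 * L)" for m
      unfolding H_def using lip_modulus[of "2 * B" L "1 / real (Suc m)"] B0 L by simp
    note bH = lip_C01_bcont[OF lH]
    have HB: "\<bar>H m (rescaled \<sigma> s n)\<bar> \<le> 2 * B" for m s n
      using lH[of m] continuous_on_rescaled[of \<sigma> s n] unfolding lip_C01_def by blast
    have IH: "integrable M (\<lambda>\<omega>. ?a k \<omega> * H m (rescaled \<sigma> (?s' \<omega>) n))" for k m n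
      by (rule integrable_alive_mult[OF functional_measurable_M[OF bH] HB])
    have Y: "\<And>\<omega>. \<omega> \<in> space N \<Longrightarrow> continuous_on {0..1} (W \<omega>)" "\<And>t. t \<in> {0..1} \<Longrightarrow> (\<lambda>\<omega>. W \<omega> t) \<in> borel_measurable N"
      using W by (auto simp: cont_process_def)
    have "(\<lambda>m. \<integral>\<omega>. H m (W \<omega>) \<partial>N) \<longlonglongrightarrow> (\<integral>\<omega>. 0 \<partial>N)"
    proof (rule integral_dominated_convergence[where w = "\<lambda>_. 2 * B"])
      show "(\<lambda>\<omega>. H m (W \<omega>)) \<in> borel_measurable N" for m by (rule bcont_C01_measurable[OF bH Y])
      show "AE \<omega> in N. (\<lambda>m. H m (W \<omega>)) \<longlonglongrightarrow> 0"
      proof (rule AE_I2)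
        fix \<omega> assume "\<omega> \<in> space N"
        then have "(\<lambda>m. min (2 * B) (L * modulus (W \<omega>) (1 / real (Suc m)))) \<longlonglongrightarrow> min (2 * B) (L * 0)"
          by (intro tendsto_intros modulus_tendsto_0 Y)
        then show "(\<lambda>m. H m (W \<omega>)) \<longlonglongrightarrow> 0" using B0 by (simp add: H_def)
      qed
      show "AE \<omega> in N. norm (H m (W \<omega>)) \<le> 2 * B" for m
        using lH[of m] Y(1) unfolding lip_C01_def by auto
    qed auto
    then have Hlim: "(\<lambda>m. u * (\<integral>\<omega>. H m (W \<omega>) \<partial>N)) \<longlonglongrightarrow> 0" using tendsto_mult_right_zero by force
    have diff: "(\<lambda>n. sqrt (real n) * (\<integral>\<omega>. ?a (n - j) \<omega> * F (rescaled \<sigma> (?s \<omega>) n) \<partial>M)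
        - sqrt (real n) * (\<integral>\<omega>. ?a n \<omega> * F (rescaled \<sigma> (?s' \<omega>) n) \<partial>M)) \<longlonglongrightarrow> 0"
    proof (rule LIMSEQ_I)
      fix e :: real assume e: "0 < e"
      have "\<forall>\<^sub>F m in sequentially. u * (\<integral>\<omega>. H m (W \<omega>) \<partial>N) < e" using Hlim e by (rule order_tendstoD)
      then obtain m where m: "u * (\<integral>\<omega>. H m (W \<omega>) \<partial>N) < e" using eventually_happens'[OF sequentially_bot] by blast
      let ?c = "\<lambda>n. L * (2 * A / (\<sigma> * sqrt (real n)))"
      \<comment> \<open>Three errors: excursions that survive \<open>n - j\<close> but not
        \<open>n\<close> steps; the time shift, measured by the truncated modulus; and the positions
        up to time \<open>j\<close>, of size \<open>A\<close> before scaling. The first and third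
        vanish as \<open>n\<close> grows, the second is small by the choice of
        \<open>m\<close>.\<close>
      let ?r = "\<lambda>n. B * (sqrt (real n) * g (n - j) y - sqrt (real n) * g n y)
          + (sqrt (real n) * (\<integral>\<omega>. ?a n \<omega> * H m (rescaled \<sigma> (?s' \<omega>) n) \<partial>M) + ?c n * (sqrt (real n) * g n y))"
      have c0: "?c \<longlonglongrightarrow> 0" using \<sigma>_pos by real_asymp
      have "?r \<longlonglongrightarrow> B * (u - u) + (u * (\<integral>\<omega>. H m (W \<omega>) \<partial>N) + 0 * u)"
        by (intro tendsto_intros lim_j C2 cl bH c0)
      then have "\<forall>\<^sub>F n in sequentially. ?r n < e" using m by (intro order_tendstoD) auto
      moreover have "\<forall>\<^sub>F n in sequentially. \<bar>sqrt (real n) * (\<integral>\<omega>. ?a (n - j) \<omega> * F (rescaled \<sigma> (?s \<omega>) n) \<partial>M)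
          - sqrt (real n) * (\<integral>\<omega>. ?a n \<omega> * F (rescaled \<sigma> (?s' \<omega>) n) \<partial>M)\<bar> \<le> ?r n"
        using eventually_ge_at_top[of "Suc j * Suc m"]
      proof eventually_elim
        case (elim n)
        \<comment> \<open>From \<open>n \<ge> (j + 1) * (m + 1)\<close>: \<open>n\<close> is
          positive and \<open>j / n \<le> 1 / (m + 1)\<close>, so the modulus in \<open>H m\<close>
          covers the shift.\<close>
        have n0: "0 < n" using elim by auto
        have "j * Suc m \<le> n" using elim by simp
        then have "real j * real (Suc m) \<le> real n" unfolding of_nat_mult[symmetric] of_nat_le_iff .
        then have jn: "real j / real n \<le> 1 / real (Suc m)" using n0 by (simp add: field_simps del: of_nat_Suc)
        have c_nn: "0 \<le> ?c n" using L \<sigma>_pos unfolding A_def by (intro mult_nonneg_nonneg divide_nonneg_nonneg sum_nonneg) auto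
        have pt: "\<bar>F (rescaled \<sigma> (?s \<omega>) n) - F (rescaled \<sigma> (?s' \<omega>) n)\<bar> \<le> H m (rescaled \<sigma> (?s' \<omega>) n) + ?c n" for \<omega>
        proof -
          define d where "d = dist01 (rescaled \<sigma> (?s \<omega>) n) (rescaled \<sigma> (?s' \<omega>) n)"
          have "d \<le> modulus (rescaled \<sigma> (?s' \<omega>) n) (real j / real n) + 2 * (\<Sum>i\<le>j. \<bar>?s \<omega> i\<bar>) / (\<sigma> * sqrt (real n))"
            unfolding d_def by (rule dist01_rescaled_shift) (use n0 \<sigma>_pos in \<open>auto simp: y_def wpath_comb_add\<close>)
          also have "(\<Sum>i\<le>j. \<bar>?s \<omega> i\<bar>) = A" unfolding A_def by (intro sum.cong) (auto simp: wpath_comb_le)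
          finally have "d \<le> modulus (rescaled \<sigma> (?s' \<omega>) n) (1 / real (Suc m)) + 2 * A / (\<sigma> * sqrt (real n))"
            using modulus_mono[OF continuous_on_rescaled[of \<sigma> "?s' \<omega>" n] _ jn] by simp
          then have "L * d \<le> L * (modulus (rescaled \<sigma> (?s' \<omega>) n) (1 / real (Suc m)) + 2 * A / (\<sigma> * sqrt (real n)))"
            using L by (rule mult_left_mono)
          moreover have "\<bar>F (rescaled \<sigma> (?s \<omega>) n) - F (rescaled \<sigma> (?s' \<omega>) n)\<bar> \<le> L * d"
            unfolding d_def using F continuous_on_rescaled unfolding lip_C01_def by blast
          ultimately have "\<bar>F (rescaled \<sigma> (?s \<omega>) n) - F (rescaled \<sigma> (?s' \<omega>) n)\<bar> \<le> L * modulus (rescaled \<sigma> (?s' \<omega>) n) (1 / real (Suc m)) + ?c n"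
            by (simp only: distrib_left)
          moreover have "\<bar>F (rescaled \<sigma> (?s \<omega>) n) - F (rescaled \<sigma> (?s' \<omega>) n)\<bar> \<le> 2 * B + ?c n"
            using B[of "?s \<omega>" n] B[of "?s' \<omega>" n] c_nn by linarith
          ultimately show ?thesis unfolding H_def by (simp add: min_def)
        qed
        have split: "\<bar>?a (n - j) \<omega> * F (rescaled \<sigma> (?s \<omega>) n) - ?a n \<omega> * F (rescaled \<sigma> (?s' \<omega>) n)\<bar>
            \<le> B * (?a (n - j) \<omega> - ?a n \<omega>) + (?a n \<omega> * H m (rescaled \<sigma> (?s' \<omega>) n) + ?c n * ?a n \<omega>)" for \<omega>
        proof (cases "alive K (?s' \<omega>) 0 (U 0 \<omega>) n")
          case True
          then have "alive K (?s' \<omega>) 0 (U 0 \<omega>) (n - j)" by (rule alive_antimono) simp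
          then show ?thesis using True pt[of \<omega>] by simp
        next
          case False
          then show ?thesis using B[of "?s \<omega>" n] by (cases "alive K (?s' \<omega>) 0 (U 0 \<omega>) (n - j)") auto
        qed
        have "\<bar>(\<integral>\<omega>. ?a (n - j) \<omega> * F (rescaled \<sigma> (?s \<omega>) n) \<partial>M) - (\<integral>\<omega>. ?a n \<omega> * F (rescaled \<sigma> (?s' \<omega>) n) \<partial>M)\<bar>
            = \<bar>\<integral>\<omega>. ?a (n - j) \<omega> * F (rescaled \<sigma> (?s \<omega>) n) - ?a n \<omega> * F (rescaled \<sigma> (?s' \<omega>) n) \<partial>M\<bar>"
          by (simp only: Bochner_Integration.integral_diff[OF I1 I2])
        also have "\<dots> \<le> (\<integral>\<omega>. \<bar>?a (n - j) \<omega> * F (rescaled \<sigma> (?s \<omega>) n) - ?a n \<omega> * F (rescaled \<sigma> (?s' \<omega>) n)\<bar> \<partial>M)"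
          by (rule integral_abs_bound)
        also have "\<dots> \<le> (\<integral>\<omega>. B * (?a (n - j) \<omega> - ?a n \<omega>) + (?a n \<omega> * H m (rescaled \<sigma> (?s' \<omega>) n) + ?c n * ?a n \<omega>) \<partial>M)"
          by (rule integral_mono[OF _ _ split])
             (intro integrable_abs Bochner_Integration.integrable_add Bochner_Integration.integrable_diff integrable_mult_right I1 I2 IH integrable_alive)+
        also have "\<dots> = B * (g (n - j) y - g n y) + ((\<integral>\<omega>. ?a n \<omega> * H m (rescaled \<sigma> (?s' \<omega>) n) \<partial>M) + ?c n * g n y)"
          unfolding g_def using integrable_alive[of y n] integrable_alive[of y "n - j"] IH[of n m n] by simp
        finally have "sqrt (real n) * \<bar>(\<integral>\<omega>. ?a (n - j) \<omega> * F (rescaled \<sigma> (?s \<omega>) n) \<partial>M) - (\<integral>\<omega>. ?a n \<omega> * F (rescaled \<sigma> (?s' \<omega>) n) \<partial>M)\<bar>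
            \<le> sqrt (real n) * (B * (g (n - j) y - g n y) + ((\<integral>\<omega>. ?a n \<omega> * H m (rescaled \<sigma> (?s' \<omega>) n) \<partial>M) + ?c n * g n y))"
          by (rule mult_left_mono) simp
        also have "\<dots> = ?r n" by (simp only: distrib_left right_diff_distrib mult.left_commute)
        finally show ?case by (simp only: right_diff_distrib[symmetric] abs_mult) simp
      qed
      ultimately have "\<forall>\<^sub>F n in sequentially. norm (sqrt (real n) * (\<integral>\<omega>. ?a (n - j) \<omega> * F (rescaled \<sigma> (?s \<omega>) n) \<partial>M)
          - sqrt (real n) * (\<integral>\<omega>. ?a n \<omega> * F (rescaled \<sigma> (?s' \<omega>) n) \<partial>M) - 0) < e"
        by eventually_elim simp
      then show "\<exists>n0. \<forall>n\<ge>n0. norm (sqrt (real n) * (\<integral>\<omega>. ?a (n - j) \<omega> * F (rescaled \<sigma> (?s \<omega>) n) \<partial>M)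
          - sqrt (real n) * (\<integral>\<omega>. ?a n \<omega> * F (rescaled \<sigma> (?s' \<omega>) n) \<partial>M) - 0) < e" by (simp only: eventually_sequentially)
    qed
    from tendsto_add[OF diff cl[OF bF]] show ?thesis by simp
  qed
qed

end

section \<open>Summation over the crossings\<close>

text \<open>Dominated convergence for iterated series, as two applications of Tannery's
  theorem.\<close>

lemma double_tannery:
  fixes a :: "nat \<Rightarrow> nat \<Rightarrow> nat \<Rightarrow> real"
  assumes lim: "\<And>k j. (\<lambda>n. a k j n) \<longlonglongrightarrow> b k j" and bnd: "\<And>k j n. \<bar>a k j n\<bar> \<le> m k j"
    and m: "\<And>k. summable (m k)" "summable (\<lambda>k. \<Sum>j. m k j)"
  shows "(\<lambda>n. \<Sum>k. \<Sum>j. a k j n) \<longlonglongrightarrow> (\<Sum>k. \<Sum>j. b k j)"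
proof -
  have 1: "(\<lambda>n. \<Sum>j. a k j n) \<longlonglongrightarrow> (\<Sum>j. b k j)" for k
    using tannerys_theorem[of "\<lambda>j n. a k j n" "b k" sequentially "m k"] lim bnd m(1)
    by (auto intro!: always_eventually)
  have 2: "\<bar>\<Sum>j. a k j n\<bar> \<le> (\<Sum>j. m k j)" for k n
  proof -
    have s: "summable (\<lambda>j. norm (a k j n))" by (rule summable_comparison_test'[OF m(1)[of k]]) (use bnd in auto)
    have "norm (\<Sum>j. a k j n) \<le> (\<Sum>j. norm (a k j n))" by (rule summable_norm[OF s])
    also have "\<dots> \<le> (\<Sum>j. m k j)" using bnd by (intro suminf_le s m) auto
    finally show ?thesis by simp
  qed
  show ?thesis
    using tannerys_theorem[of "\<lambda>k n. \<Sum>j. a k j n" "\<lambda>k. \<Sum>j. b k j" sequentially "\<lambda>k. \<Sum>j. m k j"] 1 2 m(2)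
    by (auto intro!: always_eventually)
qed

lemma suminf_square:
  fixes f :: "nat \<Rightarrow> nat \<Rightarrow> real"
  shows "(\<Sum>k. \<Sum>j. if k < n \<and> j < n then f k j else 0) = (\<Sum>k<n. \<Sum>j<n. f k j)"
proof -
  have "(\<Sum>j. if k < n \<and> j < n then f k j else 0) = (if k < n then \<Sum>j<n. f k j else 0)" for k
    using suminf_finite[of "{..<n}" "\<lambda>j. if k < n \<and> j < n then f k j else 0"] by auto
  then show ?thesis
    using suminf_finite[of "{..<n}" "\<lambda>k. if k < n then \<Sum>j<n. f k j else 0"] by auto
qed

context killed_walk
begin

text \<open>\<open>mom\<close> is what \<open>reach_moments\<close> provides for the starting point
  \<open>x\<close>; the dominating series below are built from it.\<close>

context
  fixes x :: real and u :: "real \<Rightarrow> real" and B0 l :: real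
  assumes C2: "\<And>y. (\<lambda>n. sqrt (real n) * g n y) \<longlonglongrightarrow> u y"
    and B0: "0 \<le> B0" and l: "0 < l" "l < 1"
    and mom: "\<And>k n. (\<Sum>j\<le>n. \<integral>\<omega>. of_bool (R x k j \<omega>) * (1 + \<bar>S x \<omega> j\<bar>) \<partial>M) \<le> B0 * l ^ k"
begin

definition moment :: "nat \<Rightarrow> nat \<Rightarrow> real" where
  "moment k j = (\<integral>\<omega>. of_bool (R x k j \<omega>) * (1 + \<bar>S x \<omega> j\<bar>) \<partial>M)"

definition Lw :: "(real \<Rightarrow> real) \<Rightarrow> nat \<Rightarrow> nat \<Rightarrow> real" where
  "Lw \<phi> k j = (\<integral>\<omega>. of_bool (R x k j \<omega>) * \<phi> (S x \<omega> j) \<partial>M)"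

definition upos :: "real \<Rightarrow> real" where
  "upos y = (if 0 \<le> y then u y else 0)"

lemma u_measurable [measurable]: "u \<in> borel_measurable borel"
  by (rule borel_measurable_LIMSEQ_real[of borel "\<lambda>n y. sqrt (real n) * g n y"]) (use C2 in auto)

lemma upos_measurable [measurable]: "upos \<in> borel_measurable borel"
  unfolding upos_def[abs_def] by measurable

lemma u_nonneg: "0 \<le> u y"
  by (rule LIMSEQ_le_const[OF C2]) (use g_bounds in auto)

lemma u_bound: "\<exists>C\<ge>0. \<forall>y. u y \<le> C * (1 + \<bar>y\<bar>)"
proof -
  obtain C where C: "0 \<le> C" "\<And>n y. sqrt (real n) * g n y \<le> C * (1 + \<bar>y\<bar>)" using g_sqrt_bound by blast
  have "u y \<le> C * (1 + \<bar>y\<bar>)" for y by (rule LIMSEQ_le_const2[OF C2]) (use C in auto)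
  then show ?thesis using C(1) by blast
qed

lemma integrable_moment: "integrable M (\<lambda>\<omega>. of_bool (R x k j \<omega>) * (1 + \<bar>S x \<omega> j\<bar>))"
  unfolding distrib_left by (intro Bochner_Integration.integrable_add integrable_reach_abs) (simp add: integrable_reach)

lemma moment_nonneg: "0 \<le> moment k j"
  unfolding moment_def by (intro Bochner_Integration.integral_nonneg) auto

lemma summable_moment: "summable (moment k)" and suminf_moment: "(\<Sum>j. moment k j) \<le> B0 * l ^ k"
proof -
  have b: "(\<Sum>j<n. moment k j) \<le> B0 * l ^ k" for n
  proof -
    have "(\<Sum>j<n. moment k j) \<le> (\<Sum>j\<le>n. moment k j)" using moment_nonneg by (intro sum_mono2) auto
    then show ?thesis using mom[of k n] unfolding moment_def by simp
  qed
  show s: "summable (moment k)" by (rule summableI_nonneg_bounded[OF moment_nonneg b])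
  show "(\<Sum>j. moment k j) \<le> B0 * l ^ k" by (rule suminf_le_const[OF s b])
qed

lemma summable_moments: "summable (\<lambda>k. C * (\<Sum>j. moment k j))"
proof (rule summable_mult, rule summable_comparison_test'[of "\<lambda>k. B0 * l ^ k" 0])
  show "summable (\<lambda>k. B0 * l ^ k)" using l by (intro summable_mult summable_geometric) auto
  show "norm (\<Sum>j. moment k j) \<le> B0 * l ^ k" for k
    using suminf_moment[of k] suminf_nonneg[OF summable_moment[of k] moment_nonneg] by simp
qed

lemma double_tannery_moment:
  assumes "\<And>k j. (\<lambda>n. a k j n) \<longlonglongrightarrow> b k j" "\<And>k j n. \<bar>a k j n\<bar> \<le> C * moment k j"
  shows "(\<lambda>n. \<Sum>k. \<Sum>j. a k j n) \<longlonglongrightarrow> (\<Sum>k. \<Sum>j. b k j)"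
proof (rule double_tannery[OF assms])
  show "summable (\<lambda>j. C * moment k j)" for k by (intro summable_mult summable_moment)
  show "summable (\<lambda>k. \<Sum>j. C * moment k j)" using summable_moments[of C] by (simp add: suminf_mult[OF summable_moment])
qed

context
  fixes \<phi> :: "real \<Rightarrow> real" and C :: real
  assumes \<phi>_meas [measurable]: "\<phi> \<in> borel_measurable borel" and C: "0 \<le> C" and \<phi>: "\<And>y. \<bar>\<phi> y\<bar> \<le> C * (1 + \<bar>y\<bar>)"
begin

lemma reach_weight_bound: "\<bar>of_bool (R x k j \<omega>) * \<phi> (S x \<omega> j)\<bar> \<le> C * (of_bool (R x k j \<omega>) * (1 + \<bar>S x \<omega> j\<bar>))"
  using \<phi>[of "S x \<omega> j"] by (cases "R x k j \<omega>") auto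

lemma integrable_reach_weight: "integrable M (\<lambda>\<omega>. of_bool (R x k j \<omega>) * \<phi> (S x \<omega> j))"
proof (rule Bochner_Integration.integrable_bound[OF integrable_mult_right[OF integrable_moment, of C k j]])
  show "AE \<omega> in M. norm (of_bool (R x k j \<omega>) * \<phi> (S x \<omega> j)) \<le> norm (C * (of_bool (R x k j \<omega>) * (1 + \<bar>S x \<omega> j\<bar>)))"
    by (rule AE_I2) (simp only: real_norm_def, rule order_trans[OF reach_weight_bound abs_ge_self])
qed measurable

lemma integral_abs_reach_weight: "(\<integral>\<omega>. \<bar>of_bool (R x k j \<omega>) * \<phi> (S x \<omega> j)\<bar> \<partial>M) \<le> C * moment k j"
  unfolding moment_def integral_mult_right_zero[symmetric]
  by (rule integral_mono[OF integrable_abs[OF integrable_reach_weight] integrable_mult_right[OF integrable_moment] reach_weight_bound])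

lemma abs_Lw_le: "\<bar>Lw \<phi> k j\<bar> \<le> C * moment k j"
  unfolding Lw_def by (rule order_trans[OF integral_abs_bound integral_abs_reach_weight])

lemma Lw_square_tendsto: "(\<lambda>n. \<Sum>k<n. \<Sum>j<n. Lw \<phi> k j) \<longlonglongrightarrow> (\<Sum>k. \<Sum>j. Lw \<phi> k j)"
proof -
  have "(\<lambda>n. \<Sum>k. \<Sum>j. if k < n \<and> j < n then Lw \<phi> k j else 0) \<longlonglongrightarrow> (\<Sum>k. \<Sum>j. Lw \<phi> k j)"
  proof (rule double_tannery_moment)
    fix k j
    show "(\<lambda>n. if k < n \<and> j < n then Lw \<phi> k j else 0) \<longlonglongrightarrow> Lw \<phi> k j"
      by (rule tendsto_eventually) (use eventually_gt_at_top[of "max k j"] in eventually_elim, auto)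
    show "\<bar>if k < n \<and> j < n then Lw \<phi> k j else 0\<bar> \<le> C * moment k j" for n
      using abs_Lw_le[of k j] moment_nonneg[of k j] C by auto
  qed
  then show ?thesis by (simp only: suminf_square)
qed

text \<open>For each path at most one \<open>j\<close> contributes, and none if the crossing time is
  infinite or lies after absorption. This turns the expectations in the theorem into series over
  deterministic times.\<close>

lemma integral_at_crossing:
  "(\<integral>\<omega>. (if zc_time (wpath x (Xs \<omega>)) k < \<infinity> \<and> zc_time (wpath x (Xs \<omega>)) k \<le> absorb_time (wpath x (Xs \<omega>)) (Us \<omega>) K
          then \<phi> (S x \<omega> (the_enat (zc_time (wpath x (Xs \<omega>)) k))) else 0) \<partial>M) = (\<Sum>j. Lw \<phi> k j)"
proof -
  have sums: "(\<lambda>j. of_bool (R x k j \<omega>) * \<phi> (S x \<omega> j)) sums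
      (if zc_time (wpath x (Xs \<omega>)) k < \<infinity> \<and> zc_time (wpath x (Xs \<omega>)) k \<le> absorb_time (wpath x (Xs \<omega>)) (Us \<omega>) K
          then \<phi> (S x \<omega> (the_enat (zc_time (wpath x (Xs \<omega>)) k))) else 0)" for \<omega>
  proof (cases "\<exists>j. R x k j \<omega>")
    case True
    then obtain j where j: "R x k j \<omega>" by blast
    have iff: "R x k i \<omega> \<longleftrightarrow> i = j" for i using reach_unique[OF j] j by blast
    have "(\<lambda>i. of_bool (R x k i \<omega>) * \<phi> (S x \<omega> i)) = (\<lambda>i. if i = j then \<phi> (S x \<omega> i) else 0)"
      unfolding iff by (rule ext) simp
    moreover have "zc_time (wpath x (Xs \<omega>)) k = enat j" "enat j \<le> absorb_time (wpath x (Xs \<omega>)) (Us \<omega>) K"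
      using j by (auto simp: reach_iff)
    ultimately show ?thesis using sums_single[of j "\<lambda>i. \<phi> (S x \<omega> i)"] by simp
  next
    case False
    then have no: "\<not> (zc_time (wpath x (Xs \<omega>)) k < \<infinity> \<and> zc_time (wpath x (Xs \<omega>)) k \<le> absorb_time (wpath x (Xs \<omega>)) (Us \<omega>) K)"
      by (cases "zc_time (wpath x (Xs \<omega>)) k") (auto simp: reach_iff)
    have "(\<lambda>i. of_bool (R x k i \<omega>) * \<phi> (S x \<omega> i)) = (\<lambda>_. 0)" using False by auto
    then show ?thesis unfolding if_not_P[OF no] by simp
  qed
  have fin: "summable (\<lambda>j. norm (of_bool (R x k j \<omega>) * \<phi> (S x \<omega> j)))" for \<omega>
  proof (cases "\<exists>j. R x k j \<omega>")
    case True
    then obtain j where j: "R x k j \<omega>" by blast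
    have iff: "R x k i \<omega> \<longleftrightarrow> i = j" for i using reach_unique[OF j] j by blast
    have "(\<lambda>i. norm (of_bool (R x k i \<omega>) * \<phi> (S x \<omega> i))) = (\<lambda>i. if i = j then norm (\<phi> (S x \<omega> i)) else 0)"
      unfolding iff by (rule ext) simp
    then show ?thesis using sums_single[of j "\<lambda>i. norm (\<phi> (S x \<omega> i))"] by (simp add: sums_iff)
  qed auto
  have "(\<integral>\<omega>. (\<Sum>j. of_bool (R x k j \<omega>) * \<phi> (S x \<omega> j)) \<partial>M) = (\<Sum>j. Lw \<phi> k j)"
    unfolding Lw_def
  proof (rule integral_suminf)
    show "summable (\<lambda>j. \<integral>\<omega>. norm (of_bool (R x k j \<omega>) * \<phi> (S x \<omega> j)) \<partial>M)"
    proof (rule summable_comparison_test'[of "\<lambda>j. C * moment k j" 0])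
      show "summable (\<lambda>j. C * moment k j)" by (intro summable_mult summable_moment)
      show "norm (\<integral>\<omega>. norm (of_bool (R x k j \<omega>) * \<phi> (S x \<omega> j)) \<partial>M) \<le> C * moment k j" for j
        using integral_abs_reach_weight[of k j] by simp
    qed
    show "AE \<omega> in M. summable (\<lambda>j. norm (of_bool (R x k j \<omega>) * \<phi> (S x \<omega> j)))" by (rule AE_I2) (rule fin)
  qed (rule integrable_reach_weight)
  then show ?thesis unfolding sums_unique[OF sums, symmetric] .
qed

end

lemma upos_bound:
  assumes "\<And>y. \<bar>u y\<bar> \<le> C * (1 + \<bar>y\<bar>)" shows "\<bar>upos y\<bar> \<le> C * (1 + \<bar>y\<bar>)"
  using assms[of y] unfolding upos_def by (auto intro: order_trans[OF abs_ge_zero])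

definition Vtot :: real where "Vtot = (\<Sum>k. \<Sum>j. Lw u k j)"
definition Vplus :: real where "Vplus = (\<Sum>k. \<Sum>j. Lw upos k j)"

lemma Lw_tendsto:
  "(\<lambda>n. \<Sum>k<n. \<Sum>j<n. Lw u k j) \<longlonglongrightarrow> Vtot" "(\<lambda>n. \<Sum>k<n. \<Sum>j<n. Lw upos k j) \<longlonglongrightarrow> Vplus"
proof -
  obtain C where C: "0 \<le> C" "\<And>y. u y \<le> C * (1 + \<bar>y\<bar>)" using u_bound by blast
  then have b: "\<And>y. \<bar>u y\<bar> \<le> C * (1 + \<bar>y\<bar>)" using u_nonneg by simp
  show "(\<lambda>n. \<Sum>k<n. \<Sum>j<n. Lw u k j) \<longlonglongrightarrow> Vtot"
    unfolding Vtot_def by (rule Lw_square_tendsto[OF u_measurable C(1) b])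
  show "(\<lambda>n. \<Sum>k<n. \<Sum>j<n. Lw upos k j) \<longlonglongrightarrow> Vplus"
    unfolding Vplus_def by (rule Lw_square_tendsto[OF upos_measurable C(1) upos_bound[OF b]])
qed

lemma Lw_order: "0 \<le> Lw upos k j" "Lw upos k j \<le> Lw u k j"
proof -
  obtain C where C: "0 \<le> C" "\<And>y. u y \<le> C * (1 + \<bar>y\<bar>)" using u_bound by blast
  then have b: "\<And>y. \<bar>u y\<bar> \<le> C * (1 + \<bar>y\<bar>)" using u_nonneg by simp
  show "0 \<le> Lw upos k j" unfolding Lw_def using u_nonneg by (intro Bochner_Integration.integral_nonneg) (auto simp: upos_def)
  show "Lw upos k j \<le> Lw u k j" unfolding Lw_def
    by (intro integral_mono integrable_reach_weight[OF u_measurable C(1) b] integrable_reach_weight[OF upos_measurable C(1) upos_bound[OF b]])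
       (use u_nonneg in \<open>auto simp: upos_def\<close>)
qed

lemma V_order: "0 \<le> Vplus" "Vplus \<le> Vtot"
proof -
  show "0 \<le> Vplus" by (rule LIMSEQ_le_const[OF Lw_tendsto(2)]) (use Lw_order in \<open>auto intro!: sum_nonneg\<close>)
  show "Vplus \<le> Vtot" by (rule LIMSEQ_le[OF Lw_tendsto(2,1)]) (use Lw_order in \<open>auto intro!: sum_mono\<close>)
qed

text \<open>Summed over \<open>n\<close>, the excursions after a crossing at \<open>j\<close>
  contribute a partial sum of \<open>g\<close>, which \<open>sum_g_bound\<close> dominates uniformly
  in \<open>j\<close>. For single \<open>n\<close> no such bound is available when \<open>j\<close>
  is close to \<open>n\<close>.\<close>

lemma survival_average: "(\<lambda>N. (\<Sum>n<N. q x n) / sqrt (real N)) \<longlonglongrightarrow> 2 * Vtot"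
proof -
  obtain C where C: "0 \<le> C" "\<And>n y. (\<Sum>m<n. g m y) \<le> C * (1 + \<bar>y\<bar>) * sqrt (real n)" using sum_g_bound by blast
  \<comment> \<open>The factor 1/2 turns the limit \<open>2 * u y\<close> of
    \<open>sum_div_sqrt_tendsto\<close> into \<open>u y\<close>.\<close>
  define h where "h N j y = (\<Sum>m<N - j. g m y) / sqrt (real N) / 2" for N j y
  have [measurable]: "h N j \<in> borel_measurable borel" for N j unfolding h_def by measurable
  have h0: "0 \<le> h N j y" for N j y unfolding h_def using g_bounds by (intro divide_nonneg_nonneg sum_nonneg) auto
  have hb: "\<bar>h N j y\<bar> \<le> C * (1 + \<bar>y\<bar>)" for N j y
  proof (cases "N = 0")
    case False
    have "(\<Sum>m<N - j. g m y) \<le> C * (1 + \<bar>y\<bar>) * sqrt (real (N - j))" by (rule C(2))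
    also have "\<dots> \<le> C * (1 + \<bar>y\<bar>) * sqrt (real N)" using C(1) by (intro mult_left_mono) auto
    finally have "(\<Sum>m<N - j. g m y) / sqrt (real N) \<le> C * (1 + \<bar>y\<bar>)" using False by (simp add: pos_divide_le_eq)
    moreover have "0 \<le> C * (1 + \<bar>y\<bar>)" using C(1) by simp
    moreover have "a / 2 \<le> b" if "a \<le> b" "0 \<le> b" for a b :: real using that by linarith
    ultimately have "h N j y \<le> C * (1 + \<bar>y\<bar>)" unfolding h_def by blast
    then show ?thesis using h0[of N j y] by simp
  qed (use C(1) in \<open>simp add: h_def\<close>)
  have hlim: "(\<lambda>N. h N j y) \<longlonglongrightarrow> u y" for j y
  proof (rule LIMSEQ_offset[of _ j])
    have "(\<lambda>N. (\<Sum>m<N. g m y) / sqrt (real N) * (sqrt (real N) / sqrt (real N + real j) / 2)) \<longlonglongrightarrow> 2 * u y * (1 / 2)"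
      by (intro tendsto_mult sum_div_sqrt_tendsto C2) real_asymp
    moreover have "\<forall>\<^sub>F N in sequentially. (\<Sum>m<N. g m y) / sqrt (real N) * (sqrt (real N) / sqrt (real N + real j) / 2) = h (N + j) j y"
      using eventually_gt_at_top[of 0] by eventually_elim (simp add: h_def)
    ultimately show "(\<lambda>N. h (N + j) j y) \<longlonglongrightarrow> u y" by (simp add: tendsto_cong)
  qed
  have Lh: "(\<lambda>N. Lw (h N j) k j) \<longlonglongrightarrow> Lw u k j" for k j
    unfolding Lw_def
  proof -
    show "(\<lambda>N. \<integral>\<omega>. of_bool (R x k j \<omega>) * h N j (S x \<omega> j) \<partial>M) \<longlonglongrightarrow> (\<integral>\<omega>. of_bool (R x k j \<omega>) * u (S x \<omega> j) \<partial>M)"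
    proof (rule integral_dominated_convergence[OF _ _ integrable_mult_right[OF integrable_moment, of C k j]])
      show "AE \<omega> in M. (\<lambda>N. of_bool (R x k j \<omega>) * h N j (S x \<omega> j)) \<longlonglongrightarrow> of_bool (R x k j \<omega>) * u (S x \<omega> j)"
        by (intro AE_I2 tendsto_mult_left hlim)
      show "AE \<omega> in M. norm (of_bool (R x k j \<omega>) * h N j (S x \<omega> j)) \<le> C * (of_bool (R x k j \<omega>) * (1 + \<bar>S x \<omega> j\<bar>))" for N
      proof (rule AE_I2)
        fix \<omega>
        show "norm (of_bool (R x k j \<omega>) * h N j (S x \<omega> j)) \<le> C * (of_bool (R x k j \<omega>) * (1 + \<bar>S x \<omega> j\<bar>))"
          using hb[of N j "S x \<omega> j"] by (cases "R x k j \<omega>") simp_all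
      qed
    qed measurable
  qed
  \<comment> \<open>Up to time \<open>N\<close> the crossing index is at most \<open>N\<close>. The
    time \<open>j\<close> gets the same range so that \<open>suminf_square\<close> applies; for
    \<open>j = N\<close> the sum in \<open>h\<close> is empty.\<close>
  have "(\<lambda>N. \<Sum>k. \<Sum>j. if k < Suc N \<and> j < Suc N then Lw (h N j) k j else 0) \<longlonglongrightarrow> Vtot"
    unfolding Vtot_def
  proof (rule double_tannery_moment)
    fix k j
    have "\<forall>\<^sub>F N in sequentially. (if k < Suc N \<and> j < Suc N then Lw (h N j) k j else 0) = Lw (h N j) k j"
      using eventually_gt_at_top[of "max k j"] by eventually_elim auto
    then show "(\<lambda>N. if k < Suc N \<and> j < Suc N then Lw (h N j) k j else 0) \<longlonglongrightarrow> Lw u k j"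
      using Lh[of j k] by (simp add: tendsto_cong)
    show "\<bar>if k < Suc N \<and> j < Suc N then Lw (h N j) k j else 0\<bar> \<le> C * moment k j" for N
      using abs_Lw_le[of "h N j" C k j, OF _ C(1) hb] moment_nonneg[of k j] C(1) by auto
  qed
  moreover have "(\<Sum>k. \<Sum>j. if k < Suc N \<and> j < Suc N then Lw (h N j) k j else 0) = (\<Sum>n<N. q x n) / sqrt (real N) / 2" for N
  proof -
    let ?I = "\<lambda>k j m. \<integral>\<omega>. of_bool (R x k j \<omega>) * g m (S x \<omega> j) \<partial>M"
    have Ig: "integrable M (\<lambda>\<omega>. of_bool (R x k j \<omega>) * g m (S x \<omega> j))" for k j m
      by (rule integrable_reach_weight[OF g_measurable, of 1]) (use g_bounds[of m] in \<open>auto intro: order_trans[of _ 1]\<close>)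
    have "(\<Sum>n<N. q x n) = (\<Sum>n<N. \<Sum>k\<le>N. \<Sum>j\<le>n. ?I k j (n - j))"
      by (intro sum.cong refl q_eq_sum) auto
    also have "\<dots> = (\<Sum>k\<le>N. \<Sum>n<N. \<Sum>j\<le>n. ?I k j (n - j))" by (rule sum.swap)
    also have "\<dots> = (\<Sum>k\<le>N. \<Sum>j<N. \<Sum>m<N - j. ?I k j m)"
    proof (rule sum.cong[OF refl])
      fix k show "(\<Sum>n<N. \<Sum>j\<le>n. ?I k j (n - j)) = (\<Sum>j<N. \<Sum>m<N - j. ?I k j m)" by (rule sum_shifted_diagonal[of "?I k"])
    qed
    finally have "(\<Sum>n<N. q x n) / sqrt (real N) / 2 = (\<Sum>k\<le>N. \<Sum>j<N. (\<Sum>m<N - j. ?I k j m) / sqrt (real N) / 2)"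
      by (simp only: sum_divide_distrib)
    also have "\<dots> = (\<Sum>k\<le>N. \<Sum>j<N. Lw (h N j) k j)"
    proof (intro sum.cong refl)
      fix k j
      have "(\<Sum>m<N - j. ?I k j m) = (\<integral>\<omega>. (\<Sum>m<N - j. of_bool (R x k j \<omega>) * g m (S x \<omega> j)) \<partial>M)"
        by (rule Bochner_Integration.integral_sum[symmetric]) (rule Ig)
      then show "(\<Sum>m<N - j. ?I k j m) / sqrt (real N) / 2 = Lw (h N j) k j"
        unfolding Lw_def h_def by (simp add: sum_distrib_left[symmetric])
    qed
    also have "\<dots> = (\<Sum>k<Suc N. \<Sum>j<Suc N. Lw (h N j) k j)"
    proof -
      have "(\<Sum>j<Suc N. Lw (h N j) k j) = (\<Sum>j<N. Lw (h N j) k j)" for k by (simp add: Lw_def h_def)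
      then show ?thesis by (simp only:) (simp only: lessThan_Suc_atMost)
    qed
    finally show ?thesis using suminf_square[of "Suc N" "\<lambda>k j. Lw (h N j) k j"] by simp
  qed
  ultimately have "(\<lambda>N. (\<Sum>n<N. q x n) / sqrt (real N) / 2) \<longlonglongrightarrow> Vtot" by simp
  from tendsto_mult_left[OF this, of 2] show ?thesis by simp
qed

text \<open>Given the crossing, \<open>excursion_limit\<close> holds for every position of the walk;
  dominated convergence then integrates over the position. The side of the position decides between
  the two limit processes.\<close>

lemma crossing_limit:
  assumes F: "lip_C01 F B L" and L: "0 \<le> L" and Wp: "cont_process N1 Wp" and Wm: "cont_process N2 Wm"
    and C4p: "\<And>y. 0 < u y \<Longrightarrow> 0 \<le> y \<Longrightarrow> law_conv_C01 (\<lambda>n. uniform_measure M {\<omega>\<in>space M. alive K (wpath y (Xs \<omega>)) 0 (U 0 \<omega>) n})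
                 (\<lambda>n \<omega>. rescaled \<sigma> (wpath y (Xs \<omega>)) n) N1 Wp"
    and C4m: "\<And>y. 0 < u y \<Longrightarrow> y < 0 \<Longrightarrow> law_conv_C01 (\<lambda>n. uniform_measure M {\<omega>\<in>space M. alive K (wpath y (Xs \<omega>)) 0 (U 0 \<omega>) n})
                 (\<lambda>n \<omega>. rescaled \<sigma> (wpath y (Xs \<omega>)) n) N2 Wm"
  shows "(\<lambda>n. sqrt (real n) * (\<integral>\<omega>. of_bool (R x k j \<omega>) * (of_bool (alive K (wpath x (Xs \<omega>)) j (U k \<omega>) n) *
            F (rescaled \<sigma> (wpath x (Xs \<omega>)) n)) \<partial>M))
    \<longlonglongrightarrow> (\<integral>\<omega>. F (Wp \<omega>) \<partial>N1) * Lw upos k j + (\<integral>\<omega>. F (Wm \<omega>) \<partial>N2) * (Lw u k j - Lw upos k j)"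
    (is "?f \<longlonglongrightarrow> ?wp * _ + ?wm * _")
proof (rule LIMSEQ_offset[of _ j])
  obtain C where C: "0 \<le> C" "\<And>n y. sqrt (real n) * g n y \<le> C * (1 + \<bar>y\<bar>)" using g_sqrt_bound by blast
  have bu: "\<bar>u y\<bar> \<le> C * (1 + \<bar>y\<bar>)" for y
    using u_nonneg[of y] LIMSEQ_le_const2[OF C2, of y "C * (1 + \<bar>y\<bar>)"] C(2) by auto
  note bF = lip_C01_bcont[OF F]
  have B: "\<bar>F (rescaled \<sigma> s n)\<bar> \<le> B" for s n
    using F continuous_on_rescaled[of \<sigma> s n] unfolding lip_C01_def by blast
  have B0': "0 \<le> B" using B[of undefined undefined] by linarith
  define w where "w y = (if 0 \<le> y then ?wp else ?wm)" for y :: real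
  let ?\<Psi> = "\<lambda>n \<omega>. \<integral>\<omega>'. of_bool (alive K (wpath (S x \<omega> j) (Xs \<omega>')) 0 (U 0 \<omega>') (n - j)) *
      F (rescaled \<sigma> (wpath x (comb_seq j (Xs \<omega>) (Xs \<omega>'))) n) \<partial>M"
  have \<Phi>m: "(\<lambda>p. F (rescaled \<sigma> (wpath x (fst p)) n)) \<in> borel_measurable paths" for n
    by (rule measurable_compose[OF measurable_fst functional_measurable[OF bF]])
  note RA = reach_alive_integral[OF \<Phi>m B, simplified fst_conv]
  \<comment> \<open>Uses \<open>sqrt (n + j) \<le> sqrt n + sqrt j\<close>. The constant grows with
    \<open>j\<close>, so this serves a single pair only.\<close>
  have bnd: "\<bar>sqrt (real (n + j)) * ?\<Psi> (n + j) \<omega>\<bar> \<le> B * (C + sqrt (real j)) * (1 + \<bar>S x \<omega> j\<bar>)" for n \<omega>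
  proof -
    let ?y = "S x \<omega> j"
    have m: "(\<lambda>\<omega>'. F (rescaled \<sigma> (wpath x (comb_seq j (Xs \<omega>) (Xs \<omega>'))) (n + j))) \<in> borel_measurable M"
    proof (rule measurable_compose[OF _ functional_measurable[OF bF]])
      show "(\<lambda>\<omega>'. comb_seq j (Xs \<omega>) (Xs \<omega>')) \<in> measurable M marks"
        by (intro measurable_comb_seq' measurable_const Xs_measurable) (simp add: space_PiM)
    qed
    have "\<bar>?\<Psi> (n + j) \<omega>\<bar> \<le> (\<integral>\<omega>'. \<bar>of_bool (alive K (wpath ?y (Xs \<omega>')) 0 (U 0 \<omega>') (n + j - j)) *
      F (rescaled \<sigma> (wpath x (comb_seq j (Xs \<omega>) (Xs \<omega>'))) (n + j))\<bar> \<partial>M)" by (rule integral_abs_bound)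
    also have "\<dots> \<le> (\<integral>\<omega>'. B * of_bool (alive K (wpath ?y (Xs \<omega>')) 0 (U 0 \<omega>') (n + j - j)) \<partial>M)"
      by (rule integral_mono[OF integrable_abs[OF integrable_alive_mult[OF m B]] integrable_mult_right[OF integrable_alive]])
         (use B in auto)
    also have "\<dots> = B * g n ?y" by (simp add: g_def)
    finally have 1: "\<bar>?\<Psi> (n + j) \<omega>\<bar> \<le> B * g n ?y" .
    have 2: "sqrt (real (n + j)) * g n ?y \<le> (C + sqrt (real j)) * (1 + \<bar>?y\<bar>)"
    proof -
      have "sqrt (real (n + j)) \<le> sqrt (real n) + sqrt (real j)" using sqrt_add_le_add_sqrt[of "real n" "real j"] by simp
      then have "sqrt (real (n + j)) * g n ?y \<le> (sqrt (real n) + sqrt (real j)) * g n ?y"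
        using g_bounds by (intro mult_right_mono) auto
      also have "\<dots> = sqrt (real n) * g n ?y + sqrt (real j) * g n ?y" by (rule distrib_right)
      also have "\<dots> \<le> C * (1 + \<bar>?y\<bar>) + sqrt (real j) * (1 + \<bar>?y\<bar>)"
        using C(2)[of n ?y] g_bounds(2)[of n ?y] by (intro add_mono mult_left_mono) auto
      finally show ?thesis by (simp only: distrib_right)
    qed
    have "\<bar>sqrt (real (n + j)) * ?\<Psi> (n + j) \<omega>\<bar> \<le> sqrt (real (n + j)) * (B * g n ?y)"
      unfolding abs_mult using 1 by (simp add: mult_left_mono del: of_nat_add)
    also have "\<dots> = B * (sqrt (real (n + j)) * g n ?y)" by (rule mult.left_commute)
    also have "\<dots> \<le> B * ((C + sqrt (real j)) * (1 + \<bar>?y\<bar>))" by (rule mult_left_mono[OF 2 B0'])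
    finally show ?thesis by (simp only: mult.assoc)
  qed
  have Idom: "integrable M (\<lambda>\<omega>. B * (C + sqrt (real j)) * (of_bool (R x k j \<omega>) * (1 + \<bar>S x \<omega> j\<bar>)))"
    by (intro integrable_mult_right integrable_moment)
  have "(\<lambda>n. \<integral>\<omega>. of_bool (R x k j \<omega>) * (sqrt (real (n + j)) * ?\<Psi> (n + j) \<omega>) \<partial>M) \<longlonglongrightarrow> (\<integral>\<omega>. of_bool (R x k j \<omega>) * (u (S x \<omega> j) * w (S x \<omega> j)) \<partial>M)"
  proof (rule integral_dominated_convergence[OF _ _ Idom])
    show "(\<lambda>\<omega>. of_bool (R x k j \<omega>) * (u (S x \<omega> j) * w (S x \<omega> j))) \<in> borel_measurable M"
      unfolding w_def by measurable
    show "(\<lambda>\<omega>. of_bool (R x k j \<omega>) * (sqrt (real (n + j)) * ?\<Psi> (n + j) \<omega>)) \<in> borel_measurable M" for n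
    proof -
      have "integrable M (\<lambda>\<omega>. of_bool (R x k j \<omega>) * ?\<Psi> (n + j) \<omega>)" using RA(3)[of j "n + j" x k] by simp
      then have "integrable M (\<lambda>\<omega>. sqrt (real (n + j)) * (of_bool (R x k j \<omega>) * ?\<Psi> (n + j) \<omega>))" by (rule integrable_mult_right)
      then show ?thesis by (simp only: mult.left_commute borel_measurable_integrable)
    qed
    show "AE \<omega> in M. (\<lambda>n. of_bool (R x k j \<omega>) * (sqrt (real (n + j)) * ?\<Psi> (n + j) \<omega>)) \<longlonglongrightarrow> of_bool (R x k j \<omega>) * (u (S x \<omega> j) * w (S x \<omega> j))"
    proof (intro AE_I2 tendsto_mult_left)
      fix \<omega>
      have "(\<lambda>n. sqrt (real n) * ?\<Psi> n \<omega>) \<longlonglongrightarrow> u (S x \<omega> j) * w (S x \<omega> j)"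
      proof (cases "0 \<le> S x \<omega> j")
        case True
        then show ?thesis unfolding w_def if_P[OF True]
          by (intro excursion_limit[OF F L Wp C2 u_nonneg C4p]) auto
      next
        case False
        then show ?thesis unfolding w_def if_not_P[OF False]
          by (intro excursion_limit[OF F L Wm C2 u_nonneg C4m]) auto
      qed
      then show "(\<lambda>n. sqrt (real (n + j)) * ?\<Psi> (n + j) \<omega>) \<longlonglongrightarrow> u (S x \<omega> j) * w (S x \<omega> j)"
        by (rule LIMSEQ_ignore_initial_segment)
    qed
    show "AE \<omega> in M. norm (of_bool (R x k j \<omega>) * (sqrt (real (n + j)) * ?\<Psi> (n + j) \<omega>)) \<le> B * (C + sqrt (real j)) * (of_bool (R x k j \<omega>) * (1 + \<bar>S x \<omega> j\<bar>))" for n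
    proof (rule AE_I2)
      fix \<omega>
      show "norm (of_bool (R x k j \<omega>) * (sqrt (real (n + j)) * ?\<Psi> (n + j) \<omega>)) \<le> B * (C + sqrt (real j)) * (of_bool (R x k j \<omega>) * (1 + \<bar>S x \<omega> j\<bar>))"
        using bnd[of n \<omega>] by (cases "R x k j \<omega>") simp_all
    qed
  qed
  moreover have "(\<integral>\<omega>. of_bool (R x k j \<omega>) * (sqrt (real (n + j)) * ?\<Psi> (n + j) \<omega>) \<partial>M) = ?f (n + j)" for n
    unfolding RA(1)[OF le_add2] by (simp only: mult.left_commute[of "of_bool _"] integral_mult_right_zero)
  moreover have "(\<integral>\<omega>. of_bool (R x k j \<omega>) * (u (S x \<omega> j) * w (S x \<omega> j)) \<partial>M) = ?wp * Lw upos k j + ?wm * (Lw u k j - Lw upos k j)"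
  proof -
    note Iu = integrable_reach_weight[OF u_measurable C(1) bu]
    note Ip = integrable_reach_weight[OF upos_measurable C(1) upos_bound[OF bu]]
    have "(\<integral>\<omega>. of_bool (R x k j \<omega>) * (u (S x \<omega> j) * w (S x \<omega> j)) \<partial>M)
        = (\<integral>\<omega>. ?wp * (of_bool (R x k j \<omega>) * upos (S x \<omega> j)) + ?wm * (of_bool (R x k j \<omega>) * u (S x \<omega> j) - of_bool (R x k j \<omega>) * upos (S x \<omega> j)) \<partial>M)"
      by (intro Bochner_Integration.integral_cong refl) (simp add: w_def upos_def)
    also have "\<dots> = ?wp * Lw upos k j + ?wm * (Lw u k j - Lw upos k j)"
      unfolding Lw_def using Iu Ip by simp
    finally show ?thesis .
  qed
  ultimately show "(\<lambda>n. ?f (n + j)) \<longlonglongrightarrow> ?wp * Lw upos k j + ?wm * (Lw u k j - Lw upos k j)" by simp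
qed

text \<open>No estimate of single late pairs is used: since the indicators of all pairs add up to
  that of survival, the omitted pairs contribute at most \<open>B\<close> times the survival
  probability minus the probability of the chosen ones.\<close>

lemma survival_functional_limit:
  assumes F: "lip_C01 F B L" and L: "0 \<le> L" and Wp: "cont_process N1 Wp" and Wm: "cont_process N2 Wm"
    and C4p: "\<And>y. 0 < u y \<Longrightarrow> 0 \<le> y \<Longrightarrow> law_conv_C01 (\<lambda>n. uniform_measure M {\<omega>\<in>space M. alive K (wpath y (Xs \<omega>)) 0 (U 0 \<omega>) n})
                 (\<lambda>n \<omega>. rescaled \<sigma> (wpath y (Xs \<omega>)) n) N1 Wp"
    and C4m: "\<And>y. 0 < u y \<Longrightarrow> y < 0 \<Longrightarrow> law_conv_C01 (\<lambda>n. uniform_measure M {\<omega>\<in>space M. alive K (wpath y (Xs \<omega>)) 0 (U 0 \<omega>) n})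
                 (\<lambda>n \<omega>. rescaled \<sigma> (wpath y (Xs \<omega>)) n) N2 Wm"
  shows "(\<lambda>n. sqrt (real n) * (\<integral>\<omega>. of_bool (enat n < absorb_time (wpath x (Xs \<omega>)) (Us \<omega>) K) *
            F (rescaled \<sigma> (wpath x (Xs \<omega>)) n) \<partial>M))
    \<longlonglongrightarrow> (\<integral>\<omega>. F (Wp \<omega>) \<partial>N1) * Vplus + (\<integral>\<omega>. F (Wm \<omega>) \<partial>N2) * (Vtot - Vplus)"
    (is "?E \<longlonglongrightarrow> ?wp * _ + ?wm * _")
proof -
  interpret N1: prob_space N1 using Wp by (simp add: cont_process_def)
  interpret N2: prob_space N2 using Wm by (simp add: cont_process_def)
  let ?a = "\<lambda>k j n \<omega>. of_bool (R x k j \<omega>) * of_bool (alive K (wpath x (Xs \<omega>)) j (U k \<omega>) n) :: real"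
  let ?s = "\<lambda>n \<omega>. of_bool (enat n < absorb_time (wpath x (Xs \<omega>)) (Us \<omega>) K) :: real"
  let ?F = "\<lambda>n \<omega>. F (rescaled \<sigma> (wpath x (Xs \<omega>)) n)"
  define t where "t k j n = (\<integral>\<omega>. ?a k j n \<omega> * ?F n \<omega> \<partial>M)" for k j n
  define t1 where "t1 k j n = (\<integral>\<omega>. ?a k j n \<omega> \<partial>M)" for k j n
  note bF = lip_C01_bcont[OF F]
  have B: "\<bar>F (rescaled \<sigma> s n)\<bar> \<le> B" for s n
    using F continuous_on_rescaled[of \<sigma> s n] unfolding lip_C01_def by blast
  have B0': "0 \<le> B" using B[of undefined undefined] by linarith
  have \<Phi>m: "(\<lambda>p. F (rescaled \<sigma> (wpath x (fst p)) n)) \<in> borel_measurable paths" for n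
    by (rule measurable_compose[OF measurable_fst functional_measurable[OF bF]])
  note Fm [measurable] = functional_measurable_M[OF bF]
  have It: "integrable M (\<lambda>\<omega>. ?a k j n \<omega> * ?F n \<omega>)" if "j \<le> n" for k j n
    using reach_alive_integral(2)[OF \<Phi>m B that, simplified fst_conv] by (simp only: mult.assoc)
  have It1: "integrable M (\<lambda>\<omega>. ?a k j n \<omega>)" if "j \<le> n" for k j n using that by (rule prob_reach_alive)
  have Is: "integrable M (\<lambda>\<omega>. ?s n \<omega>)" for n by (rule integrable_const_bound[of _ 1]) auto
  have IsF: "integrable M (\<lambda>\<omega>. ?s n \<omega> * ?F n \<omega>)" for n
  proof (rule integrable_const_bound[of _ B])
    have "\<bar>of_bool P * ?F n \<omega>\<bar> \<le> B" for P \<omega> using B[of "wpath x (Xs \<omega>)" n] B0' by (cases P) auto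
    then show "AE \<omega> in M. norm (?s n \<omega> * ?F n \<omega>) \<le> B" by simp
  qed measurable
  have lim_t: "(\<lambda>n. sqrt (real n) * t k j n) \<longlonglongrightarrow> ?wp * Lw upos k j + ?wm * (Lw u k j - Lw upos k j)" for k j
    using crossing_limit[OF F L Wp Wm C4p C4m, of k j] unfolding t_def by (simp only: mult.assoc)
  \<comment> \<open>The constant functional 1 turns the limit for \<open>F\<close> into one for
    probabilities.\<close>
  have lim_t1: "(\<lambda>n. sqrt (real n) * t1 k j n) \<longlonglongrightarrow> Lw u k j" for k j
  proof -
    have "lip_C01 (\<lambda>_. 1) 1 0" by (simp add: lip_C01_def)
    from crossing_limit[OF this order_refl Wp Wm C4p C4m, of k j]
    show ?thesis unfolding t1_def by (simp add: N1.prob_space N2.prob_space)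
  qed
  have trunc: "\<bar>(\<integral>\<omega>. ?s n \<omega> * ?F n \<omega> \<partial>M) - (\<Sum>k<m. \<Sum>j<m. t k j n)\<bar> \<le> B * (q x n - (\<Sum>k<m. \<Sum>j<m. t1 k j n))" if mn: "m \<le> n" for m n
  proof -
    let ?D = "\<lambda>\<omega>. ?s n \<omega> - (\<Sum>k<m. \<Sum>j<m. ?a k j n \<omega>)"
    have D0: "0 \<le> ?D \<omega>" for \<omega>
    proof -
      have "(\<Sum>k<m. \<Sum>j<m. ?a k j n \<omega>) \<le> (\<Sum>k<m. \<Sum>j\<le>n. ?a k j n \<omega>)" using mn by (intro sum_mono sum_mono2) auto
      also have "\<dots> \<le> (\<Sum>k\<le>n. \<Sum>j\<le>n. ?a k j n \<omega>)" using mn by (intro sum_mono2 sum_nonneg) auto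
      also have "\<dots> = ?s n \<omega>" by (rule sum_reach_alive[OF order_refl])
      finally show ?thesis by simp
    qed
    have S1: "integrable M (\<lambda>\<omega>. \<Sum>k<m. \<Sum>j<m. ?a k j n \<omega>)" "(\<integral>\<omega>. (\<Sum>k<m. \<Sum>j<m. ?a k j n \<omega>) \<partial>M) = (\<Sum>k<m. \<Sum>j<m. t1 k j n)"
    proof -
      have I: "integrable M (\<lambda>\<omega>. ?a k j n \<omega>)" if "j \<in> {..<m}" for k j using that mn by (intro It1) auto
      show "integrable M (\<lambda>\<omega>. \<Sum>k<m. \<Sum>j<m. ?a k j n \<omega>)" by (rule Bochner_Integration.integrable_sum[OF Bochner_Integration.integrable_sum[OF I]])
      show "(\<integral>\<omega>. (\<Sum>k<m. \<Sum>j<m. ?a k j n \<omega>) \<partial>M) = (\<Sum>k<m. \<Sum>j<m. t1 k j n)" unfolding t1_def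
        by (simp only: Bochner_Integration.integral_sum[OF Bochner_Integration.integrable_sum[OF I]] Bochner_Integration.integral_sum[OF I])
    qed
    have S2: "integrable M (\<lambda>\<omega>. \<Sum>k<m. \<Sum>j<m. ?a k j n \<omega> * ?F n \<omega>)" "(\<integral>\<omega>. (\<Sum>k<m. \<Sum>j<m. ?a k j n \<omega> * ?F n \<omega>) \<partial>M) = (\<Sum>k<m. \<Sum>j<m. t k j n)"
    proof -
      have I: "integrable M (\<lambda>\<omega>. ?a k j n \<omega> * ?F n \<omega>)" if "j \<in> {..<m}" for k j using that mn by (intro It) auto
      show "integrable M (\<lambda>\<omega>. \<Sum>k<m. \<Sum>j<m. ?a k j n \<omega> * ?F n \<omega>)" by (rule Bochner_Integration.integrable_sum[OF Bochner_Integration.integrable_sum[OF I]])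
      show "(\<integral>\<omega>. (\<Sum>k<m. \<Sum>j<m. ?a k j n \<omega> * ?F n \<omega>) \<partial>M) = (\<Sum>k<m. \<Sum>j<m. t k j n)" unfolding t_def
        by (simp only: Bochner_Integration.integral_sum[OF Bochner_Integration.integrable_sum[OF I]] Bochner_Integration.integral_sum[OF I])
    qed
    have DF: "?s n \<omega> * ?F n \<omega> - (\<Sum>k<m. \<Sum>j<m. ?a k j n \<omega> * ?F n \<omega>) = ?D \<omega> * ?F n \<omega>" for \<omega>
      by (simp only: sum_distrib_right[symmetric] left_diff_distrib)
    have eq: "(\<integral>\<omega>. ?s n \<omega> * ?F n \<omega> \<partial>M) - (\<Sum>k<m. \<Sum>j<m. t k j n) = (\<integral>\<omega>. ?D \<omega> * ?F n \<omega> \<partial>M)"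
      unfolding S2(2)[symmetric] DF[symmetric] by (rule Bochner_Integration.integral_diff[OF IsF S2(1), symmetric])
    have "\<bar>(\<integral>\<omega>. ?s n \<omega> * ?F n \<omega> \<partial>M) - (\<Sum>k<m. \<Sum>j<m. t k j n)\<bar> \<le> (\<integral>\<omega>. \<bar>?D \<omega> * ?F n \<omega>\<bar> \<partial>M)"
      unfolding eq by (rule integral_abs_bound)
    also have "\<dots> \<le> (\<integral>\<omega>. B * ?D \<omega> \<partial>M)"
    proof (rule integral_mono)
      show "integrable M (\<lambda>\<omega>. \<bar>?D \<omega> * ?F n \<omega>\<bar>)"
        unfolding DF[symmetric] by (rule integrable_abs[OF Bochner_Integration.integrable_diff[OF IsF S2(1)]])
      show "integrable M (\<lambda>\<omega>. B * ?D \<omega>)" by (rule integrable_mult_right[OF Bochner_Integration.integrable_diff[OF Is S1(1)]])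
      fix \<omega>
      have "\<bar>?D \<omega> * ?F n \<omega>\<bar> = ?D \<omega> * \<bar>?F n \<omega>\<bar>" unfolding abs_mult abs_of_nonneg[OF D0] ..
      also have "\<dots> \<le> ?D \<omega> * B" by (rule mult_left_mono[OF B D0])
      finally show "\<bar>?D \<omega> * ?F n \<omega>\<bar> \<le> B * ?D \<omega>" by (simp only: mult.commute)
    qed
    also have "\<dots> = B * (q x n - (\<Sum>k<m. \<Sum>j<m. t1 k j n))"
      unfolding q_eq_integral S1(2)[symmetric] Bochner_Integration.integral_diff[OF Is S1(1), symmetric] by (rule integral_mult_right_zero)
    finally show ?thesis .
  qed
  let ?P = "\<lambda>m. \<Sum>k<m. \<Sum>j<m. Lw u k j" and ?Pp = "\<lambda>m. \<Sum>k<m. \<Sum>j<m. Lw upos k j"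
  let ?PF = "\<lambda>m. ?wp * ?Pp m + ?wm * (?P m - ?Pp m)" and ?VF = "?wp * Vplus + ?wm * (Vtot - Vplus)"
  have PF: "?PF \<longlonglongrightarrow> ?VF" by (intro tendsto_intros Lw_tendsto)
  show ?thesis
  proof (rule LIMSEQ_I)
    fix e :: real assume e: "0 < e"
    \<comment> \<open>Scaled by \<open>sqrt n\<close>, the omitted probability is below
      \<open>(Vtot + d) - (Vtot - 2 * d) = 3 * d\<close>; two more errors of size \<open>d\<close>
      come from the limits in \<open>n\<close> and in \<open>m\<close>.\<close>
    define d where "d = e / (3 * B + 3)"
    have d: "0 < d" unfolding d_def using e B0' by simp
    have de: "B * (3 * d) + 3 * d \<le> e"
    proof -
      have "B * (3 * d) + 3 * d = (3 * B + 3) * d" by (simp add: algebra_simps)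
      also have "\<dots> = e" unfolding d_def using B0' by simp
      finally show ?thesis by simp
    qed
    have "\<forall>\<^sub>F m in sequentially. Vtot - d < ?P m" using Lw_tendsto(1) d by (intro order_tendstoD) auto
    moreover have "\<forall>\<^sub>F m in sequentially. dist (?PF m) ?VF < d" using tendstoD[OF PF d] .
    ultimately have "\<forall>\<^sub>F m in sequentially. Vtot - d < ?P m \<and> dist (?PF m) ?VF < d" by (rule eventually_conj)
    then obtain m where m: "Vtot - d < ?P m" "dist (?PF m) ?VF < d" using eventually_happens'[OF sequentially_bot] by blast
    have "(\<lambda>n. \<Sum>k<m. \<Sum>j<m. sqrt (real n) * t k j n) \<longlonglongrightarrow> (\<Sum>k<m. \<Sum>j<m. ?wp * Lw upos k j + ?wm * (Lw u k j - Lw upos k j))"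
      by (intro tendsto_sum lim_t)
    then have "(\<lambda>n. sqrt (real n) * (\<Sum>k<m. \<Sum>j<m. t k j n)) \<longlonglongrightarrow> ?PF m"
      by (simp only: sum_distrib_left[symmetric] sum.distrib sum_subtractf)
    then have "\<forall>\<^sub>F n in sequentially. dist (sqrt (real n) * (\<Sum>k<m. \<Sum>j<m. t k j n)) (?PF m) < d" by (rule tendstoD[OF _ d])
    moreover have "(\<lambda>n. \<Sum>k<m. \<Sum>j<m. sqrt (real n) * t1 k j n) \<longlonglongrightarrow> ?P m"
      by (intro tendsto_sum lim_t1)
    then have "(\<lambda>n. sqrt (real n) * (\<Sum>k<m. \<Sum>j<m. t1 k j n)) \<longlonglongrightarrow> ?P m"
      by (simp add: sum_distrib_left)
    then have "\<forall>\<^sub>F n in sequentially. ?P m - d < sqrt (real n) * (\<Sum>k<m. \<Sum>j<m. t1 k j n)" using d by (intro order_tendstoD) auto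
    moreover have "\<forall>\<^sub>F n in sequentially. sqrt (real n) * q x n < Vtot + d"
      using V_order d by (intro monotone_density_upper[OF decseq_q survival_average]) auto
    ultimately have "\<forall>\<^sub>F n in sequentially. norm (?E n - ?VF) < e"
      using eventually_ge_at_top[of m]
    proof eventually_elim
      case (elim n)
      let ?Q = "sqrt (real n) * (\<Sum>k<m. \<Sum>j<m. t k j n)"
      have "\<bar>?E n - ?Q\<bar> = sqrt (real n) * \<bar>(\<integral>\<omega>. ?s n \<omega> * ?F n \<omega> \<partial>M) - (\<Sum>k<m. \<Sum>j<m. t k j n)\<bar>"
        by (simp add: abs_mult right_diff_distrib[symmetric])
      also have "\<dots> \<le> sqrt (real n) * (B * (q x n - (\<Sum>k<m. \<Sum>j<m. t1 k j n)))"
        by (intro mult_left_mono trunc elim) simp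
      also have "\<dots> = B * (sqrt (real n) * q x n - sqrt (real n) * (\<Sum>k<m. \<Sum>j<m. t1 k j n))"
        by (simp only: right_diff_distrib mult.left_commute)
      also have "\<dots> \<le> B * (3 * d)" using elim(2,3) m(1) by (intro mult_left_mono B0') linarith
      finally have 1: "\<bar>?E n - ?Q\<bar> \<le> B * (3 * d)" .
      have 2: "\<bar>?Q - ?PF m\<bar> < d" using elim(1) unfolding dist_real_def .
      have 3: "\<bar>?PF m - ?VF\<bar> < d" using m(2) unfolding dist_real_def .
      have "\<bar>?E n - ?VF\<bar> \<le> \<bar>?E n - ?Q\<bar> + \<bar>?Q - ?PF m\<bar> + \<bar>?PF m - ?VF\<bar>" by linarith
      then show ?case using 1 2 3 d de unfolding real_norm_def by linarith
    qed
    then show "\<exists>n0. \<forall>n\<ge>n0. norm (?E n - ?VF) < e" by (simp only: eventually_sequentially)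
  qed
qed

end

end

text \<open>The product space makes the coin independent of both processes. A real-valued mark is
  covered by a sequence of which \<open>K\<close> reads one entry.\<close>

theorem theorem2:
  fixes M :: "'a measure"
    and X :: "nat \<Rightarrow> 'a \<Rightarrow> real"
    and U :: "nat \<Rightarrow> 'a \<Rightarrow> (nat \<Rightarrow> real)"
    and K :: "nat \<Rightarrow> (nat \<Rightarrow> real) \<Rightarrow> real \<Rightarrow> bool"
    and \<sigma> :: real
    and u :: "real \<Rightarrow> real"
    and N1 :: "'b measure" and Wp :: "'b \<Rightarrow> real \<Rightarrow> real"
    and N2 :: "'c measure" and Wm :: "'c \<Rightarrow> real \<Rightarrow> real"
    and x :: real
  assumes prob: "prob_space M"
    and indep: "prob_space.indep_vars M (\<lambda>_. PiM UNIV (\<lambda>_::nat. borel))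
                  (\<lambda>i \<omega>. case i of Inl n \<Rightarrow> (\<lambda>_::nat. X n \<omega>) | Inr k \<Rightarrow> U k \<omega>) (UNIV :: (nat + nat) set)"
    and X_ident: "\<And>n. distr M borel (X n) = distr M borel (X 0)"
    and U_ident: "\<And>k. distr M (PiM UNIV (\<lambda>_::nat. borel)) (U k) = distr M (PiM UNIV (\<lambda>_::nat. borel)) (U 0)"
    and X_int: "integrable M (X 0)"
    and X_mean: "(\<integral>\<omega>. X 0 \<omega> \<partial>M) = 0"
    and X_sq_int: "integrable M (\<lambda>\<omega>. (X 0 \<omega>)\<^sup>2)"
    and \<sigma>_pos: "\<sigma> > 0"
    and X_var: "(\<integral>\<omega>. (X 0 \<omega>)\<^sup>2 \<partial>M) = \<sigma>\<^sup>2"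
    and K_meas: "\<And>i. (\<lambda>(v, y). K i v y)
                   \<in> measurable (PiM UNIV (\<lambda>_::nat. borel) \<Otimes>\<^sub>M borel) (count_space UNIV)"
    and C1: "\<exists>c>0. \<exists>\<gamma>. 0 < \<gamma> \<and> \<gamma> < 1 \<and> (\<forall>y k.
               measure M {\<omega> \<in> space M. zc_time (walk X y \<omega>) k
                   \<le> absorb_time (walk X y \<omega>) (\<lambda>j. U j \<omega>) K} \<le> c * \<gamma> ^ k)"
    and C2: "\<And>y. (\<lambda>n. sqrt (real n) * measure M {\<omega> \<in> space M.
                 enat n < absorb_time (walk X y \<omega>) (\<lambda>j. U j \<omega>) K \<and> enat n < zc_time (walk X y \<omega>) 1})
               \<longlonglongrightarrow> u y"
    and Wp_proc: "cont_process N1 Wp"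
    and Wm_proc: "cont_process N2 Wm"
    and C4_pos: "\<And>y. u y > 0 \<Longrightarrow> y \<ge> 0 \<Longrightarrow>
               law_conv_C01
                 (\<lambda>n. uniform_measure M {\<omega> \<in> space M.
                    enat n < absorb_time (walk X y \<omega>) (\<lambda>j. U j \<omega>) K \<and> enat n < zc_time (walk X y \<omega>) 1})
                 (\<lambda>n \<omega>. rescaled \<sigma> (walk X y \<omega>) n) N1 Wp"
    and C4_neg: "\<And>y. u y > 0 \<Longrightarrow> y < 0 \<Longrightarrow>
               law_conv_C01
                 (\<lambda>n. uniform_measure M {\<omega> \<in> space M.
                    enat n < absorb_time (walk X y \<omega>) (\<lambda>j. U j \<omega>) K \<and> enat n < zc_time (walk X y \<omega>) 1})
                 (\<lambda>n \<omega>. rescaled \<sigma> (walk X y \<omega>) n) N2 Wm"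
    and C3: "\<exists>c>0. \<forall>n\<ge>1. measure M {\<omega> \<in> space M. enat n < absorb_time (walk X x \<omega>) (\<lambda>j. U j \<omega>) K}
               \<ge> 1 / (c * sqrt (real n))"
  shows "let V = (\<Sum>k. \<integral>\<omega>. (if zc_time (walk X x \<omega>) k < \<infinity> \<and>
                      zc_time (walk X x \<omega>) k \<le> absorb_time (walk X x \<omega>) (\<lambda>j. U j \<omega>) K
                    then u (walk X x \<omega> (the_enat (zc_time (walk X x \<omega>) k))) else 0) \<partial>M);
             Vp = (\<Sum>k. \<integral>\<omega>. (if zc_time (walk X x \<omega>) k < \<infinity> \<and>
                      zc_time (walk X x \<omega>) k \<le> absorb_time (walk X x \<omega>) (\<lambda>j. U j \<omega>) K \<and>
                      walk X x \<omega> (the_enat (zc_time (walk X x \<omega>) k)) \<ge> 0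
                    then u (walk X x \<omega> (the_enat (zc_time (walk X x \<omega>) k))) else 0) \<partial>M);
             p = Vp / V
         in p \<in> {0..1} \<and>
            law_conv_C01
              (\<lambda>n. uniform_measure M {\<omega> \<in> space M. enat n < absorb_time (walk X x \<omega>) (\<lambda>j. U j \<omega>) K})
              (\<lambda>n \<omega>. rescaled \<sigma> (walk X x \<omega>) n)
              (measure_pmf (bernoulli_pmf p) \<Otimes>\<^sub>M (N1 \<Otimes>\<^sub>M N2))
              (\<lambda>(\<rho>, \<omega>1, \<omega>2) t. of_bool \<rho> * Wp \<omega>1 t + (1 - of_bool \<rho>) * Wm \<omega>2 t)"
proof -
  interpret prob_space M by (rule prob)
  interpret killed_walk M X U K \<sigma>
    by unfold_locales (fact indep X_ident U_ident X_int X_mean X_sq_int \<sigma>_pos X_var K_meas)+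
  obtain c \<gamma> where c: "0 < c" "0 < \<gamma>" "\<gamma> < 1" and C1': "\<And>y k. prob {\<omega>\<in>space M. zc_time (walk X y \<omega>) k
                   \<le> absorb_time (walk X y \<omega>) (\<lambda>j. U j \<omega>) K} \<le> c * \<gamma> ^ k"
    using C1 by blast
  obtain B0 l where B0: "0 \<le> B0" and l: "0 < l" "l < 1"
    and mom: "\<And>k n. (\<Sum>j\<le>n. \<integral>\<omega>. of_bool (R x k j \<omega>) * (1 + \<bar>S x \<omega> j\<bar>) \<partial>M) \<le> B0 * l ^ k"
    using reach_moments[OF c C1'[unfolded walk_eq_wpath]] by blast
  \<comment> \<open>(C2) and (C4) pass from crossing and absorption times to
    \<open>alive\<close>.\<close>
  have g2: "(\<lambda>n. sqrt (real n) * g n y) \<longlonglongrightarrow> u y" for y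
    using C2[of y] unfolding g_eq_prob walk_eq_wpath first_excursion_iff .
  note ctx = g2 B0 l mom
  have C4p: "law_conv_C01 (\<lambda>n. uniform_measure M {\<omega>\<in>space M. alive K (wpath y (Xs \<omega>)) 0 (U 0 \<omega>) n})
                 (\<lambda>n \<omega>. rescaled \<sigma> (wpath y (Xs \<omega>)) n) N1 Wp" if "0 < u y" "0 \<le> y" for y
    using C4_pos[OF that] unfolding walk_eq_wpath first_excursion_iff .
  have C4m: "law_conv_C01 (\<lambda>n. uniform_measure M {\<omega>\<in>space M. alive K (wpath y (Xs \<omega>)) 0 (U 0 \<omega>) n})
                 (\<lambda>n \<omega>. rescaled \<sigma> (wpath y (Xs \<omega>)) n) N2 Wm" if "0 < u y" "y < 0" for y
    using C4_neg[OF that] unfolding walk_eq_wpath first_excursion_iff .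
  note lim = survival_functional_limit[OF ctx _ _ Wp_proc Wm_proc C4p C4m]
  interpret N1: prob_space N1 using Wp_proc by (simp add: cont_process_def)
  interpret N2: prob_space N2 using Wm_proc by (simp add: cont_process_def)
  have qlim: "(\<lambda>n. sqrt (real n) * q x n) \<longlonglongrightarrow> Vtot x u"
  proof -
    have "lip_C01 (\<lambda>_. 1) 1 0" by (simp add: lip_C01_def)
    from lim[OF this] show ?thesis by (simp add: q_eq_integral N1.prob_space N2.prob_space)
  qed
  obtain c3 where c3: "0 < c3" and C3': "\<And>n. 1 \<le> n \<Longrightarrow> 1 / (c3 * sqrt (real n)) \<le> q x n"
    using C3 unfolding q_def walk_eq_wpath by blast
  have qpos: "0 < q x n" if "1 \<le> n" for n
    using C3'[OF that] c3 that by (auto intro: less_le_trans[rotated])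
  \<comment> \<open>(C3) in the limit. It makes \<open>p\<close> a genuine quotient rather than a
    default value of division by zero.\<close>
  have "1 / c3 \<le> Vtot x u"
  proof (rule LIMSEQ_le_const[OF qlim], intro exI[of _ 1] allI impI)
    fix n :: nat assume n: "1 \<le> n"
    have "1 / c3 = sqrt (real n) * (1 / (c3 * sqrt (real n)))" using n by simp
    also have "\<dots> \<le> sqrt (real n) * q x n" using C3'[OF n] by (intro mult_left_mono) auto
    finally show "1 / c3 \<le> sqrt (real n) * q x n" .
  qed
  then have Vpos: "0 < Vtot x u" using c3 by (smt (verit) divide_pos_pos)
  obtain C where C: "0 \<le> C" "\<And>y. u y \<le> C * (1 + \<bar>y\<bar>)" using u_bound[OF ctx] by blast
  then have bu: "\<bar>u y\<bar> \<le> C * (1 + \<bar>y\<bar>)" for y using u_nonneg[OF ctx, of y] by simp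
  have V_eq: "(\<Sum>k. \<integral>\<omega>. (if zc_time (walk X x \<omega>) k < \<infinity> \<and>
                      zc_time (walk X x \<omega>) k \<le> absorb_time (walk X x \<omega>) (\<lambda>j. U j \<omega>) K
                    then u (walk X x \<omega> (the_enat (zc_time (walk X x \<omega>) k))) else 0) \<partial>M) = Vtot x u"
    unfolding walk_eq_wpath Vtot_def[OF ctx] integral_at_crossing[OF ctx u_measurable[OF ctx] C(1) bu] ..
  have Vp_eq: "(\<Sum>k. \<integral>\<omega>. (if zc_time (walk X x \<omega>) k < \<infinity> \<and>
                      zc_time (walk X x \<omega>) k \<le> absorb_time (walk X x \<omega>) (\<lambda>j. U j \<omega>) K \<and>
                      walk X x \<omega> (the_enat (zc_time (walk X x \<omega>) k)) \<ge> 0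
                    then u (walk X x \<omega> (the_enat (zc_time (walk X x \<omega>) k))) else 0) \<partial>M) = Vplus x u"
  proof -
    have "(if A \<and> B \<and> 0 \<le> z then u z else 0) = (if A \<and> B then upos u z else 0)" for A B z by (simp add: upos_def[OF ctx])
    then show ?thesis
      unfolding walk_eq_wpath Vplus_def[OF ctx]
        integral_at_crossing[OF ctx upos_measurable[OF ctx] C(1) upos_bound[OF ctx bu], symmetric] by (simp only:)
  qed
  define p where "p = Vplus x u / Vtot x u"
  have p: "p \<in> {0..1}" unfolding p_def using V_order[OF ctx] Vpos by simp
  have "law_conv_C01
          (\<lambda>n. uniform_measure M {\<omega> \<in> space M. enat n < absorb_time (wpath x (Xs \<omega>)) (Us \<omega>) K})
          (\<lambda>n \<omega>. rescaled \<sigma> (wpath x (Xs \<omega>)) n)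
          (measure_pmf (bernoulli_pmf p) \<Otimes>\<^sub>M (N1 \<Otimes>\<^sub>M N2))
          (\<lambda>(\<rho>, \<omega>1, \<omega>2) t. of_bool \<rho> * Wp \<omega>1 t + (1 - of_bool \<rho>) * Wm \<omega>2 t)"
    (is "law_conv_C01 ?P _ ?Q ?Y")
  proof (rule law_conv_C01_lipschitzI)
    have "finite_measure (?P n)" if "1 \<le> n" for n
    proof -
      have "prob_space (?P n)"
        using qpos[OF that] unfolding q_def by (intro prob_space_uniform_measure) (auto simp: emeasure_eq_measure)
      then show ?thesis by (simp add: prob_space_def)
    qed
    then show "\<forall>\<^sub>F n in sequentially. finite_measure (?P n)" by (auto simp: eventually_sequentially)
    show "continuous_on {0..1} (rescaled \<sigma> (wpath x (Xs \<omega>)) n)" for n \<omega> by (rule continuous_on_rescaled)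
    have "(\<lambda>\<omega>. rescaled \<sigma> (wpath x (Xs \<omega>)) n t) \<in> borel_measurable M" for n t
      by (rule measurable_compose[OF Xs_measurable rescaled_measurable])
    then show "(\<lambda>\<omega>. rescaled \<sigma> (wpath x (Xs \<omega>)) n t) \<in> borel_measurable (?P n)" for n t
      by (simp cong: measurable_cong_sets)
    show "cont_process ?Q ?Y" by (rule cont_process_mixture[OF Wp_proc Wm_proc])
    fix F B L assume F: "lip_C01 F B L" "0 \<le> L"
    note bF = lip_C01_bcont[OF F(1)]
    let ?E = "\<lambda>n. sqrt (real n) * (\<integral>\<omega>. of_bool (enat n < absorb_time (wpath x (Xs \<omega>)) (Us \<omega>) K) * F (rescaled \<sigma> (wpath x (Xs \<omega>)) n) \<partial>M)"
    let ?wp = "\<integral>\<omega>. F (Wp \<omega>) \<partial>N1" and ?wm = "\<integral>\<omega>. F (Wm \<omega>) \<partial>N2"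
    \<comment> \<open>Numerator and denominator both carry \<open>sqrt n\<close>, so the conditional
      expectation is a quotient of two convergent sequences with nonzero limit below.\<close>
    have "(\<lambda>n. ?E n / (sqrt (real n) * q x n)) \<longlonglongrightarrow> (?wp * Vplus x u + ?wm * (Vtot x u - Vplus x u)) / Vtot x u"
      using Vpos by (intro tendsto_divide lim[OF F] qlim) auto
    moreover have "\<forall>\<^sub>F n in sequentially. ?E n / (sqrt (real n) * q x n) = (\<integral>\<omega>. F (rescaled \<sigma> (wpath x (Xs \<omega>)) n) \<partial>?P n)"
      using eventually_ge_at_top[of 1]
    proof eventually_elim
      case (elim n)
      show ?case
        using qpos[OF elim] elim
        by (subst integral_uniform_measure[OF pred_survive _ functional_measurable_M[OF bF]]) (auto simp: q_def)
    qed
    moreover have "(?wp * Vplus x u + ?wm * (Vtot x u - Vplus x u)) / Vtot x u = (\<integral>\<omega>. F (?Y \<omega>) \<partial>?Q)"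
    proof -
      have "(?wp * Vplus x u + ?wm * (Vtot x u - Vplus x u)) / Vtot x u = p * ?wp + (1 - p) * ?wm"
        unfolding p_def using Vpos by (simp add: field_simps)
      then show ?thesis by (rule trans[OF _ integral_mixture[OF Wp_proc Wm_proc p bF, symmetric]])
    qed
    ultimately show "(\<lambda>n. \<integral>\<omega>. F (rescaled \<sigma> (wpath x (Xs \<omega>)) n) \<partial>?P n) \<longlonglongrightarrow> (\<integral>\<omega>. F (?Y \<omega>) \<partial>?Q)"
      by (simp add: tendsto_cong)
  qed
  then show ?thesis
    unfolding Let_def V_eq Vp_eq unfolding p_def[symmetric] walk_eq_wpath using p by blast
qed

end
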